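(* Let $\Phi,\Psi\in\overline{\varPhi}_Y$, $\varphi\in\mathcal{G}^{\rm dec}$ and $\rho:(0,\infty)\to(0,\infty)$. Assume that $\int_0^1\frac{\rho(t)}t\,dt<\infty$ and that there exist positive constants $C,K_1,K_2$ with $K_1<K_2$ such that $\sup_{r\le t\le2r}\rho(t)\le C\int_{K_1r}^{K_2r}\frac{\rho(t)}t\,dt$ for all $r>0$. (i) Assume that $\lim_{r\to0}\varphi(r)=\infty$ and $\lim_{r\to\infty}\varphi(r)=0$, and that there exists a positive constant $A$ such that, for all $r\in(0,\infty)$, $$\int_0^r\frac{\rho(t)}t\,dt\;\Phi^{-1}(\varphi(r))+\int_r^\infty\frac{\rho(t)\,\Phi^{-1}(\varphi(t))}t\,dt\le A\,\Psi^{-1}(\varphi(r)).\qquad( * )$$ Then, for any positive constant $C_0$, there exists a positive constant $C_1$ such that, for all $f\in L^{(\Phi,\varphi)}(\mathbb{R}^n)$ with $f\not\equiv0$, $$\Psi\left(\frac{|I_\rho f(x)|}{C_1\|f\|_{L^{(\Phi,\varphi)}}}\right)\le\Phi\left(\frac{Mf(x)}{C_0\|f\|_{L^{(\Phi,\varphi)}}}\right),\quad x\in\mathbb{R}^n.$$ Consequently, $I_\rho$ is bounded from $L^{(\Phi,\varphi)}(\mathbb{R}^n)$ to $\mathrm{w}L^{(\Psi,\varphi)}(\mathbb{R}^n)$. Moreover, if $\Phi\in\overline\nabla_2$, then, for all $f\in\mathrm{w}L^{(\Phi,\varphi)}(\mathbb{R}^n)$ with $f\not\equiv0$, $$\Psi\left(\frac{|I_\rho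 f(x)|}{C_1\|f\|_{\mathrm{w}L^{(\Phi,\varphi)}}}\right)\le\Phi\left(\frac{Mf(x)}{C_0\|f\|_{\mathrm{w}L^{(\Phi,\varphi)}}}\right),\quad x\in\mathbb{R}^n.$$ Consequently, if $\Phi\in\overline\nabla_2$, then $I_\rho$ is bounded from $L^{(\Phi,\varphi)}(\mathbb{R}^n)$ to $L^{(\Psi,\varphi)}(\mathbb{R}^n)$ and from $\mathrm{w}L^{(\Phi,\varphi)}(\mathbb{R}^n)$ to $\mathrm{w}L^{(\Psi,\varphi)}(\mathbb{R}^n)$. (ii) If $I_\rho$ is bounded from $L^{(\Phi,\varphi)}(\mathbb{R}^n)$ to $\mathrm{w}L^{(\Psi,\varphi)}(\mathbb{R}^n)$, then there exists a positive constant $A'$ such that, for all $r\in(0,\infty)$, $$\int_0^r\frac{\rho(t)}t\,dt\;\Phi^{-1}(\varphi(r))\le A'\,\Psi^{-1}(\varphi(r)).\qquad( ** )$$ Moreover, under the assumption that there exists a positive constant $C$ such that $\int_0^r\varphi(t)t^{n-1}\,dt\le C\varphi(r)r^n$ for all $r\in(0,\infty)$, if $I_\rho$ is bounded from $L^{(\Phi,\varphi)}(\mathbb{R}^n)$ to $\mathrm{w}L^{(\Psi,\varphi)}(\mathbb{R}^n)$, then $( * )$ holds for some $A\in(0,\infty)$ and for all $r\in(0,\infty)$. (iii) In part (ii), the boundedness from $L^{(\Phi,\varphi)}(\mathbb{R}^n)$ to $\mathrm{w}L^{(\Psi,\varphi)}(\mathbb{R}^n)$ can be replaced by the boundedness from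 $L^{(\Phi,\varphi)}(\mathbb{R}^n)$ to $L^{(1,\Psi^{-1}(\varphi))}(\mathbb{R}^n)$; that is, if $I_\rho$ is bounded from $L^{(\Phi,\varphi)}(\mathbb{R}^n)$ to $L^{(1,\Psi^{-1}(\varphi))}(\mathbb{R}^n)$, then $( ** )$ holds for some $A'\in(0,\infty)$ and all $r\in(0,\infty)$, and if in addition there is $C>0$ with $\int_0^r\varphi(t)t^{n-1}\,dt\le C\varphi(r)r^n$ for all $r\in(0,\infty)$, then $( * )$ holds for some $A\in(0,\infty)$ and all $r\in(0,\infty)$.
   Context: $|G|$ is the Lebesgue measure of $G\subset\mathbb{R}^n$; $B(a,r)$ is the open ball with center $a$ and radius $r$; $m(G,f,t)=|\{x\in G:|f(x)|>t\}|$. Functions appearing under integral signs are understood to be measurable. The generalized fractional integral operator is $I_\rho f(x)=\int_{\mathbb{R}^n}\frac{\rho(|x-y|)}{|x-y|^n}f(y)\,dy$. $M$ is the Hardy-Littlewood maximal operator, $Mf(x)=\sup_{B\ni x}\frac1{|B|}\int_B|f(y)|\,dy$, supremum over all balls $B$ containing $x$. An operator $T$ is bounded from $X$ to $Y$ if there is a constant $C>0$ with $\|Tf\|_Y\le C\|f\|_X$ for all $f\in X$. "Increasing" means nondecreasing. For an increasing $\Phi:[0,\infty]\to[0,\infty]$ let $a(\Phi)=\sup\{t\ge0:\Phi(t)=0\}$ and $b(\Phi)=\inf\{t\ge0:\Phi(t)=\infty\}$, with $\sup\emptyset=0$, $\inf\emptyset=\infty$. $\overline{\varPhi}$ is the set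 of all increasing $\Phi:[0,\infty]\to[0,\infty]$ such that: $0\le a(\Phi)<\infty$ and $0<b(\Phi)\le\infty$; $\lim_{t\to+0}\Phi(t)=\Phi(0)=0$; $\Phi$ is left continuous on $[0,b(\Phi))$; if $b(\Phi)=\infty$ then $\lim_{t\to\infty}\Phi(t)=\Phi(\infty)=\infty$; if $b(\Phi)<\infty$ then $\lim_{t\to b(\Phi)-0}\Phi(t)=\Phi(b(\Phi))$ $(\le\infty)$. For $\Phi\in\overline{\varPhi}$ the generalized inverse is $\Phi^{-1}(u)=\inf\{t\ge0:\Phi(t)>u\}$ for $u\in[0,\infty)$ and $\Phi^{-1}(\infty)=\infty$. $\Phi\in\overline{\varPhi}$ is a Young function if it is convex on $[0,b(\Phi))$; $\varPhi_Y$ is the set of Young functions. $\Phi\approx\Psi$ means there is $C>0$ with $\Phi(C^{-1}t)\le\Psi(t)\le\Phi(Ct)$ for all $t\in[0,\infty]$. $\overline{\varPhi}_Y$ is the set of all $\Phi\in\overline{\varPhi}$ such that $\Phi\approx\Psi$ for some $\Psi\in\varPhi_Y$. $\overline\nabla_2$ is the set of all $\Phi\in\overline{\varPhi}$ for which there is $k>1$ with $\Phi(t)\le\frac1{2k}\Phi(kt)$ for all $t>0$. $\mathcal{G}^{\rm dec}$ is the set of all $\varphi:(0,\infty)\to(0,\infty)$ for which there is $C>0$ such that $C\varphi(r)\ge\varphi(s)$ and $\varphi(r)r^n\le C\varphi(s)s^n$ whenever $0<r<s<\infty$. For $\Phi\in\overline{\varPhi}_Y$, $\varphi:(0,\infty)\to(0,\infty)$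 and $B=B(a,r)$, let $$\|f\|_{\Phi,\varphi,B}=\inf\Big\{\lambda>0:\frac1{\varphi(r)|B|}\int_B\Phi\Big(\frac{|f(x)|}\lambda\Big)dx\le1\Big\},\quad \|f\|_{\Phi,\varphi,B,\mathrm{weak}}=\inf\Big\{\lambda>0:\sup_{t\in(0,\infty)}\frac{\Phi(t)\,m(B,f/\lambda,t)}{|B|\varphi(r)}\le1\Big\}$$ (with $0\cdot\infty=0$). $L^{(\Phi,\varphi)}(\mathbb{R}^n)$ and $\mathrm{w}L^{(\Phi,\varphi)}(\mathbb{R}^n)$ are the sets of measurable $f$ on $\mathbb{R}^n$ with, respectively, $\|f\|_{L^{(\Phi,\varphi)}}=\sup_B\|f\|_{\Phi,\varphi,B}<\infty$ and $\|f\|_{\mathrm{w}L^{(\Phi,\varphi)}}=\sup_B\|f\|_{\Phi,\varphi,B,\mathrm{weak}}<\infty$, suprema over all balls $B$ in $\mathbb{R}^n$. $L^{(1,\psi)}(\mathbb{R}^n)$ is $L^{(\Phi,\psi)}(\mathbb{R}^n)$ for $\Phi(t)=t$, i.e. $\|f\|_{L^{(1,\psi)}}=\sup_{B=B(a,r)}\frac1{\psi(r)|B|}\int_B|f(x)|\,dx$; $\Psi^{-1}(\varphi)$ denotes the function $r\mapsto\Psi^{-1}(\varphi(r))$. *)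

theory Defs
  imports "HOL-Analysis.Analysis"
begin

section \<open>Generalized Young functions\<close>

text \<open>Functions from \<open>[0,\<infinity>]\<close> to \<open>[0,\<infinity>]\<close> are functions on \<^typ>\<open>ennreal\<close>; there
  \<open>Sup {} = 0\<close>, \<open>Inf {} = \<infinity>\<close> and \<open>0 * \<infinity> = 0\<close>.\<close>

definition a_of :: "(ennreal \<Rightarrow> ennreal) \<Rightarrow> ennreal" where
  "a_of \<Phi> = Sup {t. \<Phi> t = 0}"

definition b_of :: "(ennreal \<Rightarrow> ennreal) \<Rightarrow> ennreal" where
  "b_of \<Phi> = Inf {t. \<Phi> t = top}"

definition Phi_bar :: "(ennreal \<Rightarrow> ennreal) set" where
  "Phi_bar = {\<Phi>. mono \<Phi> \<and>
     a_of \<Phi> < top \<and> 0 < b_of \<Phi> \<and>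
     (\<Phi> \<longlongrightarrow> 0) (at_right 0) \<and> \<Phi> 0 = 0 \<and>
     (\<forall>t < b_of \<Phi>. (\<Phi> \<longlongrightarrow> \<Phi> t) (at_left t)) \<and>
     (b_of \<Phi> = top \<longrightarrow> (\<Phi> \<longlongrightarrow> top) (at_left top) \<and> \<Phi> top = top) \<and>
     (b_of \<Phi> < top \<longrightarrow> (\<Phi> \<longlongrightarrow> \<Phi> (b_of \<Phi>)) (at_left (b_of \<Phi>)))}"

definition gen_inv :: "(ennreal \<Rightarrow> ennreal) \<Rightarrow> ennreal \<Rightarrow> ennreal" where
  "gen_inv \<Phi> u = (if u = top then top else Inf {t. u < \<Phi> t})"

text \<open>Below \<open>b_of \<Phi>\<close> the function \<open>\<Phi>\<close> is finite, so \<^const>\<open>enn2real\<close> loses nothing there.\<close>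

definition Phi_Y :: "(ennreal \<Rightarrow> ennreal) set" where
  "Phi_Y = {\<Phi> \<in> Phi_bar.
     convex_on {t. 0 \<le> t \<and> ennreal t < b_of \<Phi>} (\<lambda>t. enn2real (\<Phi> (ennreal t)))}"

definition Phi_equiv :: "(ennreal \<Rightarrow> ennreal) \<Rightarrow> (ennreal \<Rightarrow> ennreal) \<Rightarrow> bool" where
  "Phi_equiv \<Phi> \<Psi> \<longleftrightarrow> (\<exists>C::real. C > 0 \<and>
     (\<forall>t. \<Phi> (ennreal (inverse C) * t) \<le> \<Psi> t \<and> \<Psi> t \<le> \<Phi> (ennreal C * t)))"

definition Phi_Y_bar :: "(ennreal \<Rightarrow> ennreal) set" where
  "Phi_Y_bar = {\<Phi> \<in> Phi_bar. \<exists>\<Psi> \<in> Phi_Y. Phi_equiv \<Phi> \<Psi>}"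

definition nabla2_bar :: "(ennreal \<Rightarrow> ennreal) set" where
  "nabla2_bar = {\<Phi> \<in> Phi_bar. \<exists>k::real. k > 1 \<and>
     (\<forall>t > 0. \<Phi> t \<le> ennreal (1 / (2 * k)) * \<Phi> (ennreal k * t))}"

text \<open>Functions on \<open>(0,\<infinity>)\<close> are functions on \<^typ>\<open>real\<close> whose values outside \<open>(0,\<infinity>)\<close> are
  irrelevant; the parameter \<open>n\<close> is the dimension of the underlying space.\<close>

definition G_dec :: "nat \<Rightarrow> (real \<Rightarrow> real) set" where
  "G_dec n = {\<phi>. (\<forall>r > 0. \<phi> r > 0) \<and>
     (\<exists>C > 0. \<forall>r s. 0 < r \<and> r < s \<longrightarrow>
        C * \<phi> r \<ge> \<phi> s \<and> \<phi> r * r ^ n \<le> C * (\<phi> s * s ^ n))}"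

text \<open>\<open>\<Psi>\<^sup>-\<^sup>1(\<phi>)\<close> as a real function: for \<open>\<Psi> \<in> Phi_bar\<close> and \<open>0 < \<phi> r\<close> the value
  \<open>gen_inv \<Psi> (\<phi> r)\<close> is positive and finite.\<close>

definition inv_comp :: "(ennreal \<Rightarrow> ennreal) \<Rightarrow> (real \<Rightarrow> real) \<Rightarrow> real \<Rightarrow> real" where
  "inv_comp \<Psi> \<phi> r = enn2real (gen_inv \<Psi> (ennreal (\<phi> r)))"

section \<open>Orlicz--Morrey spaces\<close>

text \<open>All norms take values in \<open>[0,\<infinity>]\<close>.\<close>

definition ball_norm ::
    "(ennreal \<Rightarrow> ennreal) \<Rightarrow> (real \<Rightarrow> real) \<Rightarrow> 'a::euclidean_space \<Rightarrow> real \<Rightarrow> ('a \<Rightarrow> real) \<Rightarrow> ennreal" where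
  "ball_norm \<Phi> \<phi> a r f =
     (INF c \<in> {c::real. c > 0 \<and>
        (\<integral>\<^sup>+x\<in>ball a r. \<Phi> (ennreal (\<bar>f x\<bar> / c)) \<partial>lebesgue)
          / (ennreal (\<phi> r) * emeasure lebesgue (ball a r)) \<le> 1}. ennreal c)"

definition distr_fun :: "'a::euclidean_space set \<Rightarrow> ('a \<Rightarrow> real) \<Rightarrow> real \<Rightarrow> ennreal" where
  "distr_fun G f t = emeasure lebesgue {x \<in> G. \<bar>f x\<bar> > t}"

definition weak_ball_norm ::
    "(ennreal \<Rightarrow> ennreal) \<Rightarrow> (real \<Rightarrow> real) \<Rightarrow> 'a::euclidean_space \<Rightarrow> real \<Rightarrow> ('a \<Rightarrow> real) \<Rightarrow> ennreal" where
  "weak_ball_norm \<Phi> \<phi> a r f =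
     (INF c \<in> {c::real. c > 0 \<and>
        (SUP t \<in> {0<..}. \<Phi> (ennreal t) * distr_fun (ball a r) (\<lambda>x. f x / c) t
          / (emeasure lebesgue (ball a r) * ennreal (\<phi> r))) \<le> 1}. ennreal c)"

definition L_norm ::
    "(ennreal \<Rightarrow> ennreal) \<Rightarrow> (real \<Rightarrow> real) \<Rightarrow> ('a::euclidean_space \<Rightarrow> real) \<Rightarrow> ennreal" where
  "L_norm \<Phi> \<phi> f = (SUP (a, r) \<in> UNIV \<times> {0<..}. ball_norm \<Phi> \<phi> a r f)"

definition wL_norm ::
    "(ennreal \<Rightarrow> ennreal) \<Rightarrow> (real \<Rightarrow> real) \<Rightarrow> ('a::euclidean_space \<Rightarrow> real) \<Rightarrow> ennreal" where
  "wL_norm \<Phi> \<phi> f = (SUP (a, r) \<in> UNIV \<times> {0<..}. weak_ball_norm \<Phi> \<phi> a r f)"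

definition L1_norm :: "(real \<Rightarrow> real) \<Rightarrow> ('a::euclidean_space \<Rightarrow> real) \<Rightarrow> ennreal" where
  "L1_norm \<psi> = L_norm (\<lambda>t. t) \<psi>"

definition fun_space :: "(('a::euclidean_space \<Rightarrow> real) \<Rightarrow> ennreal) \<Rightarrow> ('a \<Rightarrow> real) set" where
  "fun_space N = {f \<in> borel_measurable lebesgue. N f < top}"

section \<open>Operators\<close>

text \<open>The Bochner integral defining \<open>I\<^sub>\<rho> f(x)\<close> is \<open>0\<close> by convention when it does not converge
  absolutely, so convergence is recorded separately. At \<open>y = x\<close> the kernel is \<open>0\<close> by convention,
  which concerns only a null set.\<close>

definition frac_integrand :: "(real \<Rightarrow> real) \<Rightarrow> ('a::euclidean_space \<Rightarrow> real) \<Rightarrow> 'a \<Rightarrow> 'a \<Rightarrow> real" where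
  "frac_integrand \<rho> f x y = \<rho> (norm (x - y)) / norm (x - y) ^ DIM('a) * f y"

definition frac_converges :: "(real \<Rightarrow> real) \<Rightarrow> ('a::euclidean_space \<Rightarrow> real) \<Rightarrow> 'a \<Rightarrow> bool" where
  "frac_converges \<rho> f x \<longleftrightarrow> integrable lebesgue (frac_integrand \<rho> f x)"

definition frac_int :: "(real \<Rightarrow> real) \<Rightarrow> ('a::euclidean_space \<Rightarrow> real) \<Rightarrow> 'a \<Rightarrow> real" where
  "frac_int \<rho> f x = (\<integral>y. frac_integrand \<rho> f x y \<partial>lebesgue)"

definition maximal_fun :: "('a::euclidean_space \<Rightarrow> real) \<Rightarrow> 'a \<Rightarrow> ennreal" where
  "maximal_fun f x =
     (SUP (a, r) \<in> {(a, r). x \<in> ball a r}.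
        (\<integral>\<^sup>+y\<in>ball a r. ennreal \<bar>f y\<bar> \<partial>lebesgue) / emeasure lebesgue (ball a r))"

text \<open>Boundedness of \<open>I\<^sub>\<rho>\<close> from \<open>fun_space N\<close> to \<open>fun_space N'\<close> includes that \<open>I\<^sub>\<rho> f\<close> is well defined
  (almost everywhere) on the domain space.\<close>

definition frac_int_bounded ::
    "(real \<Rightarrow> real) \<Rightarrow> (('a::euclidean_space \<Rightarrow> real) \<Rightarrow> ennreal) \<Rightarrow> (('a \<Rightarrow> real) \<Rightarrow> ennreal) \<Rightarrow> bool" where
  "frac_int_bounded \<rho> N N' \<longleftrightarrow>
     (\<exists>C::real. C > 0 \<and> (\<forall>f \<in> fun_space N.
        (AE x in lebesgue. frac_converges \<rho> f x) \<and>
        frac_int \<rho> f \<in> fun_space N' \<and>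
        N' (frac_int \<rho> f) \<le> ennreal C * N f))"

text \<open>\<open>\<Psi>(|I\<^sub>\<rho> f(x)| / (C1 ||f||)) \<le> \<Phi>(M f(x) / (C0 ||f||))\<close>, where \<open>||f|| = N f\<close>. The conjunct on
  convergence excludes that the inequality holds merely because a divergent integral is
  conventionally \<open>0\<close>; where the right-hand side is \<open>\<infinity>\<close> the inequality says nothing about
  \<open>I\<^sub>\<rho> f(x)\<close>, which need not exist there.\<close>

definition pointwise_ineq ::
    "(ennreal \<Rightarrow> ennreal) \<Rightarrow> (ennreal \<Rightarrow> ennreal) \<Rightarrow> (real \<Rightarrow> real) \<Rightarrow>
      (('a::euclidean_space \<Rightarrow> real) \<Rightarrow> ennreal) \<Rightarrow> real \<Rightarrow> real \<Rightarrow> ('a \<Rightarrow> real) \<Rightarrow> 'a \<Rightarrow> bool" where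
  "pointwise_ineq \<Phi> \<Psi> \<rho> N C0 C1 f x \<longleftrightarrow>
     (\<Phi> (maximal_fun f x / (ennreal C0 * N f)) < top \<longrightarrow> frac_converges \<rho> f x) \<and>
     \<Psi> (ennreal \<bar>frac_int \<rho> f x\<bar> / (ennreal C1 * N f)) \<le> \<Phi> (maximal_fun f x / (ennreal C0 * N f))"

section \<open>Integral conditions\<close>

definition near_cond ::
    "(ennreal \<Rightarrow> ennreal) \<Rightarrow> (ennreal \<Rightarrow> ennreal) \<Rightarrow> (real \<Rightarrow> real) \<Rightarrow> (real \<Rightarrow> real) \<Rightarrow> real \<Rightarrow> bool" where
  "near_cond \<Phi> \<Psi> \<phi> \<rho> A \<longleftrightarrow> (\<forall>r > 0.
     (\<integral>\<^sup>+t\<in>{0<..<r}. ennreal (\<rho> t / t) \<partial>lebesgue) * gen_inv \<Phi> (ennreal (\<phi> r))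
       \<le> ennreal A * gen_inv \<Psi> (ennreal (\<phi> r)))"

definition full_cond ::
    "(ennreal \<Rightarrow> ennreal) \<Rightarrow> (ennreal \<Rightarrow> ennreal) \<Rightarrow> (real \<Rightarrow> real) \<Rightarrow> (real \<Rightarrow> real) \<Rightarrow> real \<Rightarrow> bool" where
  "full_cond \<Phi> \<Psi> \<phi> \<rho> A \<longleftrightarrow> (\<forall>r > 0.
     (\<integral>\<^sup>+t\<in>{0<..<r}. ennreal (\<rho> t / t) \<partial>lebesgue) * gen_inv \<Phi> (ennreal (\<phi> r))
       + (\<integral>\<^sup>+t\<in>{r<..}. ennreal (\<rho> t / t) * gen_inv \<Phi> (ennreal (\<phi> t)) \<partial>lebesgue)
       \<le> ennreal A * gen_inv \<Psi> (ennreal (\<phi> r)))"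

definition phi_int_cond :: "nat \<Rightarrow> (real \<Rightarrow> real) \<Rightarrow> bool" where
  "phi_int_cond n \<phi> \<longleftrightarrow> (\<exists>C > 0. \<forall>r > 0.
     (\<integral>\<^sup>+t\<in>{0<..<r}. ennreal (\<phi> t * t ^ (n - 1)) \<partial>lebesgue) \<le> ennreal (C * (\<phi> r * r ^ n)))"

end

theory Submission
  imports Defs
begin

text \<open>
  A function equivalent to a Young function satisfies \<open>\<Phi>(\<theta> t) \<le> \<theta> \<Phi>(K t)\<close> for \<open>0 \<le> \<theta> \<le> 1\<close>, and this
  inequality replaces convexity throughout. It bounds the average of \<open>|f|\<close> over a ball of radius \<open>r\<close>
  by a multiple of \<open>\<Phi>\<^sup>-\<^sup>1(\<phi>(r)) \<parallel>f\<parallel>\<close>; for weak norms \<open>\<nabla>\<^sub>2\<close> does the same by summing over the levels \<open>k\<^sup>j\<close>.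

  Since \<open>\<rho>(s) \<le> C \<integral> \<rho>(t)/t dt\<close> over \<open>K1 s < t < K2 s\<close>, Fubini's theorem bounds the part \<open>|x - y| < R\<close> of
  \<open>I\<^sub>\<rho> f(x)\<close> by \<open>M f(x)\<close> times the integral of \<open>\<rho>(t)/t\<close> over \<open>(0, K2 R)\<close>, and the part \<open>|x - y| \<ge> R\<close> by \<open>\<parallel>f\<parallel>\<close> times the
  integral of \<open>\<rho>(t) \<Phi>\<^sup>-\<^sup>1(\<phi>(t))/t\<close> over \<open>(K1 R, \<infinity>)\<close>. Choosing \<open>R\<close> such that \<open>\<phi>(R)\<close> is comparable to
  \<open>\<Phi>(M f(x) / (C0 \<parallel>f\<parallel>))\<close> gives the pointwise inequality. Boundedness follows from modular estimates of
  \<open>M\<close>: where \<open>M f > 2 t\<close> on a ball \<open>B\<close> and \<open>t\<close> is large against \<open>\<Phi>\<^sup>-\<^sup>1(\<phi>(r)) \<parallel>f\<parallel>\<close>, only \<open>f\<close> on \<open>2B\<close> above the level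
  \<open>t\<close> matters, and Vitali's covering lemma applies.

  The conditions are necessary because \<open>I\<^sub>\<rho>\<close> of the indicator function of \<open>B(0, 2r)\<close>, and of the
  function \<open>\<Phi>\<^sup>-\<^sup>1(\<phi>(|y|))\<close>, is on \<open>B(0, r)\<close> at least a constant times the first, respectively the second,
  integral in the condition.
\<close>

section \<open>Radial integrals\<close>

text \<open>Three obstacles shape the proof. First, infima give only strict comparisons: in
  \<open>quasi_young\<close>, \<open>t < gen_inv \<Phi> u\<close> yields
  \<open>\<Phi> t \<le> u\<close>, but equality need not, and a norm need not itself be an
  admissible scaling. Hence the recurring factors 2: f is divided by twice its norm, and levels are
  taken at \<open>2 * G r\<close> or \<open>G r / 2\<close>. Second, \<phi> may jump, so no radius
  need solve \<phi>(R) = u; the two growth bounds on \<phi> still give an R solving it up to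
  \<open>D * 2 ^ n\<close>, and \<open>G_comp\<close> absorbs every fixed dilation of the radius, by
  2, K1 or K2. Third, \<rho> and f are merely Lebesgue measurable, while Fubini and the composition
  with \<open>norm (x - y)\<close> want Borel functions; Borel versions are substituted, and polar
  coordinates turn a null set of radii into a null set of points. The estimates are proved for
  modular inequalities of normalised functions, and norms enter only at both ends.\<close>

definition sphere_area :: "'a::euclidean_space itself \<Rightarrow> real" where
  "sphere_area _ = real DIM('a) * unit_ball_vol (real DIM('a))"

lemma sphere_area_pos: "sphere_area TYPE('a::euclidean_space) > 0"
  by (simp add: sphere_area_def)

text \<open>Polar coordinates without a measure on the sphere: both sides give each half-line the
  volume of a ball, the density being the derivative of that volume in the radius. The half-lines
  form a generator stable under intersection.\<close>

lemma distr_norm_lborel: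
  "distr (lborel :: 'a::euclidean_space measure) borel norm =
     density lborel (\<lambda>t. ennreal (sphere_area TYPE('a) * t ^ (DIM('a) - 1)) * indicator {0<..} t)"
  (is "?M = ?N")
proof (rule measure_eqI_generator_eq)
  let ?n = "DIM('a)" let ?w = "unit_ball_vol (real DIM('a))"
  show "Int_stable (range (\<lambda>a::real. {..a}))"
    by (auto simp: Int_stable_def)
  show "range (\<lambda>a::real. {..a}) \<subseteq> Pow UNIV" by auto
  show sN: "sets ?N = sigma_sets UNIV (range (\<lambda>a::real. {..a}))"
    by (simp add: borel_eq_atMost)
  show "sets ?M = sigma_sets UNIV (range (\<lambda>a::real. {..a}))"
    by (simp add: borel_eq_atMost)
  have M: "emeasure ?M {..a} = ennreal (if a < 0 then 0 else ?w * a ^ ?n)" for a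
  proof -
    have "emeasure ?M {..a} = emeasure lborel (norm -` {..a} \<inter> space lborel :: 'a set)"
      by (intro emeasure_distr) auto
    also have "norm -` {..a} \<inter> space lborel = (cball 0 a :: 'a set)"
      by auto
    finally show ?thesis by (auto simp: emeasure_cball)
  qed
  have N: "emeasure ?N {..a} = ennreal (if a < 0 then 0 else ?w * a ^ ?n)" for a
  proof -
    have "emeasure ?N {..a} = (\<integral>\<^sup>+t. ennreal (sphere_area TYPE('a) * t ^ (?n - 1)) * indicator {0<..} t * indicator {..a} t \<partial>lborel)"
      by (intro emeasure_density) auto
    also have "\<dots> = (\<integral>\<^sup>+t. ennreal (sphere_area TYPE('a) * t ^ (?n - 1)) * indicator {0..a} t \<partial>lborel)"
    \<comment> \<open>The two products of indicators differ only at t = 0.\<close>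
    proof (rule nn_integral_cong_AE)
      have "AE t in lborel. t \<noteq> (0::real)" by (simp add: AE_lborel_singleton)
      then show "AE t in lborel. ennreal (sphere_area TYPE('a) * t ^ (?n - 1)) * indicator {0<..} t * indicator {..a} t
         = ennreal (sphere_area TYPE('a) * t ^ (?n - 1)) * indicator {0..a} t"
        by eventually_elim (auto simp: indicator_def)
    qed
    also have "\<dots> = ennreal (if a < 0 then 0 else ?w * a ^ ?n)"
    proof (cases "a < 0")
      case True
      then show ?thesis by simp
    next
      case False
      have "(\<integral>\<^sup>+t. ennreal (sphere_area TYPE('a) * t ^ (?n - 1)) * indicator {0..a} t \<partial>lborel)
         = ?w * a ^ ?n - ?w * 0 ^ ?n"
      proof (rule nn_integral_FTC_Icc)
        show "(\<lambda>t. sphere_area TYPE('a) * t ^ (?n - 1)) \<in> borel_measurable borel" by simp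
        show "((\<lambda>t. ?w * t ^ ?n) has_real_derivative sphere_area TYPE('a) * x ^ (?n - 1)) (at x)" for x
          by (auto intro!: derivative_eq_intros simp: sphere_area_def)
        show "0 \<le> sphere_area TYPE('a) * x ^ (?n - 1)" if "x \<in> {0..a}" for x
          using that by (simp add: sphere_area_def)
        show "0 \<le> a" using False by simp
      qed
      then show ?thesis using False by (simp add: zero_power)
    qed
    finally show ?thesis .
  qed
  show "emeasure ?M X = emeasure ?N X" if "X \<in> range (\<lambda>a::real. {..a})" for X
    using that M N by auto
  show "range (\<lambda>i::nat. {..real i}) \<subseteq> range (\<lambda>a::real. {..a})" by auto
  show "(\<Union>i::nat. {..real i}) = UNIV"
    by (auto simp: real_arch_simple)
  show "emeasure ?M {..real i} \<noteq> \<infinity>" for i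
    by (simp add: M)
qed

lemma nn_integral_radial:
  fixes g :: "real \<Rightarrow> ennreal"
  assumes [measurable]: "g \<in> borel_measurable borel"
  shows "(\<integral>\<^sup>+y. g (norm (y :: 'a::euclidean_space)) \<partial>lborel) =
    (\<integral>\<^sup>+t\<in>{0<..}. ennreal (sphere_area TYPE('a) * t ^ (DIM('a) - 1)) * g t \<partial>lborel)"
proof -
  have "(\<integral>\<^sup>+y. g (norm (y :: 'a)) \<partial>lborel) = (\<integral>\<^sup>+t. g t \<partial>distr (lborel :: 'a measure) borel norm)"
    by (subst nn_integral_distr) auto
  also have "\<dots> = (\<integral>\<^sup>+t. ennreal (sphere_area TYPE('a) * t ^ (DIM('a) - 1)) * indicator {0<..} t * g t \<partial>lborel)"
    unfolding distr_norm_lborel by (subst nn_integral_density) auto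
  finally show ?thesis by (simp add: mult_ac)
qed

text \<open>The power of t from polar coordinates against the power in the kernel leaves 1/t, which
  is why every condition on \<rho> is stated with \<open>\<rho> t / t\<close>.\<close>

lemma nn_integral_radial_kernel:
  fixes g :: "real \<Rightarrow> ennreal"
  assumes [measurable]: "g \<in> borel_measurable borel" "\<rho> \<in> borel_measurable borel"
    and nn: "\<And>t. 0 \<le> \<rho> t"
  shows "(\<integral>\<^sup>+y. ennreal (\<rho> (norm y) / norm y ^ DIM('a)) * g (norm (y :: 'a::euclidean_space)) \<partial>lborel) =
    ennreal (sphere_area TYPE('a)) * (\<integral>\<^sup>+t\<in>{0<..}. ennreal (\<rho> t / t) * g t \<partial>lborel)"
proof -
  have "(\<integral>\<^sup>+y. ennreal (\<rho> (norm y) / norm y ^ DIM('a)) * g (norm (y :: 'a)) \<partial>lborel) =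
     (\<integral>\<^sup>+t\<in>{0<..}. ennreal (sphere_area TYPE('a) * t ^ (DIM('a) - 1)) * (ennreal (\<rho> t / t ^ DIM('a)) * g t) \<partial>lborel)"
    by (rule nn_integral_radial) simp
  also have "\<dots> = (\<integral>\<^sup>+t. ennreal (sphere_area TYPE('a)) * (ennreal (\<rho> t / t) * g t * indicator {0<..} t) \<partial>lborel)"
  proof (rule nn_integral_cong)
    fix t :: real
    have "ennreal (sphere_area TYPE('a) * t ^ (DIM('a) - 1)) * ennreal (\<rho> t / t ^ DIM('a)) = ennreal (sphere_area TYPE('a)) * ennreal (\<rho> t / t)"
      if "t > 0"
    proof -
      have "t ^ DIM('a) = t * t ^ (DIM('a) - 1)"
        by (metis DIM_positive power_eq_if not_gr_zero)
      then show ?thesis using that nn[of t] less_imp_le[OF sphere_area_pos[where 'a='a]]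
        by (simp add: ennreal_mult[symmetric])
    qed
    then show "ennreal (sphere_area TYPE('a) * t ^ (DIM('a) - 1)) * (ennreal (\<rho> t / t ^ DIM('a)) * g t) * indicator {0<..} t
      = ennreal (sphere_area TYPE('a)) * (ennreal (\<rho> t / t) * g t * indicator {0<..} t)"
      by (auto simp: indicator_def mult.assoc[symmetric])
  qed
  finally show ?thesis by (simp add: nn_integral_cmult)
qed

text \<open>Polar coordinates give volume 0 to the points whose norm lies in a null set of radii,
  and a translation moves the centre to x. This justifies changing \<rho> on a null set inside the
  kernel.\<close>

lemma AE_norm_lborel:
  assumes "AE t in lborel. 0 < t \<longrightarrow> P (t::real)"
  shows "AE y in lborel. y \<noteq> x \<longrightarrow> P (norm (x - y :: 'a::euclidean_space))"
proof -
  obtain N where N: "N \<in> null_sets lborel" "{t. \<not> (0 < t \<longrightarrow> P t)} \<subseteq> N"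
    using assms unfolding eventually_ae_filter by auto
  have N': "P t" if "0 < t" "t \<notin> N" for t using N(2) that by blast
  have [measurable]: "N \<in> sets borel" using N by auto
  have AEN: "AE t in lborel. t \<notin> N"
    using N by (rule_tac AE_not_in)
  have "(\<integral>\<^sup>+y. indicator N (norm (y :: 'a)) \<partial>lborel) =
     (\<integral>\<^sup>+t\<in>{0<..}. ennreal (sphere_area TYPE('a) * t ^ (DIM('a) - 1)) * indicator N t \<partial>lborel)"
    by (rule nn_integral_radial) simp
  also have "\<dots> = (\<integral>\<^sup>+t. 0 \<partial>(lborel :: real measure))"
    by (rule nn_integral_cong_AE) (use AEN in eventually_elim, auto)
  finally have "(\<integral>\<^sup>+y. indicator N (norm (y :: 'a)) \<partial>lborel) = 0" by simp
  then have "AE y in lborel. norm (y::'a) \<notin> N"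
    by (subst (asm) nn_integral_0_iff_AE) (auto elim!: eventually_mono simp: indicator_def split: if_splits)
  then have "AE y in distr lborel borel (\<lambda>y. -x + y). norm (y::'a) \<notin> N"
    by (subst lborel_distr_plus)
  then have "AE y in lborel. norm (-x + y::'a) \<notin> N"
    by (subst (asm) AE_distr_iff) auto
  then show ?thesis
  proof eventually_elim
    case (elim y)
    moreover have "norm (-x + y) = norm (x - y)" by (simp add: norm_minus_commute)
    ultimately show ?case using N'[of "norm (x - y)"] by auto
  qed
qed

section \<open>Generalized Young functions up to equivalence\<close>

lemma ennreal_divide_le_iff:
  fixes x y :: ennreal
  assumes "0 < y" "y < top"
  shows "x / y \<le> z \<longleftrightarrow> x \<le> z * y"
proof
  assume "x / y \<le> z"
  then have "x / y * y \<le> z * y" by (intro mult_right_mono) auto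
  moreover have "x / y * y = x"
    using assms by (simp add: ennreal_divide_times ennreal_divide_self)
  ultimately show "x \<le> z * y" by simp
next
  assume "x \<le> z * y"
  then show "x / y \<le> z" using assms by (intro divide_le_posI_ennreal) (auto simp: mult.commute)
qed

text \<open>Superlevel sets of a monotone function are upward closed, hence closed or open rays
  starting at their infimum.\<close>

lemma borel_measurable_mono_ennreal:
  fixes f :: "ennreal \<Rightarrow> ennreal"
  assumes "mono f"
  shows "f \<in> borel_measurable borel"
proof (rule borel_measurableI_greater)
  fix y
  define S where "S = {x. y < f x}"
  have up: "b \<in> S" if "a \<in> S" "a \<le> b" for a b
    using that assms monoD[OF assms, of a b] by (auto simp: S_def)
  have "S = (if Inf S \<in> S then {Inf S..} else {Inf S<..})"
  proof (cases "Inf S \<in> S")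
    case True
    then show ?thesis using up Inf_lower[of _ S] by auto
  next
    case False
    have "x \<in> S \<longleftrightarrow> Inf S < x" for x
    proof
      assume "x \<in> S"
      then show "Inf S < x" using Inf_lower[of x S] False by (cases "Inf S = x") auto
    next
      assume "Inf S < x"
      then obtain a where "a \<in> S" "a < x" by (auto simp: Inf_less_iff)
      then show "x \<in> S" using up by auto
    qed
    then show ?thesis using False by auto
  qed
  then have "S \<in> sets borel" by (metis atLeast_borel greaterThan_borel)
  then show "{x \<in> space borel. y < f x} \<in> sets borel" by (simp add: S_def)
qed

text \<open>\<open>scale\<close> is what equivalence preserves of convexity together with \<Phi>(0)
  = 0. \<open>small\<close> and \<open>large\<close> express the limits at 0 and \<infinity> in a
  form that also covers a jump to \<infinity>; they make \<open>gen_inv \<Phi>\<close> positive and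
  finite at positive finite arguments.\<close>

locale quasi_young =
  fixes \<Phi> :: "ennreal \<Rightarrow> ennreal" and K :: real
  assumes mono: "mono \<Phi>"
    and K_ge_1: "1 \<le> K"
    and scale: "0 \<le> \<theta> \<Longrightarrow> \<theta> \<le> 1 \<Longrightarrow> \<Phi> (ennreal \<theta> * t) \<le> ennreal \<theta> * \<Phi> (ennreal K * t)"
    and small: "0 < v \<Longrightarrow> \<exists>\<epsilon>>0. \<Phi> \<epsilon> < v"
    and large: "u < top \<Longrightarrow> \<exists>t<top. u < \<Phi> t"
begin

lemma mono': "s \<le> t \<Longrightarrow> \<Phi> s \<le> \<Phi> t"
  using mono by (auto simp: mono_def)

lemma zero [simp]: "\<Phi> 0 = 0"
  using scale[of 0 0] by simp

lemma top [simp]: "\<Phi> top = top"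
proof (rule ccontr)
  assume "\<Phi> top \<noteq> top"
  then obtain t where "\<Phi> top < \<Phi> t" using large[of "\<Phi> top"] by (auto simp: less_top)
  then show False using mono'[of t top] by auto
qed

lemma measurable_Phi [measurable]: "\<Phi> \<in> borel_measurable borel"
  by (rule borel_measurable_mono_ennreal[OF mono])

text \<open>This is \<open>scale\<close> at \<theta> = K c / s, applied after t has been rescaled by
  s / K; the second hypothesis is exactly \<theta> \<le> 1.\<close>

lemma scale_real:
  assumes "0 < c" "K * c \<le> s" 
  shows "\<Phi> (ennreal c * t) \<le> ennreal (K * c / s) * \<Phi> (ennreal s * t)"
proof -
  have s: "0 < s" using assms K_ge_1 by (smt (verit) mult_pos_pos)
  have "\<Phi> (ennreal c * t) = \<Phi> (ennreal (K * c / s) * (ennreal (s / K) * t))"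
    using assms K_ge_1 s by (simp add: mult.assoc[symmetric] ennreal_mult[symmetric])
  also have "\<dots> \<le> ennreal (K * c / s) * \<Phi> (ennreal K * (ennreal (s / K) * t))"
    using assms K_ge_1 s by (intro scale) auto
  also have "ennreal K * (ennreal (s / K) * t) = ennreal s * t"
    using K_ge_1 s by (simp add: mult.assoc[symmetric] ennreal_mult[symmetric])
  finally show ?thesis .
qed

text \<open>The infimum defining \<open>gen_inv\<close> may be attained, and then \<Phi> exceeds u
  at that point, so the hypothesis has to be strict, whereas \<open>le_gen_inv\<close> tolerates
  equality.\<close>

lemma gen_inv_lessD: "t < gen_inv \<Phi> u \<Longrightarrow> \<Phi> t \<le> u"
  unfolding gen_inv_def using Inf_lower[of t "{t. u < \<Phi> t}"]
  by (cases "u < \<Phi> t") (auto split: if_splits)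

lemma le_gen_inv: "\<Phi> t \<le> u \<Longrightarrow> t \<le> gen_inv \<Phi> u"
  unfolding gen_inv_def
proof (auto intro!: Inf_greatest)
  fix s assume "\<Phi> t \<le> u" "u < \<Phi> s"
  then show "t \<le> s" using mono'[of s t] by (cases "s \<le> t") auto
qed

lemma gen_inv_le: "u < \<Phi> t \<Longrightarrow> gen_inv \<Phi> u \<le> t"
  using gen_inv_lessD[of t u] by (cases "t < gen_inv \<Phi> u") auto

lemma gen_inv_mono: "u \<le> v \<Longrightarrow> gen_inv \<Phi> u \<le> gen_inv \<Phi> v"
proof (rule dense_le)
  fix t assume "u \<le> v" "t < gen_inv \<Phi> u"
  then show "t \<le> gen_inv \<Phi> v" using gen_inv_lessD[of t u] by (intro le_gen_inv) auto
qed

lemma gen_inv_pos: "0 < u \<Longrightarrow> 0 < gen_inv \<Phi> u"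
  using small[of u] le_gen_inv[of _ u] by (meson less_imp_le order_less_le_trans)

lemma gen_inv_less_top: "u < top \<Longrightarrow> gen_inv \<Phi> u < top"
  using large[of u] gen_inv_le[of u] by (meson order_le_less_trans)

text \<open>Dual of \<open>scale\<close>: if u < \<Phi>(s), then \<open>scale\<close> with \<theta>
  = 1 / L gives L u < \<Phi>(K L s). So the inverse grows at most linearly, up to the factor
  K.\<close>

lemma gen_inv_scale:
  assumes "1 \<le> L"
  shows "gen_inv \<Phi> (ennreal L * u) \<le> ennreal (K * L) * gen_inv \<Phi> u"
proof (cases "u = top")
  case True
  then show ?thesis using assms K_ge_1 by (simp add: gen_inv_def ennreal_mult_top)
next
  case False
  have "gen_inv \<Phi> (ennreal L * u) / ennreal (K * L) \<le> gen_inv \<Phi> u"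
  proof (rule dense_ge)
    fix s assume "gen_inv \<Phi> u < s"
    then have "u < \<Phi> s" using le_gen_inv[of s u] by (metis not_less)
    have "\<Phi> s = \<Phi> (ennreal (1 / L) * (ennreal L * s))"
      using assms by (simp add: mult.assoc[symmetric] ennreal_mult[symmetric])
    also have "\<dots> \<le> ennreal (1 / L) * \<Phi> (ennreal K * (ennreal L * s))"
      using assms by (intro scale) auto
    finally have "u < ennreal (1 / L) * \<Phi> (ennreal (K * L) * s)"
      using \<open>u < \<Phi> s\<close> K_ge_1 assms by (simp add: mult.assoc[symmetric] ennreal_mult[symmetric])
    then have "ennreal L * u < ennreal L * (ennreal (1 / L) * \<Phi> (ennreal (K * L) * s))"
      using assms by (intro ennreal_mult_strict_left_mono) auto
    also have "\<dots> = \<Phi> (ennreal (K * L) * s)"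
      using assms by (simp add: mult.assoc[symmetric] ennreal_mult[symmetric])
    finally have "gen_inv \<Phi> (ennreal L * u) \<le> ennreal (K * L) * s" by (rule gen_inv_le)
    then show "gen_inv \<Phi> (ennreal L * u) / ennreal (K * L) \<le> s"
      using assms K_ge_1 by (subst ennreal_divide_le_iff) (auto simp: mult.commute)
  qed
  then show ?thesis using assms K_ge_1 by (subst (asm) ennreal_divide_le_iff) (auto simp: mult.commute)
qed

end

lemma Phi_bar_eq_topI:
  assumes "\<Phi> \<in> Phi_bar" "b_of \<Phi> < t"
  shows "\<Phi> t = top"
proof -
  obtain s where "\<Phi> s = top" "s < t" using assms(2) unfolding b_of_def Inf_less_iff by auto
  moreover have "\<Phi> s \<le> \<Phi> t" using assms(1) \<open>s < t\<close> by (auto simp: Phi_bar_def mono_def)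
  ultimately show ?thesis by (simp add: top.extremum_unique)
qed

lemma Phi_bar_top:
  assumes "\<Phi> \<in> Phi_bar" shows "\<Phi> top = top"
  using assms Phi_bar_eq_topI[OF assms, of top] 
  by (cases "b_of \<Phi> = top") (auto simp: Phi_bar_def less_top)

text \<open>Below \<open>b_of \<Psi>\<close> this is convexity between 0 and t. The factor 2 serves
  the remaining t: \<Psi> may still be finite at \<open>b_of \<Psi>\<close>, but 2 t lies beyond it
  and makes the right-hand side \<infinity> for \<theta> > 0.\<close>

lemma Phi_Y_scale:
  assumes Y: "\<Psi> \<in> Phi_Y" and \<theta>: "0 \<le> \<theta>" "\<theta> \<le> 1"
  shows "\<Psi> (ennreal \<theta> * t) \<le> ennreal \<theta> * \<Psi> (2 * t)"
proof (cases "\<theta> = 0")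
  case True
  then show ?thesis using Y by (simp add: Phi_Y_def Phi_bar_def)
next
  case \<theta>0: False
  have bar: "\<Psi> \<in> Phi_bar" using Y by (simp add: Phi_Y_def)
  have 0: "\<Psi> 0 = 0" and mono: "mono \<Psi>" and b: "0 < b_of \<Psi>" using bar by (auto simp: Phi_bar_def)
  show ?thesis
  proof (cases "t < b_of \<Psi>")
    case True
    then have "t < top" by (metis less_top order_less_le_trans top_greatest)
    then obtain s where s: "t = ennreal s" "0 \<le> s" by (cases t) auto
    have fin: "\<Psi> x < top" if "x < b_of \<Psi>" for x
      using that unfolding b_of_def by (meson Inf_lower leD less_top mem_Collect_eq)
    have "enn2real (\<Psi> (ennreal (\<theta> *\<^sub>R s + (1 - \<theta>) *\<^sub>R 0))) \<le> \<theta> * enn2real (\<Psi> (ennreal s)) + (1 - \<theta>) * enn2real (\<Psi> (ennreal 0))"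
    proof -
      have "convex_on {t. 0 \<le> t \<and> ennreal t < b_of \<Psi>} (\<lambda>t. enn2real (\<Psi> (ennreal t)))"
        using Y by (simp add: Phi_Y_def)
      from convex_onD[OF this, of "1 - \<theta>" s 0] show ?thesis
        using s True b \<theta> by simp
    qed
    then have "enn2real (\<Psi> (ennreal (\<theta> * s))) \<le> \<theta> * enn2real (\<Psi> (ennreal s))"
      using 0 by simp
    then have "ennreal (enn2real (\<Psi> (ennreal (\<theta> * s)))) \<le> ennreal (\<theta> * enn2real (\<Psi> (ennreal s)))"
      by (rule ennreal_leI)
    moreover have "ennreal (\<theta> * s) \<le> t" using s \<theta> by (auto intro!: ennreal_leI simp: mult_left_le_one_le)
    moreover have "\<Psi> (ennreal (\<theta> * s)) < top" using calculation(2) True by (intro fin) auto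
    moreover have "\<Psi> t < top" using fin True by simp
    ultimately have "\<Psi> (ennreal \<theta> * t) \<le> ennreal \<theta> * \<Psi> t"
      using s \<theta> by (simp add: ennreal_mult ennreal_enn2real)
    also have "\<dots> \<le> ennreal \<theta> * \<Psi> (2 * t)"
    proof -
      have "1 * t \<le> 2 * t" by (intro mult_right_mono) auto
      then show ?thesis using mono by (intro mult_left_mono) (auto simp: mono_def)
    qed
    finally show ?thesis .
  next
    case False
    have "\<Psi> (2 * t) = top"
    proof (cases "t = top")
      case True
      then show ?thesis using Phi_bar_top[OF bar] by (simp add: ennreal_mult_top)
    next
      case False
      then obtain s where s: "t = ennreal s" "0 \<le> s" by (cases t) auto
      have "b_of \<Psi> \<le> t" using \<open>\<not> t < b_of \<Psi>\<close> by simp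
      moreover have "t < 2 * t"
      proof -
        have "0 < t" using b \<open>b_of \<Psi> \<le> t\<close> by order
        then have "0 < s" using s by (simp add: ennreal_less_zero_iff)
        then show ?thesis using s by (simp flip: ennreal_numeral ennreal_mult add: ennreal_lessI)
      qed
      ultimately show ?thesis by (intro Phi_bar_eq_topI[OF bar]) order
    qed
    then show ?thesis using \<theta> \<theta>0 by (simp add: ennreal_mult_top)
  qed
qed

lemma Phi_Y_bar_quasi_young:
  assumes "\<Phi> \<in> Phi_Y_bar"
  obtains K where "quasi_young \<Phi> K"
proof -
  from assms obtain \<Psi> C where \<Phi>: "\<Phi> \<in> Phi_bar" and \<Psi>: "\<Psi> \<in> Phi_Y" and C: "C > (0::real)"
    and eq: "\<And>t. \<Phi> (ennreal (inverse C) * t) \<le> \<Psi> t" "\<And>t. \<Psi> t \<le> \<Phi> (ennreal C * t)"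
    by (auto simp: Phi_Y_bar_def Phi_equiv_def)
  \<comment> \<open>One C for each direction of the equivalence, and 2 from
    \<open>Phi_Y_scale\<close>.\<close>
  define K where "K = max 1 (2 * C * C)"
  have mono: "mono \<Phi>" using \<Phi> by (simp add: Phi_bar_def)
  have "quasi_young \<Phi> K"
  proof
    show "mono \<Phi>" by fact
    show "1 \<le> K" by (simp add: K_def)
    show "\<Phi> (ennreal \<theta> * t) \<le> ennreal \<theta> * \<Phi> (ennreal K * t)" if \<theta>: "0 \<le> \<theta>" "\<theta> \<le> 1" for \<theta> t
    proof -
      have "\<Phi> (ennreal \<theta> * t) = \<Phi> (ennreal (inverse C) * (ennreal \<theta> * (ennreal C * t)))"
      proof -
        have "ennreal (inverse C) * (ennreal \<theta> * (ennreal C * t)) = (ennreal (inverse C) * ennreal \<theta> * ennreal C) * t"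
          by (simp only: mult.assoc)
        also have "ennreal (inverse C) * ennreal \<theta> * ennreal C = ennreal \<theta>"
          using C \<theta> by (simp add: ennreal_mult[symmetric])
        finally show ?thesis by simp
      qed
      also have "\<dots> \<le> \<Psi> (ennreal \<theta> * (ennreal C * t))" by (rule eq)
      also have "\<dots> \<le> ennreal \<theta> * \<Psi> (2 * (ennreal C * t))" by (rule Phi_Y_scale[OF \<Psi> \<theta>])
      also have "\<dots> \<le> ennreal \<theta> * \<Phi> (ennreal C * (2 * (ennreal C * t)))"
        by (intro mult_left_mono eq) auto
      also have "\<dots> \<le> ennreal \<theta> * \<Phi> (ennreal K * t)"
      proof -
        have "ennreal C * (2 * (ennreal C * t)) = (ennreal C * ennreal 2 * ennreal C) * t"
          by (simp add: mult.assoc)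
        also have "ennreal C * ennreal 2 * ennreal C = ennreal (2 * C * C)"
          using C by (simp add: ennreal_mult[symmetric] mult_ac del: ennreal_numeral)
        also have "ennreal (2 * C * C) * t \<le> ennreal K * t"
          by (intro mult_right_mono ennreal_leI) (auto simp: K_def)
        finally show ?thesis using mono by (intro mult_left_mono) (auto simp: mono_def)
      qed
      finally show ?thesis .
    qed
    show "\<exists>\<epsilon>>0. \<Phi> \<epsilon> < v" if "0 < v" for v
    proof -
      have "(\<Phi> \<longlongrightarrow> 0) (at_right 0)" using \<Phi> by (simp add: Phi_bar_def)
      then have "eventually (\<lambda>t. \<Phi> t < v) (at_right 0)" using that by (rule order_tendstoD(2))
      then obtain b where b: "b > 0" "\<And>z. 0 < z \<Longrightarrow> z < b \<Longrightarrow> \<Phi> z < v"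
        using eventually_at_right[of 0 "1::ennreal"] by auto
      obtain z where "0 < z" "z < b" using dense[OF b(1)] by auto
      then show ?thesis using b by auto
    qed
    show "\<exists>t<top. u < \<Phi> t" if "u < top" for u
    proof (cases "b_of \<Phi> = top")
      case True
      then have "(\<Phi> \<longlongrightarrow> top) (at_left top)" using \<Phi> by (simp add: Phi_bar_def)
      then have "eventually (\<lambda>t. u < \<Phi> t) (at_left top)" using that by (rule order_tendstoD(1))
      then obtain b where b: "b < top" "\<And>z. b < z \<Longrightarrow> z < top \<Longrightarrow> u < \<Phi> z"
        using eventually_at_left[of 0 "top::ennreal"] by auto
      obtain z where "b < z" "z < top" using dense[OF b(1)] by auto
      then show ?thesis using b by auto
    next
      case False
      then have "b_of \<Phi> < top" by (simp add: less_top)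
      then obtain t where "b_of \<Phi> < t" "t < top" using dense by blast
      then show ?thesis using Phi_bar_eq_topI[OF \<Phi>] that by auto
    qed
  qed
  then show thesis by (rule that)
qed

section \<open>Almost decreasing weights and the inverse of \<Phi> along a weight\<close>

locale almost_dec =
  fixes \<phi> :: "real \<Rightarrow> real" and n :: nat and D :: real
  assumes phi_pos: "0 < r \<Longrightarrow> 0 < \<phi> r"
    and D_ge_1: "1 \<le> D"
    and phi_dec: "0 < r \<Longrightarrow> r \<le> s \<Longrightarrow> \<phi> s \<le> D * \<phi> r"
    and phi_inc: "0 < r \<Longrightarrow> r \<le> s \<Longrightarrow> \<phi> r * r ^ n \<le> D * (\<phi> s * s ^ n)"
begin

text \<open>The comparison passes through r / L, which lies below both radii: \<open>phi_dec\<close>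
  bounds \<phi>(s) by \<phi>(r / L), and \<open>phi_inc\<close> returns from r / L to r at the cost
  of \<open>L ^ n\<close>. For r \<le> s this is monotonicity, for r > s it is doubling.\<close>

lemma phi_comp:
  assumes "0 < r" "0 < s" "r \<le> L * s" "1 \<le> L"
  shows "\<phi> s \<le> D\<^sup>2 * L ^ n * \<phi> r"
proof -
  have 1: "\<phi> s \<le> D * \<phi> (r / L)"
    using assms by (intro phi_dec) (auto simp: field_simps)
  have "\<phi> (r / L) * (r / L) ^ n \<le> D * (\<phi> r * r ^ n)"
    using assms by (intro phi_inc) (auto simp: field_simps)
  then have "\<phi> (r / L) \<le> D * L ^ n * \<phi> r"
    using assms by (simp add: power_divide field_simps)
  then have "D * \<phi> (r / L) \<le> D * (D * L ^ n * \<phi> r)"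
    using D_ge_1 by (intro mult_left_mono) auto
  with 1 show ?thesis by (simp add: power2_eq_square mult_ac)
qed

end

lemma G_dec_almost_dec:
  assumes "\<phi> \<in> G_dec n"
  obtains D where "almost_dec \<phi> n D"
proof -
  from assms obtain C where C: "C > 0" and pos: "\<And>r. r > 0 \<Longrightarrow> \<phi> r > 0"
    and *: "\<And>r s. 0 < r \<Longrightarrow> r < s \<Longrightarrow> \<phi> s \<le> C * \<phi> r \<and> \<phi> r * r ^ n \<le> C * (\<phi> s * s ^ n)"
    by (auto simp: G_dec_def)
  \<comment> \<open>The definition of \<open>G_dec\<close> compares r < s only; a constant at least
    1 adds the case r = s.\<close>
  have "almost_dec \<phi> n (max 1 C)"
  proof
    fix r s :: real assume rs: "0 < r" "r \<le> s"
    have le: "X \<le> max 1 C * Y" if "r < s \<Longrightarrow> X \<le> C * Y" "r = s \<Longrightarrow> X = Y" "0 \<le> Y" for X Y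
    proof (cases "r = s")
      case True
      then show ?thesis using that mult_right_mono[of 1 "max 1 C" Y] by auto
    next
      case False
      then have "X \<le> C * Y" using that rs by auto
      also have "\<dots> \<le> max 1 C * Y" using that by (intro mult_right_mono) auto
      finally show ?thesis .
    qed
    show "\<phi> s \<le> max 1 C * \<phi> r"
      using * rs pos[of s] pos[of r] by (intro le) auto
    show "\<phi> r * r ^ n \<le> max 1 C * (\<phi> s * s ^ n)"
      using * rs pos[of s] by (intro le) auto
  qed (use pos in auto)
  then show thesis by (rule that)
qed

locale orlicz_morrey = quasi_young \<Phi> K + almost_dec \<phi> n D
  for \<Phi> K \<phi> n D
begin

abbreviation G :: "real \<Rightarrow> real" where "G \<equiv> inv_comp \<Phi> \<phi>"

lemma G_eq: "0 < r \<Longrightarrow> ennreal (G r) = gen_inv \<Phi> (ennreal (\<phi> r))"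
  unfolding inv_comp_def using gen_inv_less_top[of "ennreal (\<phi> r)"] by simp

lemma G_pos: "0 < r \<Longrightarrow> 0 < G r"
  using gen_inv_pos[of "ennreal (\<phi> r)"] phi_pos[of r] G_eq[of r]
  by (metis ennreal_less_zero_iff)

lemma Phi_le_phi: "0 < r \<Longrightarrow> 0 \<le> t \<Longrightarrow> t < G r \<Longrightarrow> \<Phi> (ennreal t) \<le> ennreal (\<phi> r)"
  by (intro gen_inv_lessD) (simp add: G_eq[symmetric] ennreal_lessI)

lemma le_G: "0 < r \<Longrightarrow> \<Phi> t \<le> ennreal (\<phi> r) \<Longrightarrow> t \<le> ennreal (G r)"
  by (simp add: G_eq le_gen_inv)

text \<open>Comparison constant of \<open>G_comp\<close>: \<open>phi_comp\<close> contributes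
  \<open>D\<^sup>2 * L ^ n\<close>, and \<open>gen_inv_scale\<close> carries it through the inverse
  at the cost K.\<close>

definition Gc :: "real \<Rightarrow> real" where "Gc L = K * (D\<^sup>2 * L ^ n)"

lemma Gc_aux: "1 \<le> L \<Longrightarrow> 1 \<le> D\<^sup>2 * L ^ n"
  using D_ge_1 by (metis mult_ge1_I one_le_power)

lemma Gc_ge_1: "1 \<le> L \<Longrightarrow> 1 \<le> Gc L"
  unfolding Gc_def by (rule mult_ge1_I[OF K_ge_1 Gc_aux])

text \<open>Inverts \<Phi> at a level known only up to the factor L, as is the case when the radius
  matches a given value only up to a constant.\<close>

lemma le_G_scale:
  assumes "0 < r" "1 \<le> L" "\<Phi> t \<le> ennreal (L * \<phi> r)"
  shows "t \<le> ennreal (K * L * G r)"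
proof -
  have "t \<le> gen_inv \<Phi> (ennreal L * ennreal (\<phi> r))"
    using assms phi_pos[of r] by (intro le_gen_inv) (simp add: ennreal_mult)
  also have "\<dots> \<le> ennreal (K * L) * gen_inv \<Phi> (ennreal (\<phi> r))"
    by (rule gen_inv_scale) fact
  also have "\<dots> = ennreal (K * L * G r)"
    using assms G_pos[of r] K_ge_1 by (simp add: G_eq[symmetric] ennreal_mult)
  finally show ?thesis .
qed

lemma G_comp:
  assumes "0 < r" "0 < s" "r \<le> L * s" "1 \<le> L"
  shows "G s \<le> Gc L * G r"
proof -
  have "gen_inv \<Phi> (ennreal (\<phi> s)) \<le> gen_inv \<Phi> (ennreal (D\<^sup>2 * L ^ n) * ennreal (\<phi> r))"
    using phi_comp[OF assms] phi_pos[OF assms(1)] assms D_ge_1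
    by (intro gen_inv_mono) (auto simp: ennreal_mult[symmetric] intro!: ennreal_leI)
  also have "\<dots> \<le> ennreal (K * (D\<^sup>2 * L ^ n)) * gen_inv \<Phi> (ennreal (\<phi> r))"
    by (rule gen_inv_scale[OF Gc_aux]) fact
  also have "\<dots> = ennreal (Gc L * G r)"
    using Gc_ge_1[OF assms(4)] G_pos[OF assms(1)] assms
    by (simp add: Gc_def G_eq[symmetric] ennreal_mult)
  finally show ?thesis
    using Gc_ge_1[OF assms(4)] G_pos[OF assms(1)] assms by (simp add: G_eq[symmetric] ennreal_le_iff)
qed

end

section \<open>Norms and averages\<close>

abbreviation vol :: "'a::euclidean_space \<Rightarrow> real \<Rightarrow> ennreal" where
  "vol a r \<equiv> emeasure lebesgue (ball a r)"

abbreviation abs_int :: "'a::euclidean_space set \<Rightarrow> ('a \<Rightarrow> real) \<Rightarrow> ennreal" where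
  "abs_int A f \<equiv> (\<integral>\<^sup>+y\<in>A. ennreal \<bar>f y\<bar> \<partial>lebesgue)"

abbreviation tail_int :: "'a::euclidean_space set \<Rightarrow> real \<Rightarrow> ('a \<Rightarrow> real) \<Rightarrow> ennreal" where
  "tail_int A T f \<equiv> (\<integral>\<^sup>+y\<in>A. ennreal \<bar>f y\<bar> * indicator {y. T < \<bar>f y\<bar>} y \<partial>lebesgue)"

lemma emeasure_lebesgue_ball_pos:
  "0 < r \<Longrightarrow> 0 < vol (a :: 'a::euclidean_space) r"
  by (simp add: emeasure_ball ennreal_less_zero_iff)

lemma emeasure_lebesgue_ball_finite:
  "vol (a :: 'a::euclidean_space) r < top"
  by (cases "0 \<le> r") (auto simp: emeasure_ball ball_empty)

lemma emeasure_lebesgue_ball_scale: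
  fixes a b :: "'a::euclidean_space"
  assumes "0 \<le> r" "0 \<le> L"
  shows "vol a (L * r) = ennreal (L ^ DIM('a)) * vol b r"
  using assms by (simp add: emeasure_ball ennreal_mult[symmetric] power_mult_distrib mult_ac)

lemma lebesgue_measurable_ball [measurable]: "ball (a :: 'a::euclidean_space) r \<in> sets lebesgue"
  by simp

lemma ennreal_mult_assoc:
  "0 \<le> x \<Longrightarrow> 0 \<le> y \<Longrightarrow> ennreal x * (ennreal y * z) = ennreal (x * y) * z"
  by (simp add: ennreal_mult mult.assoc)

text \<open>The admissibility condition of the norm at scaling 1 on all balls, with the denominator
  cleared to avoid division in \<open>ennreal\<close>.\<close>

definition modular_le :: "(ennreal \<Rightarrow> ennreal) \<Rightarrow> (real \<Rightarrow> real) \<Rightarrow> ('a::euclidean_space \<Rightarrow> real) \<Rightarrow> bool" where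
  "modular_le \<Phi> \<phi> F \<longleftrightarrow> (\<forall>a r. 0 < r \<longrightarrow>
     (\<integral>\<^sup>+x\<in>ball a r. \<Phi> (ennreal \<bar>F x\<bar>) \<partial>lebesgue) \<le> ennreal (\<phi> r) * vol a r)"

definition weak_modular_le :: "(ennreal \<Rightarrow> ennreal) \<Rightarrow> (real \<Rightarrow> real) \<Rightarrow> ('a::euclidean_space \<Rightarrow> real) \<Rightarrow> bool" where
  "weak_modular_le \<Phi> \<phi> F \<longleftrightarrow> (\<forall>a r t. 0 < r \<longrightarrow> 0 < t \<longrightarrow>
     \<Phi> (ennreal t) * distr_fun (ball a r) F t \<le> ennreal (\<phi> r) * vol a r)"

text \<open>The norm is an infimum and \<Phi> is only assumed monotone, so the norm itself need not
  be admissible. The strict bound supplies an admissible c' below c, and monotonicity passes from c'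
  to c.\<close>

lemma L_norm_lessD:
  fixes f :: "'a::euclidean_space \<Rightarrow> real"
  assumes pos: "\<And>r. 0 < r \<Longrightarrow> 0 < \<phi> r" and "mono \<Phi>" "L_norm \<Phi> \<phi> f < ennreal c"
  shows "modular_le \<Phi> \<phi> (\<lambda>x. f x / c)"
  unfolding modular_le_def
proof (intro allI impI)
  fix a :: 'a and r :: real assume r: "0 < r"
  have "ball_norm \<Phi> \<phi> a r f \<le> L_norm \<Phi> \<phi> f"
    unfolding L_norm_def using r by (intro SUP_upper2[where i="(a, r)"]) auto
  then have "ball_norm \<Phi> \<phi> a r f < ennreal c" using assms(3) by order
  then obtain c' where c': "0 < c'" "ennreal c' < ennreal c"
    "(\<integral>\<^sup>+x\<in>ball a r. \<Phi> (ennreal (\<bar>f x\<bar> / c')) \<partial>lebesgue) / (ennreal (\<phi> r) * vol a r) \<le> 1"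
    unfolding ball_norm_def INF_less_iff by auto
  have c: "c' < c" using c' by (auto simp: ennreal_less_iff)
  have "(\<integral>\<^sup>+x\<in>ball a r. \<Phi> (ennreal \<bar>f x / c\<bar>) \<partial>lebesgue) \<le> (\<integral>\<^sup>+x\<in>ball a r. \<Phi> (ennreal (\<bar>f x\<bar> / c')) \<partial>lebesgue)"
    using c c' by (intro nn_integral_mono mult_right_mono monoD[OF \<open>mono \<Phi>\<close>] ennreal_leI)
      (auto simp: abs_div_pos[symmetric] intro!: divide_left_mono)
  also have "\<dots> \<le> ennreal (\<phi> r) * vol a r"
    using c'(3) pos[OF r] emeasure_lebesgue_ball_pos[OF r, of a] emeasure_lebesgue_ball_finite[of a r]
    by (subst (asm) ennreal_divide_le_iff) (auto simp: ennreal_zero_less_mult_iff ennreal_mult_less_top)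
  finally show "(\<integral>\<^sup>+x\<in>ball a r. \<Phi> (ennreal \<bar>f x / c\<bar>) \<partial>lebesgue) \<le> ennreal (\<phi> r) * vol a r" .
qed

lemma L_norm_leI:
  fixes f :: "'a::euclidean_space \<Rightarrow> real"
  assumes pos: "\<And>r. 0 < r \<Longrightarrow> 0 < \<phi> r" and "0 < c" and mod: "modular_le \<Phi> \<phi> (\<lambda>x. f x / c)"
  shows "L_norm \<Phi> \<phi> f \<le> ennreal c"
proof -
  have *: "ball_norm \<Phi> \<phi> a r f \<le> ennreal c" if r: "0 < r" for a r
  proof -
  have "(\<integral>\<^sup>+x\<in>ball a r. \<Phi> (ennreal (\<bar>f x\<bar> / c)) \<partial>lebesgue) \<le> ennreal (\<phi> r) * vol a r"
    using mod r \<open>0 < c\<close> by (auto simp: modular_le_def abs_div_pos[symmetric])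
  then have "(\<integral>\<^sup>+x\<in>ball a r. \<Phi> (ennreal (\<bar>f x\<bar> / c)) \<partial>lebesgue) / (ennreal (\<phi> r) * vol a r) \<le> 1"
    using pos[OF r] emeasure_lebesgue_ball_pos[OF r, of a] emeasure_lebesgue_ball_finite[of a r]
    by (subst ennreal_divide_le_iff) (auto simp: ennreal_zero_less_mult_iff ennreal_mult_less_top)
  then show ?thesis
    unfolding ball_norm_def using \<open>0 < c\<close> by (intro INF_lower) auto
qed
  show ?thesis unfolding L_norm_def by (rule SUP_least) (use * in auto)
qed

lemma measurable_abs_greater:
  fixes f :: "'a::euclidean_space \<Rightarrow> real"
  assumes [measurable]: "f \<in> borel_measurable lebesgue" "A \<in> sets lebesgue"
  shows "{x \<in> A. t < \<bar>f x\<bar>} \<in> sets lebesgue"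
proof -
  have "{x \<in> A. t < \<bar>f x\<bar>} = {x \<in> space lebesgue. x \<in> A \<and> t < \<bar>f x\<bar>}" by auto
  also have "\<dots> \<in> sets lebesgue" by measurable
  finally show ?thesis .
qed

lemma wL_norm_lessD:
  fixes f :: "'a::euclidean_space \<Rightarrow> real"
  assumes pos: "\<And>r. 0 < r \<Longrightarrow> 0 < \<phi> r" and [measurable]: "f \<in> borel_measurable lebesgue"
    and "wL_norm \<Phi> \<phi> f < ennreal c"
  shows "weak_modular_le \<Phi> \<phi> (\<lambda>x. f x / c)"
  unfolding weak_modular_le_def
proof (intro allI impI)
  fix a :: 'a and r t :: real assume r: "0 < r" and t: "0 < t"
  have "weak_ball_norm \<Phi> \<phi> a r f \<le> wL_norm \<Phi> \<phi> f"
    unfolding wL_norm_def using r by (intro SUP_upper2[where i="(a, r)"]) auto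
  then have "weak_ball_norm \<Phi> \<phi> a r f < ennreal c" using assms(3) by order
  then obtain c' where c': "0 < c'" "ennreal c' < ennreal c"
    "(SUP t \<in> {0<..}. \<Phi> (ennreal t) * distr_fun (ball a r) (\<lambda>x. f x / c') t
          / (vol a r * ennreal (\<phi> r))) \<le> 1"
    unfolding weak_ball_norm_def INF_less_iff by auto
  have c: "c' < c" using c' by (auto simp: ennreal_less_iff)
  have meas: "{x \<in> ball a r. \<bar>f x / c'\<bar> > t} \<in> sets lebesgue"
    by (rule measurable_abs_greater) measurable
  have le: "\<bar>f x / c\<bar> \<le> \<bar>f x / c'\<bar>" for x
    using c c'(1) by (auto simp: abs_div_pos[symmetric] intro!: divide_left_mono)
  have "distr_fun (ball a r) (\<lambda>x. f x / c) t \<le> distr_fun (ball a r) (\<lambda>x. f x / c') t"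
    unfolding distr_fun_def using le by (intro emeasure_mono meas) (auto intro: less_le_trans)
  then have "\<Phi> (ennreal t) * distr_fun (ball a r) (\<lambda>x. f x / c) t \<le> \<Phi> (ennreal t) * distr_fun (ball a r) (\<lambda>x. f x / c') t"
    by (intro mult_left_mono) auto
  also have "\<dots> \<le> ennreal (\<phi> r) * vol a r"
  proof -
    have "\<Phi> (ennreal t) * distr_fun (ball a r) (\<lambda>x. f x / c') t / (vol a r * ennreal (\<phi> r)) \<le> 1"
      using c'(3) t by (auto simp: SUP_le_iff)
    then show ?thesis
    using c'(3) pos[OF r] emeasure_lebesgue_ball_pos[OF r, of a] emeasure_lebesgue_ball_finite[of a r]
    by (subst (asm) ennreal_divide_le_iff) (auto simp: ennreal_zero_less_mult_iff ennreal_mult_less_top mult.commute)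
  qed
  finally show "\<Phi> (ennreal t) * distr_fun (ball a r) (\<lambda>x. f x / c) t \<le> ennreal (\<phi> r) * vol a r" .
qed

lemma wL_norm_leI:
  fixes f :: "'a::euclidean_space \<Rightarrow> real"
  assumes pos: "\<And>r. 0 < r \<Longrightarrow> 0 < \<phi> r" and "0 < c" and mod: "weak_modular_le \<Phi> \<phi> (\<lambda>x. f x / c)"
  shows "wL_norm \<Phi> \<phi> f \<le> ennreal c"
proof -
  have *: "weak_ball_norm \<Phi> \<phi> a r f \<le> ennreal c" if r: "0 < r" for a r
  proof -
  have "\<Phi> (ennreal t) * distr_fun (ball a r) (\<lambda>x. f x / c) t / (vol a r * ennreal (\<phi> r)) \<le> 1"
    if "0 < t" for t
  proof -
    have "\<Phi> (ennreal t) * distr_fun (ball a r) (\<lambda>x. f x / c) t \<le> ennreal (\<phi> r) * vol a r"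
      using mod r that by (auto simp: weak_modular_le_def)
    then show ?thesis
      using pos[OF r] emeasure_lebesgue_ball_pos[OF r, of a] emeasure_lebesgue_ball_finite[of a r]
      by (subst ennreal_divide_le_iff) (auto simp: ennreal_zero_less_mult_iff ennreal_mult_less_top mult.commute)
  qed
  then show ?thesis
    unfolding weak_ball_norm_def using \<open>0 < c\<close> by (intro INF_lower) (auto simp: SUP_le_iff)
qed
  show ?thesis unfolding wL_norm_def by (rule SUP_least) (use * in auto)
qed

section \<open>Geometric layers and bounds for averages over balls\<close>

lemma geometric_layer:
  fixes t T k :: real
  assumes "0 < T" "1 < k" "T < t"
  obtains j :: nat where "k ^ j * T < t" "t \<le> k ^ Suc j * T"
proof -
  obtain m where "t / T < k ^ m" using real_arch_pow[OF assms(2)] by blast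
  then have "t \<le> k ^ m * T" using assms by (simp add: field_simps)
  then obtain m where m: "t \<le> k ^ m * T" "\<And>i. i < m \<Longrightarrow> \<not> t \<le> k ^ i * T"
    using exists_least_iff[of "\<lambda>m. t \<le> k ^ m * T"] by auto
  then have "m \<noteq> 0" using assms by (cases m) auto
  then obtain j where "m = Suc j" by (cases m) auto
  then show thesis using m(1) m(2)[of j] by (intro that[of j]) auto
qed

lemma single_le_suminf_ennreal: "f j \<le> (\<Sum>i. f i :: ennreal)"
  using sum_le_suminf[of f "{j}"] by (simp add: summableI)

text \<open>Layer-cake bound over geometric levels: on each layer |F| is replaced by the upper
  level, and the layer is enlarged to the superlevel set of its lower level.\<close>

lemma nn_integral_layer_le:
  fixes F :: "'a::euclidean_space \<Rightarrow> real"
  assumes [measurable]: "F \<in> borel_measurable lebesgue" "A \<in> sets lebesgue"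
    and "0 < T" "1 < k"
  shows "tail_int A T F \<le>
    (\<Sum>j. ennreal (k ^ Suc j * T) * distr_fun A F (k ^ j * T))"
proof -
  have [measurable]: "{x \<in> A. k ^ j * T < \<bar>F x\<bar>} \<in> sets lebesgue" for j
    by (rule measurable_abs_greater) measurable
  have "tail_int A T F
    \<le> (\<integral>\<^sup>+x. (\<Sum>j. ennreal (k ^ Suc j * T) * indicator {x \<in> A. k ^ j * T < \<bar>F x\<bar>} x) \<partial>lebesgue)"
  proof (rule nn_integral_mono)
    fix x
    show "ennreal \<bar>F x\<bar> * indicator {x. T < \<bar>F x\<bar>} x * indicator A x
      \<le> (\<Sum>j. ennreal (k ^ Suc j * T) * indicator {x \<in> A. k ^ j * T < \<bar>F x\<bar>} x)"
    proof (cases "T < \<bar>F x\<bar> \<and> x \<in> A")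
      case True
      then obtain j where "k ^ j * T < \<bar>F x\<bar>" "\<bar>F x\<bar> \<le> k ^ Suc j * T"
        using geometric_layer[OF assms(3,4), of "\<bar>F x\<bar>"] by blast
      then have "ennreal \<bar>F x\<bar> \<le> ennreal (k ^ Suc j * T) * indicator {x \<in> A. k ^ j * T < \<bar>F x\<bar>} x"
        using True by (auto intro!: ennreal_leI)
      also have "\<dots> \<le> (\<Sum>j. ennreal (k ^ Suc j * T) * indicator {x \<in> A. k ^ j * T < \<bar>F x\<bar>} x)"
        by (rule single_le_suminf_ennreal)
      finally show ?thesis using True by simp
    qed (auto simp: indicator_def)
  qed
  also have "\<dots> = (\<Sum>j. ennreal (k ^ Suc j * T) * distr_fun A F (k ^ j * T))"
    by (subst nn_integral_suminf) (auto simp: nn_integral_cmult distr_fun_def)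
  finally show ?thesis .
qed

context quasi_young
begin

text \<open>Each step gains 1 / (2 k) while the level grows only by k; the surplus factor 1/2 makes
  the later sums over levels converge.\<close>

lemma nabla2_iter:
  assumes nab: "\<And>t. 0 < t \<Longrightarrow> \<Phi> t \<le> ennreal (1 / (2 * k)) * \<Phi> (ennreal k * t)" and k: "1 < k" and T: "0 < T"
  shows "\<Phi> (ennreal T) \<le> ennreal ((1 / (2 * k)) ^ j) * \<Phi> (ennreal (k ^ j * T))"
proof (induction j)
  case (Suc j)
  have "\<Phi> (ennreal (k ^ j * T)) \<le> ennreal (1 / (2 * k)) * \<Phi> (ennreal k * ennreal (k ^ j * T))"
    using k T by (intro nab) (auto simp: ennreal_less_zero_iff)
  also have "ennreal k * ennreal (k ^ j * T) = ennreal (k ^ Suc j * T)"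
    using k T by (simp add: ennreal_mult[symmetric] mult_ac)
  finally have "ennreal ((1 / (2 * k)) ^ j) * \<Phi> (ennreal (k ^ j * T)) \<le>
    ennreal ((1 / (2 * k)) ^ j) * (ennreal (1 / (2 * k)) * \<Phi> (ennreal (k ^ Suc j * T)))"
    by (intro mult_left_mono) auto
  also have "\<dots> = ennreal ((1 / (2 * k)) ^ Suc j) * \<Phi> (ennreal (k ^ Suc j * T))"
    using k by (simp add: ennreal_mult_assoc mult.commute)
  finally show ?case using Suc by order
qed simp

end

lemma suminf_half_powers: "0 \<le> c \<Longrightarrow> (\<Sum>j. ennreal ((1 / 2) ^ j * c)) = ennreal (2 * c)"
proof -
  assume "0 \<le> c"
  have "(\<lambda>j. (1 / 2 :: real) ^ j * c) sums (1 / (1 - 1 / 2) * c)"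
    by (intro sums_mult2 geometric_sums) simp
  then show ?thesis using \<open>0 \<le> c\<close> by (intro suminf_ennreal_eq) auto
qed

context orlicz_morrey
begin

text \<open>The weak condition is applied at the levels \<open>k ^ j * T\<close>. By
  \<open>nabla2_iter\<close> the j-th layer contributes at most \<open>(1/2) ^ j * (k * T)\<close>,
  so the series is bounded by \<open>2 * k * T\<close>; for \<Phi>(t) = t all layers could
  contribute equally.\<close>

lemma weak_modular_layer:
  fixes F :: "'a::euclidean_space \<Rightarrow> real"
  assumes nab: "\<And>t. 0 < t \<Longrightarrow> \<Phi> t \<le> ennreal (1 / (2 * k)) * \<Phi> (ennreal k * t)" and k: "1 < k"
    and [measurable]: "F \<in> borel_measurable lebesgue" and F: "weak_modular_le \<Phi> \<phi> F"
    and r: "0 < r" and T: "0 < T"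
  shows "\<Phi> (ennreal T) * tail_int (ball a r) T F \<le>
    ennreal (2 * k * T) * (ennreal (\<phi> r) * vol a r)"
proof -
  let ?V = "ennreal (\<phi> r) * vol a r"
  have "\<Phi> (ennreal T) * tail_int (ball a r) T F
     \<le> \<Phi> (ennreal T) * (\<Sum>j. ennreal (k ^ Suc j * T) * distr_fun (ball a r) F (k ^ j * T))"
    using k T by (intro mult_left_mono nn_integral_layer_le) auto
  also have "\<dots> = (\<Sum>j. \<Phi> (ennreal T) * (ennreal (k ^ Suc j * T) * distr_fun (ball a r) F (k ^ j * T)))"
    by simp
  also have "\<dots> \<le> (\<Sum>j. ennreal ((1/2) ^ j * (k * T)) * ?V)"
  proof (intro suminf_le summableI)
    fix j
    have "\<Phi> (ennreal T) * (ennreal (k ^ Suc j * T) * distr_fun (ball a r) F (k ^ j * T)) \<le>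
      (ennreal ((1 / (2 * k)) ^ j) * \<Phi> (ennreal (k ^ j * T))) * (ennreal (k ^ Suc j * T) * distr_fun (ball a r) F (k ^ j * T))"
      by (intro mult_right_mono nabla2_iter[OF nab k T]) auto
    also have "\<dots> = (ennreal ((1 / (2 * k)) ^ j) * ennreal (k ^ Suc j * T)) * (\<Phi> (ennreal (k ^ j * T)) * distr_fun (ball a r) F (k ^ j * T))"
      by (simp only: mult_ac)
    also have "\<dots> \<le> (ennreal ((1 / (2 * k)) ^ j) * ennreal (k ^ Suc j * T)) * ?V"
      using F r T k by (intro mult_left_mono) (auto simp: weak_modular_le_def)
    also have "ennreal ((1 / (2 * k)) ^ j) * ennreal (k ^ Suc j * T) = ennreal ((1/2) ^ j * (k * T))"
      using k T by (simp add: ennreal_mult[symmetric] power_mult_distrib power_divide)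
    finally show "\<Phi> (ennreal T) * (ennreal (k ^ Suc j * T) * distr_fun (ball a r) F (k ^ j * T)) \<le> ennreal ((1/2) ^ j * (k * T)) * ?V" .
  qed
  also have "\<dots> = ennreal (2 * (k * T)) * ?V"
  proof -
    have "0 \<le> k * T" using k T by simp
    then show ?thesis by (simp only: ennreal_suminf_multc suminf_half_powers)
  qed
  finally show ?thesis by (simp add: mult.assoc)
qed

lemma phi_less_Phi: "0 < r \<Longrightarrow> ennreal (\<phi> r) < \<Phi> (ennreal (2 * G r))"
  using le_G[of r "ennreal (2 * G r)"] G_pos[of r] by (cases "ennreal (\<phi> r) < \<Phi> (ennreal (2 * G r))") (auto simp: not_less)

definition avg_le :: "real \<Rightarrow> ('a::euclidean_space \<Rightarrow> real) \<Rightarrow> bool" where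
  "avg_le c F \<longleftrightarrow> (\<forall>a r. 0 < r \<longrightarrow>
     abs_int (ball a r) F \<le> ennreal (c * G r) * vol a r)"

text \<open>Substitute for Jensen's inequality, by splitting at K s with s = 2 G(r): below, |F| is
  at most K s; above, |F| is at most a multiple of \<Phi>(|F|), whose integral the modular bounds.
  Each part contributes 2 K G(r).\<close>

lemma modular_avg_le:
  fixes F :: "'a::euclidean_space \<Rightarrow> real"
  assumes [measurable]: "F \<in> borel_measurable lebesgue" and F: "modular_le \<Phi> \<phi> F"
  shows "avg_le (4 * K) F"
  unfolding avg_le_def
proof (intro allI impI)
  fix a :: 'a and r :: real assume r: "0 < r"
  \<comment> \<open>Doubling guarantees \<open>\<phi> r < \<Phi> s\<close>, which may fail at
    \<open>G r\<close> itself.\<close>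
  define s where "s = 2 * G r"
  have s: "0 < s" using G_pos[OF r] by (simp add: s_def)
  have u: "0 < \<phi> r" using r by (rule phi_pos)
  have pt: "ennreal \<bar>F x\<bar> \<le> ennreal (K * s) + ennreal (K * s / \<phi> r) * \<Phi> (ennreal \<bar>F x\<bar>)" for x
  proof (cases "\<bar>F x\<bar> \<le> K * s")
    case True
    then show ?thesis by (simp add: ennreal_leI add_increasing2)
  next
    case False
    then have Fx: "0 < \<bar>F x\<bar>" using K_ge_1 s by (smt (verit) mult_pos_pos)
    have "\<Phi> (ennreal s * 1) \<le> ennreal (K * s / \<bar>F x\<bar>) * \<Phi> (ennreal \<bar>F x\<bar> * 1)"
      using False s by (intro scale_real) auto
    then have "ennreal (\<phi> r) \<le> ennreal (K * s / \<bar>F x\<bar>) * \<Phi> (ennreal \<bar>F x\<bar>)"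
      using phi_less_Phi[OF r] by (simp add: s_def)
    then have "ennreal (\<bar>F x\<bar> / \<phi> r) * ennreal (\<phi> r) \<le> ennreal (\<bar>F x\<bar> / \<phi> r) * (ennreal (K * s / \<bar>F x\<bar>) * \<Phi> (ennreal \<bar>F x\<bar>))"
      by (intro mult_left_mono) auto
    also have "ennreal (\<bar>F x\<bar> / \<phi> r) * ennreal (\<phi> r) = ennreal \<bar>F x\<bar>"
      using u by (simp add: ennreal_mult[symmetric])
    also have "ennreal (\<bar>F x\<bar> / \<phi> r) * (ennreal (K * s / \<bar>F x\<bar>) * \<Phi> (ennreal \<bar>F x\<bar>)) = ennreal (K * s / \<phi> r) * \<Phi> (ennreal \<bar>F x\<bar>)"
      using u K_ge_1 s Fx by (simp add: mult.assoc[symmetric] ennreal_mult[symmetric])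
    finally show ?thesis by (rule order_trans) simp
  qed
  have "abs_int (ball a r) F \<le>
    (\<integral>\<^sup>+x. ennreal (K * s) * indicator (ball a r) x + ennreal (K * s / \<phi> r) * (\<Phi> (ennreal \<bar>F x\<bar>) * indicator (ball a r) x) \<partial>lebesgue)"
    using pt by (intro nn_integral_mono) (auto simp: indicator_def)
  also have "\<dots> = ennreal (K * s) * vol a r + ennreal (K * s / \<phi> r) * (\<integral>\<^sup>+x\<in>ball a r. \<Phi> (ennreal \<bar>F x\<bar>) \<partial>lebesgue)"
    by (subst nn_integral_add) (auto simp: nn_integral_cmult)
  also have "\<dots> \<le> ennreal (K * s) * vol a r + ennreal (K * s / \<phi> r) * (ennreal (\<phi> r) * vol a r)"
    using F r by (intro add_left_mono mult_left_mono) (auto simp: modular_le_def)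
  also have "ennreal (K * s / \<phi> r) * (ennreal (\<phi> r) * vol a r) = ennreal (K * s) * vol a r"
    using u K_ge_1 s by (simp add: mult.assoc[symmetric] ennreal_mult[symmetric])
  also have "ennreal (K * s) * vol a r + ennreal (K * s) * vol a r
     = ennreal (K * s + K * s) * vol a r"
    using K_ge_1 s by (simp add: distrib_right[symmetric] ennreal_plus[symmetric] del: ennreal_plus)
  also have "K * s + K * s = 4 * K * G r" by (simp add: s_def)
  finally show "abs_int (ball a r) F \<le> ennreal (4 * K * G r) * vol a r" .
qed

text \<open>Splitting at s = 2 G(r) again: the part up to s gives the 2, and
  \<open>weak_modular_layer\<close> at level s bounds the rest by \<open>2 * k * s\<close>, which is
  the term 4 k.\<close>

lemma weak_modular_avg_le:
  fixes F :: "'a::euclidean_space \<Rightarrow> real"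
  assumes nab: "\<And>t. 0 < t \<Longrightarrow> \<Phi> t \<le> ennreal (1 / (2 * k)) * \<Phi> (ennreal k * t)" and k: "1 < k"
    and [measurable]: "F \<in> borel_measurable lebesgue" and F: "weak_modular_le \<Phi> \<phi> F"
  shows "avg_le (2 + 4 * k) F"
  unfolding avg_le_def
proof (intro allI impI)
  fix a :: 'a and r :: real assume r: "0 < r"
  define s where "s = 2 * G r"
  have s: "0 < s" using G_pos[OF r] by (simp add: s_def)
  have u: "0 < \<phi> r" using r by (rule phi_pos)
  let ?m = "vol a r"
  let ?I = "tail_int (ball a r) s F"
  have "ennreal (\<phi> r) * ?I \<le> \<Phi> (ennreal s) * ?I"
    using phi_less_Phi[OF r] by (intro mult_right_mono) (auto simp: s_def)
  also have "\<dots> \<le> ennreal (2 * k * s) * (ennreal (\<phi> r) * ?m)"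
    by (rule weak_modular_layer) fact+
  finally have "ennreal (1 / \<phi> r) * (ennreal (\<phi> r) * ?I) \<le> ennreal (1 / \<phi> r) * (ennreal (2 * k * s) * (ennreal (\<phi> r) * ?m))"
    by (intro mult_left_mono) auto
  also have "ennreal (1 / \<phi> r) * (ennreal (\<phi> r) * ?I) = ?I"
    using u by (simp add: mult.assoc[symmetric] ennreal_mult[symmetric])
  also have "ennreal (1 / \<phi> r) * (ennreal (2 * k * s) * (ennreal (\<phi> r) * ?m)) = ennreal (2 * k * s) * ?m"
    using u k s by (simp add: mult.assoc[symmetric] ennreal_mult[symmetric])
  finally have I: "?I \<le> ennreal (2 * k * s) * ?m" .
  have "abs_int (ball a r) F \<le>
    (\<integral>\<^sup>+x. ennreal s * indicator (ball a r) x + ennreal \<bar>F x\<bar> * indicator {x. s < \<bar>F x\<bar>} x * indicator (ball a r) x \<partial>lebesgue)"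
    by (intro nn_integral_mono) (auto simp: indicator_def intro!: ennreal_leI)
  also have "\<dots> = ennreal s * ?m + ?I"
    by (subst nn_integral_add) (auto simp: nn_integral_cmult)
  also have "\<dots> \<le> ennreal s * ?m + ennreal (2 * k * s) * ?m"
    by (intro add_left_mono I)
  also have "\<dots> = ennreal (s + 2 * k * s) * ?m"
    using k s by (simp add: distrib_right)
  also have "s + 2 * k * s = (2 + 4 * k) * G r" by (simp add: s_def algebra_simps)
  finally show "abs_int (ball a r) F \<le> ennreal ((2 + 4 * k) * G r) * ?m" .
qed

end

section \<open>The maximal function\<close>

lemma nn_integral_count_space_disjoint_indicator:
  assumes "disjoint_family_on X C"
  shows "(\<integral>\<^sup>+i. indicator (X i) x \<partial>count_space C) = (indicator (\<Union>i\<in>C. X i) x :: ennreal)"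
proof (cases "\<exists>i\<in>C. x \<in> X i")
  case True
  then obtain i where i: "i \<in> C" "x \<in> X i" by auto
  have "x \<in> X j \<longleftrightarrow> j = i" if "j \<in> C" for j
    using that i assms by (auto simp: disjoint_family_on_def)
  then have "(\<integral>\<^sup>+i. indicator (X i) x \<partial>count_space C) = (\<integral>\<^sup>+j. indicator {i} j \<partial>count_space C)"
    by (intro nn_integral_cong) (auto simp: indicator_def)
  also have "\<dots> = 1" using i by simp
  finally show ?thesis using i by (auto simp: indicator_def)
next
  case False
  then have "(\<integral>\<^sup>+i. indicator (X i) x \<partial>count_space C) = (\<integral>\<^sup>+i. 0 \<partial>count_space C :: ennreal)"
    by (intro nn_integral_cong) (auto simp: indicator_def)
  then show ?thesis using False by (auto simp: indicator_def)
qed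

lemma indicator_mono_set: "A \<subseteq> B \<Longrightarrow> indicator A x \<le> (indicator B x :: ennreal)"
  by (auto simp: indicator_def)

lemma open_sets_lebesgue: "open S \<Longrightarrow> S \<in> sets lebesgue"
  by (simp add: borel_open)

text \<open>Weak-type estimate in local form. The bound on the radii is what Vitali's lemma asks
  for; the disjoint balls it selects carry their mass of g inside A, and their fivefold enlargements
  cover E.\<close>

lemma vitali_weak_type:
  fixes g :: "'a::euclidean_space \<Rightarrow> ennreal" and A :: "'a set" and B t :: real
  assumes [measurable]: "g \<in> borel_measurable lebesgue"
  defines "E \<equiv> \<Union>(c, s)\<in>{(c, s). 0 < s \<and> s \<le> B \<and> ball c s \<subseteq> A \<and>
     ennreal t * vol c s \<le> (\<integral>\<^sup>+x\<in>ball c s. g x \<partial>lebesgue)}. ball c s"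
  shows "ennreal t * emeasure lebesgue E \<le> ennreal (5 ^ DIM('a)) * (\<integral>\<^sup>+x\<in>A. g x \<partial>lebesgue)"
proof -
  define I where "I = {(c, s). 0 < s \<and> s \<le> B \<and> ball c s \<subseteq> A \<and>
     ennreal t * vol c s \<le> (\<integral>\<^sup>+x\<in>ball c s. g x \<partial>lebesgue)}"
  have E: "E = (\<Union>i\<in>I. ball (fst i) (snd i))"
    by (auto simp: E_def I_def)
  have cov: "E \<subseteq> (\<Union>i\<in>I. ball (fst i) (snd i))" by (simp add: E)
  have rad: "0 < snd i \<and> snd i \<le> B" if "i \<in> I" for i using that by (auto simp: I_def)
  obtain C where C: "countable C" "C \<subseteq> I"
    "pairwise (\<lambda>i j. disjnt (ball (fst i) (snd i)) (ball (fst j) (snd j))) C"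
    "E \<subseteq> (\<Union>i\<in>C. ball (fst i) (5 * snd i))"
    by (rule Vitali_covering_lemma_balls[OF cov rad])
  have disj: "disjoint_family_on (\<lambda>i. ball (fst i) (snd i)) C"
    using C(3) by (auto simp: disjoint_family_on_def pairwise_def disjnt_def)
  have sub: "(\<Union>i\<in>C. ball (fst i) (snd i)) \<subseteq> A"
  proof -
    have "ball (fst i) (snd i) \<subseteq> A" if "i \<in> I" for i using that by (auto simp: I_def)
    then show ?thesis using C(2) by blast
  qed
  have "ennreal t * emeasure lebesgue E \<le> ennreal t * emeasure lebesgue (\<Union>i\<in>C. ball (fst i) (5 * snd i))"
    using C by (intro mult_left_mono emeasure_mono) (auto intro!: borel_open)
  also have "emeasure lebesgue (\<Union>i\<in>C. ball (fst i) (5 * snd i)) =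
    (\<integral>\<^sup>+x. indicator (\<Union>i\<in>C. ball (fst i) (5 * snd i)) x \<partial>lebesgue)"
    using C by (subst nn_integral_indicator) (auto intro!: borel_open)
  \<comment> \<open>Sums over the countable selection are written as integrals over
    \<open>count_space C\<close>, so that they can be exchanged with the Lebesgue integral.\<close>
  also have "\<dots> \<le> (\<integral>\<^sup>+x. (\<integral>\<^sup>+i. indicator (ball (fst i) (5 * snd i)) x \<partial>count_space C) \<partial>lebesgue)"
  proof (rule nn_integral_mono)
    fix x
    show "indicator (\<Union>i\<in>C. ball (fst i) (5 * snd i)) x \<le> (\<integral>\<^sup>+i. indicator (ball (fst i) (5 * snd i)) x \<partial>count_space C :: ennreal)"
    proof (cases "x \<in> (\<Union>i\<in>C. ball (fst i) (5 * snd i))")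
      case True
      then obtain i where i: "i \<in> C" "x \<in> ball (fst i) (5 * snd i)" by auto
      have "1 = (\<integral>\<^sup>+j. indicator {i} j \<partial>count_space C :: ennreal)" using i by simp
      also have "\<dots> \<le> (\<integral>\<^sup>+i. indicator (ball (fst i) (5 * snd i)) x \<partial>count_space C)"
        using i by (intro nn_integral_mono) (auto simp: indicator_def)
      finally show ?thesis using True by (auto simp: indicator_def)
    qed auto
  qed
  also have "\<dots> = (\<integral>\<^sup>+i. (\<integral>\<^sup>+x. indicator (ball (fst i) (5 * snd i)) x \<partial>lebesgue) \<partial>count_space C)"
    using C by (intro nn_integral_count_space_nn_integral) auto
  also have "\<dots> = (\<integral>\<^sup>+i. ennreal (5 ^ DIM('a)) * vol (fst i) (snd i) \<partial>count_space C)"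
  proof (rule nn_integral_cong)
    fix i assume "i \<in> space (count_space C)"
    then have "0 < snd i" using C(2) by (auto simp: I_def)
    then show "(\<integral>\<^sup>+x. indicator (ball (fst i) (5 * snd i)) x \<partial>lebesgue) = ennreal (5 ^ DIM('a)) * vol (fst i) (snd i)"
      by (subst emeasure_lebesgue_ball_scale[symmetric]) auto
  qed
  also have "ennreal t * \<dots> = (\<integral>\<^sup>+i. ennreal (5 ^ DIM('a)) * (ennreal t * vol (fst i) (snd i)) \<partial>count_space C)"
    by (subst nn_integral_cmult[symmetric]) (auto intro!: nn_integral_cong simp: mult_ac)
  also have "\<dots> \<le> (\<integral>\<^sup>+i. ennreal (5 ^ DIM('a)) * (\<integral>\<^sup>+x\<in>ball (fst i) (snd i). g x \<partial>lebesgue) \<partial>count_space C)"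
  proof (intro nn_integral_mono mult_left_mono)
    fix i assume "i \<in> space (count_space C)"
    then have "i \<in> I" using C(2) by auto
    then show "ennreal t * vol (fst i) (snd i) \<le> (\<integral>\<^sup>+x\<in>ball (fst i) (snd i). g x \<partial>lebesgue)"
      by (cases i) (simp add: I_def)
  qed simp
  also have "\<dots> = ennreal (5 ^ DIM('a)) * (\<integral>\<^sup>+i. (\<integral>\<^sup>+x\<in>ball (fst i) (snd i). g x \<partial>lebesgue) \<partial>count_space C)"
    by (rule nn_integral_cmult) auto
  also have "(\<integral>\<^sup>+i. (\<integral>\<^sup>+x\<in>ball (fst i) (snd i). g x \<partial>lebesgue) \<partial>count_space C)
     = (\<integral>\<^sup>+x. (\<integral>\<^sup>+i. g x * indicator (ball (fst i) (snd i)) x \<partial>count_space C) \<partial>lebesgue)"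
    using C by (intro nn_integral_count_space_nn_integral[symmetric]) auto
  also have "\<dots> = (\<integral>\<^sup>+x. g x * indicator (\<Union>i\<in>C. ball (fst i) (snd i)) x \<partial>lebesgue)"
    by (intro nn_integral_cong, subst nn_integral_cmult) (auto simp: nn_integral_count_space_disjoint_indicator[OF disj])
  also have "\<dots> \<le> (\<integral>\<^sup>+x\<in>A. g x \<partial>lebesgue)"
    by (intro nn_integral_mono mult_left_mono indicator_mono_set sub) simp
  finally show ?thesis by (simp add: mult_left_mono)
qed

text \<open>The maximal function is uncentred: a ball that witnesses a value above u at x does so at
  each of its points. Measurability follows without reducing the supremum to countably many
  balls.\<close>

lemma open_maximal_fun_greater: "open {x. u < maximal_fun f x}"
  unfolding open_subopen[of "{x. u < maximal_fun f x}"]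
proof
  fix x assume "x \<in> {x. u < maximal_fun f x}"
  then obtain a r where "x \<in> ball a r" "u < abs_int (ball a r) f / vol a r"
    unfolding maximal_fun_def by (auto simp: less_SUP_iff)
  have "u < maximal_fun f y" if "y \<in> ball a r" for y
  proof -
    have "abs_int (ball a r) f / vol a r \<le> maximal_fun f y"
      unfolding maximal_fun_def using that by (intro SUP_upper2[where i="(a, r)"]) auto
    then show ?thesis using \<open>u < _\<close> by (rule less_le_trans[rotated])
  qed
  then have "ball a r \<subseteq> {x. u < maximal_fun f x}" by auto
  then show "\<exists>T. open T \<and> x \<in> T \<and> T \<subseteq> {x. u < maximal_fun f x}"
    using \<open>x \<in> ball a r\<close> by (intro exI[of _ "ball a r"]) auto
qed

lemma measurable_maximal_fun [measurable]: "maximal_fun f \<in> borel_measurable lebesgue"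
proof (rule borel_measurableI_greater)
  fix y
  show "{x \<in> space lebesgue. y < maximal_fun f x} \<in> sets lebesgue"
    using open_maximal_fun_greater[of y f] by (auto intro!: borel_open)
qed

lemma measurable_ball_maximal_fun [measurable]: "{x \<in> ball a r. u < maximal_fun f x} \<in> sets lebesgue"
proof -
  have "{x \<in> ball a r. u < maximal_fun f x} = ball a r \<inter> {x. u < maximal_fun f x}" by auto
  then show ?thesis using open_maximal_fun_greater[of u f] by (auto intro!: borel_open)
qed

lemma le_maximal_fun:
  fixes f :: "'a::euclidean_space \<Rightarrow> real"
  assumes "x \<in> ball a r"
  shows "abs_int (ball a r) f \<le> maximal_fun f x * vol a r"
proof -
  have "0 < r" using assms by (auto intro: le_less_trans[OF zero_le_dist])
  have "abs_int (ball a r) f / vol a r \<le> maximal_fun f x"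
    unfolding maximal_fun_def using assms by (intro SUP_upper2[where i="(a, r)"]) auto
  then show ?thesis
    using emeasure_lebesgue_ball_pos[OF \<open>0 < r\<close>, of a] emeasure_lebesgue_ball_finite[of a r]
    by (subst (asm) ennreal_divide_le_iff) auto
qed

lemma ennreal_mult_le_cancel:
  assumes "0 < T" "ennreal T * x \<le> ennreal T * y" shows "x \<le> y"
proof -
  have "ennreal (1 / T) * (ennreal T * x) \<le> ennreal (1 / T) * (ennreal T * y)"
    by (rule mult_left_mono[OF assms(2)]) simp
  moreover have "ennreal (1 / T) * (ennreal T * z) = z" for z
    using assms(1) by (subst ennreal_mult_assoc) auto
  ultimately show ?thesis by (simp only:)
qed

text \<open>Letting t tend to \<infinity>. It is used for the set where the maximal function is
  \<infinity> and for functions of norm 0.\<close>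

lemma ennreal_mult_bounded_imp_zero:
  assumes "\<And>t. t0 \<le> t \<Longrightarrow> 0 < t \<Longrightarrow> ennreal t * e \<le> X" "X < top"
  shows "e = 0"
proof (rule ccontr)
  assume "e \<noteq> 0"
  obtain x where x: "X = ennreal x" "0 \<le> x" using assms(2) by (cases X) auto
  have "e \<noteq> top"
    using assms(1)[of "max t0 1"] assms(2) by (auto simp: ennreal_mult_top top_unique)
  then obtain d where d: "e = ennreal d" "0 \<le> d" by (cases e) auto
  then have "0 < d" using \<open>e \<noteq> 0\<close> by (cases "d = 0") auto
  define t where "t = max t0 (x / d + 1)"
  have t: "t0 \<le> t" "0 < t" "x / d < t" using \<open>0 < d\<close> x by (auto simp: t_def less_max_iff_disj add_nonneg_pos)
  have "ennreal (t * d) \<le> ennreal x" using assms(1)[OF t(1,2)] x d t by (simp add: ennreal_mult)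
  then have "t * d \<le> x" using x by (simp add: ennreal_le_iff)
  then show False using t \<open>0 < d\<close> by (simp add: field_simps)
qed

section \<open>Local and weak modular estimates of the maximal function\<close>

context orlicz_morrey
begin

lemma avg_leD:
  "avg_le c F \<Longrightarrow> 0 < r \<Longrightarrow> abs_int (ball a r) F \<le> ennreal (c * G r) * vol a r"
  by (simp add: avg_le_def)

text \<open>A ball of radius at least r / 2 has average at most \<open>c * Gc 2 * G r\<close>, hence
  at most t, and cannot witness a value above 2 t. So the witnesses are small and stay inside
  \<open>ball a (2 * r)\<close>. Cutting off the part of F up to t costs an average of at most t, so
  what lies above t still has average above t and \<open>vitali_weak_type\<close> applies.\<close>

lemma maximal_fun_local:
  fixes F :: "'a::euclidean_space \<Rightarrow> real"
  assumes [measurable]: "F \<in> borel_measurable lebesgue" and F: "avg_le c F" and c: "0 \<le> c"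
    and r: "0 < r" and t: "0 < t" "c * Gc 2 * G r \<le> t"
  shows "ennreal t * emeasure lebesgue {x \<in> ball a r. ennreal (2 * t) < maximal_fun F x} \<le>
    ennreal (5 ^ DIM('a)) * tail_int (ball a (2 * r)) t F"
proof -
  define g where "g x = ennreal \<bar>F x\<bar> * indicator {x. t < \<bar>F x\<bar>} x" for x
  have [measurable]: "g \<in> borel_measurable lebesgue" unfolding g_def by measurable
  let ?I = "{(b, s). 0 < s \<and> s \<le> r \<and> ball b s \<subseteq> ball a (2 * r) \<and>
     ennreal t * vol b s \<le> (\<integral>\<^sup>+x\<in>ball b s. g x \<partial>lebesgue)}"
  let ?E = "\<Union>(b, s)\<in>?I. ball b s"
  have "{x \<in> ball a r. ennreal (2 * t) < maximal_fun F x} \<subseteq> ?E"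
  proof clarify
    fix x assume x: "x \<in> ball a r" "ennreal (2 * t) < maximal_fun F x"
    then obtain b s where b: "x \<in> ball b s"
      and avg: "ennreal (2 * t) < abs_int (ball b s) F / vol b s"
      unfolding maximal_fun_def by (auto simp: less_SUP_iff)
    have s: "0 < s" using b by (auto intro: le_less_trans[OF zero_le_dist])
    let ?m = "vol b s"
    have m: "0 < ?m" "?m < top" using emeasure_lebesgue_ball_pos[OF s] emeasure_lebesgue_ball_finite by auto
    have avg': "ennreal (2 * t) * ?m < abs_int (ball b s) F"
      using avg ennreal_divide_le_iff[OF m] by (simp add: not_le[symmetric])
    have "s < r / 2"
    proof (rule ccontr)
      assume "\<not> s < r / 2"
      then have "G s \<le> Gc 2 * G r" using r s by (intro G_comp) auto
      then have "c * G s \<le> 2 * t" using t c mult_left_mono[of "G s" "Gc 2 * G r" c] by (simp add: mult.assoc)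
      then have "ennreal (c * G s) * ?m \<le> ennreal (2 * t) * ?m" by (intro mult_right_mono ennreal_leI) auto
      then show False using avg' avg_leD[OF F s, of b] by auto
    qed
    have "ball b s \<subseteq> ball a (2 * r)"
    proof
      fix y assume "y \<in> ball b s"
      \<comment> \<open>Through x, which lies in both balls.\<close>
      then have "dist a y < r + (s + s)"
        using b x dist_triangle[of a y x] dist_triangle[of x y b] by (simp add: dist_commute)
      then show "y \<in> ball a (2 * r)" using \<open>s < r / 2\<close> by simp
    qed
    have "abs_int (ball b s) F \<le> (\<integral>\<^sup>+y. ennreal t * indicator (ball b s) y + g y * indicator (ball b s) y \<partial>lebesgue)"
      by (intro nn_integral_mono) (auto simp: indicator_def g_def intro!: ennreal_leI)
    also have "\<dots> = ennreal t * ?m + (\<integral>\<^sup>+y\<in>ball b s. g y \<partial>lebesgue)"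
      by (subst nn_integral_add) (auto simp: nn_integral_cmult)
    finally have "ennreal (2 * t) * ?m < ennreal t * ?m + (\<integral>\<^sup>+y\<in>ball b s. g y \<partial>lebesgue)"
      using avg' by order
    also have "ennreal (2 * t) * ?m = ennreal t * ?m + ennreal t * ?m"
      using t by (simp add: distrib_right[symmetric] ennreal_plus[symmetric] del: ennreal_plus)
    finally have "ennreal t * ?m < (\<integral>\<^sup>+y\<in>ball b s. g y \<partial>lebesgue)"
      by (meson add_left_mono leD leI)
    then have "(b, s) \<in> ?I" using s \<open>s < r / 2\<close> \<open>ball b s \<subseteq> _\<close> by auto
    then show "x \<in> ?E" using b by blast
  qed
  then have "ennreal t * emeasure lebesgue {x \<in> ball a r. ennreal (2 * t) < maximal_fun F x} \<le> ennreal t * emeasure lebesgue ?E"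
    by (intro mult_left_mono emeasure_mono open_sets_lebesgue open_UN) auto
  also have "\<dots> \<le> ennreal (5 ^ DIM('a)) * (\<integral>\<^sup>+x\<in>ball a (2 * r). g x \<partial>lebesgue)"
    by (rule vitali_weak_type) measurable
  finally show ?thesis by (simp add: g_def)
qed

text \<open>By \<open>maximal_fun_local\<close>, in each ball the set where the maximal function is
  \<infinity> has measure at most a fixed finite bound divided by t, for every large t.\<close>

lemma maximal_fun_finite_AE:
  fixes F :: "'a::euclidean_space \<Rightarrow> real"
  assumes [measurable]: "F \<in> borel_measurable lebesgue" and F: "avg_le c F" and c: "0 \<le> c"
  shows "AE x in lebesgue. maximal_fun F x < top"
proof -
  have null: "{x \<in> ball 0 (real (Suc j)). maximal_fun F x = top} \<in> null_sets lebesgue" for j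
  proof -
    let ?r = "real (Suc j)" let ?B = "ball 0 ?r :: 'a set"
    let ?N = "{x \<in> ball 0 (real (Suc j)). maximal_fun F x = top}"
    have N: "?N \<in> sets lebesgue"
    proof -
      have "?N = {x \<in> space lebesgue. x \<in> ball 0 (real (Suc j)) \<and> maximal_fun F x = top}" by auto
      also have "\<dots> \<in> sets lebesgue" by measurable
      finally show ?thesis .
    qed
    let ?X = "ennreal (5 ^ DIM('a)) * (ennreal (c * G (2 * ?r)) * vol (0::'a) (2 * ?r))"
    have "ennreal t * emeasure lebesgue ?N \<le> ?X" if t: "c * Gc 2 * G ?r \<le> t" "0 < t" for t
    proof -
      have "ennreal t * emeasure lebesgue ?N \<le> ennreal t * emeasure lebesgue {x \<in> ?B. ennreal (2 * t) < maximal_fun F x}"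
        by (intro mult_left_mono emeasure_mono measurable_ball_maximal_fun) auto
      also have "\<dots> \<le> ennreal (5 ^ DIM('a)) * tail_int (ball 0 (2 * ?r)) t F"
        using t F c by (intro maximal_fun_local) auto
      also have "\<dots> \<le> ennreal (5 ^ DIM('a)) * abs_int (ball 0 (2 * ?r)) F"
        by (intro mult_left_mono nn_integral_mono) (auto simp: indicator_def)
      also have "\<dots> \<le> ?X"
        using avg_leD[OF F, of "2 * ?r" 0] by (intro mult_left_mono) auto
      finally show ?thesis .
    qed
    moreover have "?X < top"
      using emeasure_lebesgue_ball_finite[of "0::'a" "2 * ?r"] by (intro ennreal_mult_less_top[THEN iffD2] disjI2 conjI) auto
    ultimately have "emeasure lebesgue ?N = 0" by (rule ennreal_mult_bounded_imp_zero)
    then show ?thesis using N by (intro null_setsI)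
  qed
  have "(\<Union>j. {x \<in> ball 0 (real (Suc j)). maximal_fun F x = top}) \<in> null_sets lebesgue"
    by (rule null_sets_UN) (rule null)
  moreover have "{x. maximal_fun F x = top} \<subseteq> (\<Union>j. {x \<in> ball 0 (real (Suc j)). maximal_fun F x = top})"
  proof
    fix x assume "x \<in> {x. maximal_fun F x = top}"
    moreover obtain j :: nat where "norm x < real j" using reals_Archimedean2 by blast
    ultimately show "x \<in> (\<Union>j. {x \<in> ball 0 (real (Suc j)). maximal_fun F x = top})"
      by (auto intro!: exI[of _ j])
  qed
  ultimately show ?thesis
    by (intro AE_I'[of "\<Union>j. {x \<in> ball 0 (real (Suc j)). maximal_fun F x = top}"]) (simp_all only: less_top[symmetric] not_not space_completion space_lborel space_borel UNIV_I simp_thms)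
qed

text \<open>Common frame for strong and weak hypotheses on F, which enter through \<open>F\<close>
  and \<open>large\<close>. If t is large against G(r), the local estimate applies at T = M0 t / 2;
  otherwise t < G(r), so \<Phi>(t) \<le> \<phi>(r) and bounding the set by the whole ball suffices.
  M0 is chosen so that the failure of the first case forces t < G(r), and so that T \<ge> B
  t.\<close>

lemma maximal_weak_aux:
  fixes F :: "'a::euclidean_space \<Rightarrow> real"
  assumes [measurable]: "F \<in> borel_measurable lebesgue" and F: "avg_le c F" and c: "0 < c"
    and M0: "2 * (c * Gc 2) + 2 * B \<le> M0" "0 < B" and r: "0 < r" and t: "0 < t"
    and large: "\<And>T. 0 < T \<Longrightarrow> B * t \<le> T \<Longrightarrow>
      \<Phi> (ennreal t) * (ennreal (5 ^ DIM('a)) * tail_int (ball a (2 * r)) T F)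
       \<le> ennreal (B * t) * (ennreal (\<phi> r) * vol a r)"
  shows "\<Phi> (ennreal t) * emeasure lebesgue {x \<in> ball a r. ennreal (M0 * t) < maximal_fun F x}
    \<le> ennreal (\<phi> r) * vol a r"
proof (cases "c * Gc 2 * G r \<le> M0 * t / 2")
  case True
  let ?E = "{x \<in> ball a r. ennreal (M0 * t) < maximal_fun F x}"
  let ?V = "ennreal (\<phi> r) * vol a r"
  define T where "T = M0 * t / 2"
  have "1 \<le> Gc 2" by (rule Gc_ge_1) simp
  then have "B \<le> M0 / 2" using M0 c by (smt (verit) field_sum_of_halves mult_pos_pos)
  then have BT: "B * t \<le> T" using t by (simp add: T_def)
  then have T: "0 < T" using t M0(2) by (smt (verit) mult_pos_pos)
  have "ennreal T * emeasure lebesgue {x \<in> ball a r. ennreal (2 * T) < maximal_fun F x}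
    \<le> ennreal (5 ^ DIM('a)) * tail_int (ball a (2 * r)) T F"
    using True c T by (intro maximal_fun_local[OF _ F _ r]) (auto simp: T_def)
  then have "\<Phi> (ennreal t) * (ennreal T * emeasure lebesgue ?E)
    \<le> \<Phi> (ennreal t) * (ennreal (5 ^ DIM('a)) * tail_int (ball a (2 * r)) T F)"
    by (intro mult_left_mono) (auto simp: T_def)
  also have "\<dots> \<le> ennreal (B * t) * ?V" by (rule large[OF T BT])
  also have "\<dots> \<le> ennreal T * ?V" by (intro mult_right_mono ennreal_leI BT) auto
  finally have "ennreal T * (\<Phi> (ennreal t) * emeasure lebesgue ?E) \<le> ennreal T * ?V"
    by (simp only: mult_ac)
  then show ?thesis by (rule ennreal_mult_le_cancel[OF T])
next
  case False
  have g1: "1 \<le> Gc 2" by (rule Gc_ge_1) simp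
  have pos: "0 < c * Gc 2" using g1 c by simp
  have "(c * Gc 2) * t \<le> M0 * t / 2" using M0 t by (simp add: mult_right_mono field_simps)
  also have "\<dots> < (c * Gc 2) * G r" using False by simp
  finally have "t < G r" using pos by (simp add: mult_less_cancel_left_pos)
  then have "\<Phi> (ennreal t) \<le> ennreal (\<phi> r)" using r t by (intro Phi_le_phi) auto
  then show ?thesis by (intro mult_mono emeasure_mono) auto
qed

lemma phi_double_ball:
  fixes a :: "'a::euclidean_space"
  assumes "n = DIM('a)" "0 < r"
  shows "ennreal (\<phi> (2 * r)) * vol a (2 * r) \<le> ennreal (D * 2 ^ DIM('a)) * (ennreal (\<phi> r) * vol a r)"
proof -
  have "vol a (2 * r) = ennreal (2 ^ DIM('a)) * vol a r"
    using assms by (intro emeasure_lebesgue_ball_scale) auto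
  moreover have "ennreal (\<phi> (2 * r)) \<le> ennreal (D * \<phi> r)"
    using assms by (intro ennreal_leI phi_dec) auto
  ultimately have "ennreal (\<phi> (2 * r)) * vol a (2 * r) \<le> ennreal (D * \<phi> r) * (ennreal (2 ^ DIM('a)) * vol a r)"
    by (intro mult_mono) auto
  also have "\<dots> = ennreal (D * 2 ^ DIM('a)) * (ennreal (\<phi> r) * vol a r)"
    using D_ge_1 phi_pos[OF assms(2)] by (simp add: ennreal_mult_assoc; simp add: mult_ac)
  finally show ?thesis .
qed

text \<open>\<Phi>(t)/t is almost increasing: \<Phi>(t)/t \<le> K \<Phi>(y)/y with the denominators
  cleared.\<close>

lemma Phi_mult_le:
  assumes "0 < t" "K * t \<le> y"
  shows "\<Phi> (ennreal t) * ennreal y \<le> ennreal (K * t) * \<Phi> (ennreal y)"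
proof -
  have y: "0 < y" using assms K_ge_1 by (smt (verit) mult_pos_pos)
  have "\<Phi> (ennreal t * 1) * ennreal y \<le> (ennreal (K * t / y) * \<Phi> (ennreal y * 1)) * ennreal y"
    by (intro mult_right_mono scale_real assms) auto
  also have "\<dots> = (ennreal y * ennreal (K * t / y)) * \<Phi> (ennreal y)" by (simp add: mult_ac)
  also have "ennreal y * ennreal (K * t / y) = ennreal (K * t)"
    using y assms K_ge_1 by (simp add: ennreal_mult[symmetric])
  finally show ?thesis by simp
qed

text \<open>Where |F| > T \<ge> K t, \<open>Phi_mult_le\<close> bounds \<Phi>(t) |F| by K t
  \<Phi>(|F|), whose integral over the doubled ball the modular controls. In
  \<open>K * D * 10 ^ n\<close>, the doubled ball contributes \<open>D * 2 ^ n\<close> and Vitali's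
  lemma \<open>5 ^ n\<close>.\<close>

lemma maximal_weak:
  fixes F :: "'a::euclidean_space \<Rightarrow> real"
  assumes n: "n = DIM('a)" and [measurable]: "F \<in> borel_measurable lebesgue" and F: "modular_le \<Phi> \<phi> F"
    and M0: "2 * (4 * K * Gc 2) + 2 * (K * D * 10 ^ n) \<le> M0" and r: "0 < r" and t: "0 < t"
  shows "\<Phi> (ennreal t) * emeasure lebesgue {x \<in> ball a r. ennreal (M0 * t) < maximal_fun F x}
    \<le> ennreal (\<phi> r) * vol a r"
proof (rule maximal_weak_aux[OF _ modular_avg_le[OF _ F] _ M0])
  have KD: "1 \<le> D * 10 ^ n" using D_ge_1 by (intro mult_ge1_I) auto
  fix T assume T: "0 < T" "K * D * 10 ^ n * t \<le> T"
  have KT: "K * t \<le> T"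
  proof -
    have "K * t * 1 \<le> K * t * (D * 10 ^ n)" using KD K_ge_1 t by (intro mult_left_mono) auto
    then show ?thesis using T by (simp add: mult_ac)
  qed
  let ?I = "tail_int (ball a (2 * r)) T F"
  have "\<Phi> (ennreal t) * ?I \<le> ennreal (K * t) * (\<integral>\<^sup>+x\<in>ball a (2 * r). \<Phi> (ennreal \<bar>F x\<bar>) \<partial>lebesgue)"
  proof -
    have "\<Phi> (ennreal t) * ?I = (\<integral>\<^sup>+x. \<Phi> (ennreal t) * (ennreal \<bar>F x\<bar> * indicator {x. T < \<bar>F x\<bar>} x * indicator (ball a (2 * r)) x) \<partial>lebesgue)"
      by (subst nn_integral_cmult) auto
    also have "\<dots> \<le> (\<integral>\<^sup>+x. ennreal (K * t) * (\<Phi> (ennreal \<bar>F x\<bar>) * indicator (ball a (2 * r)) x) \<partial>lebesgue)"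
      using Phi_mult_le[OF t] KT by (intro nn_integral_mono) (auto simp: indicator_def)
    also have "\<dots> = ennreal (K * t) * (\<integral>\<^sup>+x\<in>ball a (2 * r). \<Phi> (ennreal \<bar>F x\<bar>) \<partial>lebesgue)"
      by (subst nn_integral_cmult) auto
    finally show ?thesis .
  qed
  also have "\<dots> \<le> ennreal (K * t) * (ennreal (\<phi> (2 * r)) * vol a (2 * r))"
    using F r by (intro mult_left_mono) (auto simp: modular_le_def)
  also have "\<dots> \<le> ennreal (K * t) * (ennreal (D * 2 ^ n) * (ennreal (\<phi> r) * vol a r))"
    using phi_double_ball[OF n r] n by (intro mult_left_mono) auto
  finally have "ennreal (5 ^ n) * (\<Phi> (ennreal t) * ?I) \<le> ennreal (5 ^ n) * (ennreal (K * t) * (ennreal (D * 2 ^ n) * (ennreal (\<phi> r) * vol a r)))"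
    by (intro mult_left_mono) auto
  also have "\<dots> = ennreal (K * D * 10 ^ n * t) * (ennreal (\<phi> r) * vol a r)"
  proof -
    have "(10::real) ^ n = 5 ^ n * 2 ^ n" by (simp add: power_mult_distrib[symmetric])
    then show ?thesis using D_ge_1 K_ge_1 t by (simp add: ennreal_mult_assoc; simp add: mult_ac)
  qed
  finally show "\<Phi> (ennreal t) * (ennreal (5 ^ DIM('a)) * ?I) \<le> ennreal (K * D * 10 ^ n * t) * (ennreal (\<phi> r) * vol a r)"
    by (simp only: n mult_ac)
qed (use K_ge_1 D_ge_1 r t in auto)

text \<open>\<Phi>(|F|) need not be integrable now, so \<open>Phi_mult_le\<close> is applied to the
  level T alone, as \<Phi>(t) T \<le> K t \<Phi>(T), and \<open>weak_modular_layer\<close> bounds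
  the tail above T. The latter adds the factor 2 k to the constant.\<close>

lemma maximal_weak_weak:
  fixes F :: "'a::euclidean_space \<Rightarrow> real"
  assumes n: "n = DIM('a)" and nab: "\<And>t. 0 < t \<Longrightarrow> \<Phi> t \<le> ennreal (1 / (2 * k)) * \<Phi> (ennreal k * t)" and k: "1 < k"
    and [measurable]: "F \<in> borel_measurable lebesgue" and F: "weak_modular_le \<Phi> \<phi> F"
    and M0: "2 * ((2 + 4 * k) * Gc 2) + 2 * (2 * k * K * D * 10 ^ n) \<le> M0" and r: "0 < r" and t: "0 < t"
  shows "\<Phi> (ennreal t) * emeasure lebesgue {x \<in> ball a r. ennreal (M0 * t) < maximal_fun F x}
    \<le> ennreal (\<phi> r) * vol a r"
proof (rule maximal_weak_aux[OF _ weak_modular_avg_le[OF nab k _ F] _ M0])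
  have KD: "1 \<le> 2 * k * D * 10 ^ n" using D_ge_1 k by (intro mult_ge1_I) auto
  fix T assume T: "0 < T" "2 * k * K * D * 10 ^ n * t \<le> T"
  have KT: "K * t \<le> T"
  proof -
    have "K * t * 1 \<le> K * t * (2 * k * D * 10 ^ n)" using KD K_ge_1 t by (intro mult_left_mono) auto
    then show ?thesis using T by (simp add: mult_ac)
  qed
  let ?I = "tail_int (ball a (2 * r)) T F"
  have "ennreal T * (\<Phi> (ennreal t) * ?I) = (\<Phi> (ennreal t) * ennreal T) * ?I"
    by (simp only: mult_ac)
  also have "\<dots> \<le> (ennreal (K * t) * \<Phi> (ennreal T)) * ?I"
    by (intro mult_right_mono Phi_mult_le t KT) auto
  also have "\<dots> = ennreal (K * t) * (\<Phi> (ennreal T) * ?I)" by (simp only: mult_ac)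
  also have "\<dots> \<le> ennreal (K * t) * (ennreal (2 * k * T) * (ennreal (\<phi> (2 * r)) * vol a (2 * r)))"
    using r T by (intro mult_left_mono weak_modular_layer[OF nab k _ F]) auto
  also have "\<dots> \<le> ennreal (K * t) * (ennreal (2 * k * T) * (ennreal (D * 2 ^ n) * (ennreal (\<phi> r) * vol a r)))"
    using phi_double_ball[OF n r] n by (intro mult_left_mono) auto
  also have "\<dots> = ennreal T * (ennreal (K * t * 2 * k * D * 2 ^ n) * (ennreal (\<phi> r) * vol a r))"
    using D_ge_1 K_ge_1 t T(1) k by (simp add: ennreal_mult_assoc; simp add: mult_ac)
  finally have "\<Phi> (ennreal t) * ?I \<le> ennreal (K * t * 2 * k * D * 2 ^ n) * (ennreal (\<phi> r) * vol a r)"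
    by (rule ennreal_mult_le_cancel[OF T(1)])
  then have "ennreal (5 ^ n) * (\<Phi> (ennreal t) * ?I) \<le> ennreal (5 ^ n) * (ennreal (K * t * 2 * k * D * 2 ^ n) * (ennreal (\<phi> r) * vol a r))"
    by (intro mult_left_mono) auto
  also have "\<dots> = ennreal (2 * k * K * D * 10 ^ n * t) * (ennreal (\<phi> r) * vol a r)"
  proof -
    have "(10::real) ^ n = 5 ^ n * 2 ^ n" by (simp add: power_mult_distrib[symmetric])
    then show ?thesis using D_ge_1 K_ge_1 t k by (simp add: ennreal_mult_assoc; simp add: mult_ac)
  qed
  finally show "\<Phi> (ennreal t) * (ennreal (5 ^ DIM('a)) * ?I) \<le> ennreal (2 * k * K * D * 10 ^ n * t) * (ennreal (\<phi> r) * vol a r)"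
    by (simp only: n mult_ac)
qed (use K_ge_1 D_ge_1 r t k in auto)

end

lemma sum_half_powers_le: "(\<Sum>j\<le>J. (1 / 2 :: real) ^ (J - j)) \<le> 2"
proof (induction J)
  case (Suc J)
  have "(\<Sum>j\<le>Suc J. (1 / 2 :: real) ^ (Suc J - j)) = (\<Sum>j\<le>J. (1 / 2) * (1 / 2) ^ (J - j)) + 1"
    by (simp add: Suc_diff_le)
  also have "\<dots> = (1 / 2) * (\<Sum>j\<le>J. (1 / 2) ^ (J - j)) + 1"
    by (simp only: sum_distrib_left)
  finally show ?case using Suc by simp
qed simp

section \<open>Summation over levels, transfer of weak bounds, and the strong estimate\<close>

context quasi_young
begin

text \<open>The sum is a discrete form of t times the integral of \<Phi>(u) / \<open>u ^ 2\<close>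
  over s < u < t. It is dominated by its last nonzero term: relative to the level
  \<open>k ^ J * s\<close> just below t, the j-th term carries the factor
  \<open>(1 / 2) ^ (J - j)\<close>.\<close>

lemma nabla2_layer_sum:
  assumes nab: "\<And>t. 0 < t \<Longrightarrow> \<Phi> t \<le> ennreal (1 / (2 * k)) * \<Phi> (ennreal k * t)" and k: "1 < k" and s: "0 < s"
  shows "(\<Sum>j. ennreal (1 / (k ^ j * s)) * \<Phi> (ennreal (k ^ j * s)) * (ennreal t * indicator {t. k ^ j * s < t} t))
    \<le> ennreal (2 * k) * \<Phi> (ennreal t)"
    (is "(\<Sum>j. ?a j) \<le> _")
proof (cases "s < t")
  case False
  have "\<not> k ^ j * s < t" for j
  proof -
    have "s \<le> k ^ j * s" using k s by simp
    then show ?thesis using False by linarith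
  qed
  then show ?thesis by (simp add: indicator_def)
next
  case True
  obtain J where J: "k ^ J * s < t" "t \<le> k ^ Suc J * s"
    using geometric_layer[OF s k True] by blast
  have zero: "?a j = 0" if "j \<notin> {..J}" for j
  proof -
    have "k ^ Suc J * s \<le> k ^ j * s" using that k s by (intro mult_right_mono power_increasing) auto
    then show ?thesis using J by (auto simp: indicator_def)
  qed
  have le: "?a j \<le> ennreal ((1 / 2) ^ (J - j) * k) * \<Phi> (ennreal (k ^ J * s))" if "j \<le> J" for j
  proof -
    have kk: "k ^ (J - j) * k ^ j = k ^ J" using that by (simp add: power_add[symmetric])
    have pos: "0 < k ^ j * s" using k s by simp
    have "\<Phi> (ennreal (k ^ j * s)) \<le> ennreal ((1 / (2 * k)) ^ (J - j)) * \<Phi> (ennreal (k ^ (J - j) * (k ^ j * s)))"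
      by (rule nabla2_iter[OF nab k pos])
    also have "k ^ (J - j) * (k ^ j * s) = k ^ J * s" by (simp only: mult.assoc[symmetric] kk)
    finally have 1: "\<Phi> (ennreal (k ^ j * s)) \<le> ennreal ((1 / (2 * k)) ^ (J - j)) * \<Phi> (ennreal (k ^ J * s))" .
    have "t / (k ^ j * s) \<le> k ^ Suc J * s / (k ^ j * s)"
      using pos J(2) by (intro divide_right_mono) auto
    also have "\<dots> = k ^ (J - j) * k" using pos s k kk[symmetric] by (simp add: field_simps)
    finally have 2: "t / (k ^ j * s) \<le> k ^ (J - j) * k" .
    have "?a j \<le> \<Phi> (ennreal (k ^ j * s)) * (ennreal (1 / (k ^ j * s)) * ennreal t)"
      by (auto simp: indicator_def mult_ac)
    also have "ennreal (1 / (k ^ j * s)) * ennreal t = ennreal (t / (k ^ j * s))"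
      using pos s True by (simp add: ennreal_mult[symmetric])
    also have "\<Phi> (ennreal (k ^ j * s)) * ennreal (t / (k ^ j * s)) \<le>
      (ennreal ((1 / (2 * k)) ^ (J - j)) * \<Phi> (ennreal (k ^ J * s))) * ennreal (k ^ (J - j) * k)"
      using 1 2 by (intro mult_mono ennreal_leI) auto
    also have "\<dots> = (ennreal ((1 / (2 * k)) ^ (J - j)) * ennreal (k ^ (J - j) * k)) * \<Phi> (ennreal (k ^ J * s))"
      by (simp only: mult_ac)
    also have "ennreal ((1 / (2 * k)) ^ (J - j)) * ennreal (k ^ (J - j) * k) = ennreal ((1 / 2) ^ (J - j) * k)"
      using k by (simp add: ennreal_mult[symmetric] power_divide power_mult_distrib)
    finally show ?thesis .
  qed
  have "(\<Sum>j. ?a j) = (\<Sum>j\<le>J. ?a j)"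
    using zero by (intro suminf_finite) auto
  also have "\<dots> \<le> (\<Sum>j\<le>J. ennreal ((1 / 2) ^ (J - j) * k) * \<Phi> (ennreal (k ^ J * s)))"
    by (intro sum_mono le) auto
  also have "\<dots> = ennreal (\<Sum>j\<le>J. (1 / 2) ^ (J - j) * k) * \<Phi> (ennreal (k ^ J * s))"
    using k by (simp add: sum_distrib_right[symmetric])
  also have "\<dots> \<le> ennreal (2 * k) * \<Phi> (ennreal t)"
  proof (intro mult_mono ennreal_leI mono')
    show "(\<Sum>j\<le>J. (1 / 2) ^ (J - j) * k) \<le> 2 * k"
      using sum_half_powers_le[of J] k by (simp add: sum_distrib_right[symmetric])
  qed (use J in auto)
  finally show ?thesis .
qed

text \<open>Carries the weak bound for M over to a set described through \<Phi>(M). As v need not be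
  a value of \<Phi>, the bound is used at a level above the inverse \<tau> of v, and the 2 in
  \<open>2 * M0\<close> leaves room for that.\<close>

lemma weak_transfer:
  fixes M :: "'a::euclidean_space \<Rightarrow> ennreal"
  assumes W: "\<And>t. 0 < t \<Longrightarrow> \<Phi> (ennreal t) * emeasure lebesgue {x \<in> B. ennreal (M0 * t) < M x} \<le> V"
    and fin: "AE x in lebesgue. M x < top"
    and meas: "\<And>u. {x \<in> B. u < M x} \<in> sets lebesgue"
    and M0: "0 < M0" and S: "\<And>x. x \<in> S \<Longrightarrow> x \<in> B \<and> v \<le> \<Phi> (M x / ennreal (2 * M0))"
  shows "v * emeasure lebesgue S \<le> V"
proof (cases "v = 0")
  case False
  define \<tau> where "\<tau> = Inf {t. v \<le> \<Phi> t}"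
  have tau_le: "\<tau> \<le> M x / ennreal (2 * M0)" if "x \<in> S" for x
    using S[OF that] unfolding \<tau>_def by (intro Inf_lower) auto
  show ?thesis
  proof (cases "\<tau> = top")
    case True
    \<comment> \<open>Here M is \<infinity> at every point of S, which by \<open>fin\<close> happens
      only on a null set.\<close>
    have "AE x in lebesgue. x \<notin> S"
      using fin
    proof eventually_elim
      case (elim x)
      have "M x / ennreal (2 * M0) < top" using elim M0 by (simp add: ennreal_divide_eq_top_iff less_top[symmetric])
      then show ?case using tau_le[of x] True by (auto simp: top_unique)
    qed
    then obtain N where N: "N \<in> null_sets lebesgue" "S \<subseteq> N"
      unfolding eventually_ae_filter by auto
    then have "emeasure lebesgue S \<le> emeasure lebesgue N" by (intro emeasure_mono) auto
    then have "emeasure lebesgue S = 0" using N by (simp add: null_setsD1)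
    then show ?thesis by simp
  next
    case False
    then obtain p where p: "\<tau> = ennreal p" "0 \<le> p" by (cases \<tau>) auto
    obtain \<epsilon> where \<epsilon>: "0 < \<epsilon>" "\<Phi> \<epsilon> < v" using small[of v] \<open>v \<noteq> 0\<close> by (auto simp: zero_less_iff_neq_zero)
    have "\<epsilon> \<le> \<tau>" unfolding \<tau>_def
    proof (rule Inf_greatest)
      fix t assume "t \<in> {t. v \<le> \<Phi> t}"
      then show "\<epsilon> \<le> t" using \<epsilon> mono'[of t \<epsilon>] by (metis leD le_cases mem_Collect_eq order_trans)
    qed
    then have p0: "0 < p" using \<epsilon> p by (metis ennreal_less_zero_iff order_less_le_trans)
    \<comment> \<open>3/2 lies strictly between 1 and 2: \<Phi> has already reached v at
      \<open>3 / 2 * p\<close>, while on S the value of M is at least \<open>2 * M0 * p\<close>,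
      above \<open>M0 * (3 / 2 * p)\<close>.\<close>
    have "\<tau> < ennreal (3 / 2 * p)" using p p0 by (simp add: ennreal_less_iff)
    then obtain t where t: "v \<le> \<Phi> t" "t < ennreal (3 / 2 * p)" unfolding \<tau>_def Inf_less_iff by auto
    then have v: "v \<le> \<Phi> (ennreal (3 / 2 * p))" using mono'[OF less_imp_le[OF t(2)]] t(1) by order
    have "S \<subseteq> {x \<in> B. ennreal (M0 * (3 / 2 * p)) < M x}"
    proof
      fix x assume x: "x \<in> S"
      have "\<tau> * ennreal (2 * M0) \<le> M x / ennreal (2 * M0) * ennreal (2 * M0)"
        by (intro mult_right_mono tau_le x) auto
      also have "\<dots> = M x" using M0 by (simp add: ennreal_divide_times ennreal_divide_self)
      finally have "ennreal (p * (2 * M0)) \<le> M x" using p M0 by (simp add: ennreal_mult)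
      moreover have "ennreal (M0 * (3 / 2 * p)) < ennreal (p * (2 * M0))"
        using M0 p0 by (intro ennreal_lessI) auto
      ultimately show "x \<in> {x \<in> B. ennreal (M0 * (3 / 2 * p)) < M x}" using S[OF x] by auto
    qed
    then have "v * emeasure lebesgue S \<le> \<Phi> (ennreal (3 / 2 * p)) * emeasure lebesgue {x \<in> B. ennreal (M0 * (3 / 2 * p)) < M x}"
      using v by (intro mult_mono emeasure_mono meas) auto
    also have "\<dots> \<le> V" using p0 by (intro W) auto
    finally show ?thesis .
  qed
qed simp

end

context orlicz_morrey
begin

text \<open>\<Phi>(M F / M0) is at most \<phi>(r) / 2 where M F \<le> 2 s, and elsewhere at most a
  multiple of \<Phi>(T j) for the geometric layer containing M F. \<open>maximal_fun_local\<close>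
  bounds the measure of each \<open>E j\<close> by a tail integral of F, and the tails are summed by
  \<open>nabla2_layer_sum\<close>. The two summands of M0 make each contribution at most half of the
  right-hand side.\<close>

lemma maximal_strong:
  fixes F :: "'a::euclidean_space \<Rightarrow> real"
  assumes n: "n = DIM('a)" and nab: "\<And>t. 0 < t \<Longrightarrow> \<Phi> t \<le> ennreal (1 / (2 * k)) * \<Phi> (ennreal k * t)" and k: "1 < k"
    and [measurable]: "F \<in> borel_measurable lebesgue" and F: "modular_le \<Phi> \<phi> F"
    and M0: "8 * K * (4 * K * Gc 2) + 8 * k * k * K * D * 10 ^ n \<le> M0" and r: "0 < r"
  shows "(\<integral>\<^sup>+x\<in>ball a r. \<Phi> (maximal_fun F x / ennreal M0) \<partial>lebesgue) \<le> ennreal (\<phi> r) * vol a r"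
proof -
  let ?B = "ball a r" let ?B2 = "ball a (2 * r)"
  let ?V = "ennreal (\<phi> r) * emeasure lebesgue ?B"
  define s where "s = 4 * K * Gc 2 * G r"
  define T where "T j = k ^ j * s" for j :: nat
  have g2: "1 \<le> Gc 2" by (rule Gc_ge_1) simp
  have s: "0 < s" using K_ge_1 g2 G_pos[OF r] by (simp add: s_def)
  have T: "0 < T j" "s \<le> T j" for j using s k by (auto simp: T_def)
  have avg: "avg_le (4 * K) F" by (rule modular_avg_le) fact+
  have c1: "0 \<le> 8 * K * (4 * K * Gc 2)" using K_ge_1 g2 by simp
  have c2: "0 \<le> 8 * k * k * K * D * 10 ^ n" using K_ge_1 D_ge_1 k by simp
  have M0': "8 * K * (4 * K * Gc 2) \<le> M0" "8 * k * k * K * D * 10 ^ n \<le> M0" using c1 c2 M0 by linarith+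
  have "8 * K * 1 \<le> 8 * K * (4 * K * Gc 2)" using K_ge_1 g2 by (intro mult_left_mono mult_ge1_I) auto
  then have M0pos: "0 < M0" using M0' K_ge_1 by linarith
  have KkM: "K * (2 * k) \<le> M0"
  proof -
    have "2 * k * K * 1 \<le> (2 * k * K) * (4 * k * D * 10 ^ n)"
      using K_ge_1 D_ge_1 k by (intro mult_left_mono mult_ge1_I) auto
    then show ?thesis using M0'(2) by (simp add: mult_ac)
  qed
  define E where "E j = {x \<in> ?B. ennreal (2 * T j) < maximal_fun F x}" for j
  have [measurable]: "E j \<in> sets lebesgue" for j unfolding E_def by (rule measurable_ball_maximal_fun)
  let ?I = "\<lambda>j. tail_int ?B2 (T j) F"
  \<comment> \<open>The first summand of M0 gives 2 s / M0 \<le> G(r) / (4 K).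
    \<open>scale_real\<close> trades this for a factor 1/2 in front of \<Phi>(G(r) / 2), whose
    argument is strictly below G(r).\<close>
  have small_part: "\<Phi> (ennreal (2 * s / M0)) \<le> ennreal (1 / 2 * \<phi> r)"
  proof -
    have "2 * s / M0 \<le> 1 / (4 * K) * G r"
    proof -
      have "8 * K * (4 * K * Gc 2) * G r \<le> M0 * G r" using M0' G_pos[OF r] by (intro mult_right_mono) auto
      then show ?thesis using M0pos K_ge_1 by (simp add: s_def field_simps)
    qed
    then have "\<Phi> (ennreal (2 * s / M0)) \<le> \<Phi> (ennreal (1 / (4 * K)) * ennreal (G r))"
      using K_ge_1 G_pos[OF r] by (intro mono') (simp add: ennreal_mult[symmetric] ennreal_leI)
    also have "\<dots> \<le> ennreal (K * (1 / (4 * K)) / (1 / 2)) * \<Phi> (ennreal (1 / 2) * ennreal (G r))"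
      using K_ge_1 by (intro scale_real) auto
    also have "K * (1 / (4 * K)) / (1 / 2) = 1 / 2" using K_ge_1 by simp
    also have "ennreal (1 / 2) * ennreal (G r) = ennreal (1 / 2 * G r)"
      using G_pos[OF r] by (intro ennreal_mult[symmetric]) auto
    also have "ennreal (1 / 2) * \<Phi> (ennreal (1 / 2 * G r)) \<le> ennreal (1 / 2) * ennreal (\<phi> r)"
      using G_pos[OF r] r by (intro mult_left_mono Phi_le_phi) auto
    also have "\<dots> = ennreal (1 / 2 * \<phi> r)" using phi_pos[OF r] by (intro ennreal_mult[symmetric]) auto
    finally show ?thesis .
  qed
  \<comment> \<open>A single layer suffices at each x; passing to the whole series gives a bound
    that can be integrated term by term.\<close>
  have pt: "\<Phi> (maximal_fun F x / ennreal M0) \<le> ennreal (1 / 2 * \<phi> r) + (\<Sum>j. ennreal (2 * k * K / M0) * (\<Phi> (ennreal (T j)) * indicator (E j) x))"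
    if fin: "maximal_fun F x < top" and xB: "x \<in> ?B" for x
  proof -
    obtain m where m: "maximal_fun F x = ennreal m" "0 \<le> m" using fin by (cases "maximal_fun F x") auto
    have mM: "maximal_fun F x / ennreal M0 = ennreal (m / M0)" using m M0pos by (simp add: divide_ennreal)
    show ?thesis
    proof (cases "2 * s < m")
      case False
      then have "m / M0 \<le> 2 * s / M0" using M0pos by (intro divide_right_mono) auto
      then have "\<Phi> (ennreal (m / M0)) \<le> \<Phi> (ennreal (2 * s / M0))" by (intro mono' ennreal_leI)
      then show ?thesis using small_part unfolding mM by (intro add_increasing2) auto
    next
      case True
      then obtain j where j: "k ^ j * (2 * s) < m" "m \<le> k ^ Suc j * (2 * s)"
        using geometric_layer[of "2 * s" k m] s k by auto
      have "0 < m" using True s by simp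
      then have "x \<in> E j" using j(1) xB m unfolding E_def T_def by (auto intro!: ennreal_lessI simp: mult_ac)
      have "m / M0 \<le> (2 * k * T j) / M0" using j(2) M0pos by (intro divide_right_mono) (auto simp: T_def mult_ac)
      then have "\<Phi> (ennreal (m / M0)) \<le> \<Phi> (ennreal ((2 * k * T j) / M0) * 1)" by (simp add: mono' ennreal_leI)
      also have "\<dots> \<le> ennreal (K * ((2 * k * T j) / M0) / T j) * \<Phi> (ennreal (T j) * 1)"
      proof (rule scale_real)
        show "0 < 2 * k * T j / M0" using T k M0pos by simp
        have "K * (2 * k) * T j \<le> M0 * T j" using KkM T(1)[of j] by (intro mult_right_mono) auto
        then show "K * (2 * k * T j / M0) \<le> T j" using M0pos by (simp add: field_simps)
      qed
      also have "K * ((2 * k * T j) / M0) / T j = 2 * k * K / M0" using T(1)[of j] by (simp add: field_simps)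
      finally have "\<Phi> (ennreal (m / M0)) \<le> ennreal (2 * k * K / M0) * (\<Phi> (ennreal (T j)) * indicator (E j) x)"
        using \<open>x \<in> E j\<close> by simp
      also have "\<dots> \<le> (\<Sum>j. ennreal (2 * k * K / M0) * (\<Phi> (ennreal (T j)) * indicator (E j) x))"
        by (rule single_le_suminf_ennreal)
      finally show ?thesis unfolding mM by (intro add_increasing) auto
    qed
  qed
  have EI: "\<Phi> (ennreal (T j)) * emeasure lebesgue (E j) \<le> ennreal (5 ^ n) * (ennreal (1 / T j) * \<Phi> (ennreal (T j)) * ?I j)" for j
  proof -
    have "4 * K * Gc 2 * G r \<le> T j" using T(2)[of j] by (simp add: s_def)
    then have "ennreal (T j) * emeasure lebesgue (E j) \<le> ennreal (5 ^ DIM('a)) * ?I j"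
      unfolding E_def using K_ge_1 T by (intro maximal_fun_local[OF _ avg _ r]) auto
    then have "ennreal (1 / T j) * (ennreal (T j) * emeasure lebesgue (E j)) \<le> ennreal (1 / T j) * (ennreal (5 ^ DIM('a)) * ?I j)"
      by (rule mult_left_mono) simp
    also have "ennreal (1 / T j) * (ennreal (T j) * emeasure lebesgue (E j)) = emeasure lebesgue (E j)"
      using T(1)[of j] by (simp add: ennreal_mult_assoc)
    finally have "\<Phi> (ennreal (T j)) * emeasure lebesgue (E j) \<le> \<Phi> (ennreal (T j)) * (ennreal (1 / T j) * (ennreal (5 ^ DIM('a)) * ?I j))"
      by (rule mult_left_mono) simp
    then show ?thesis by (simp only: n mult_ac)
  qed
  \<comment> \<open>The sum is moved under the integral, where \<open>nabla2_layer_sum\<close>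
    applies at each point with t = |F x|.\<close>
  have sumI: "(\<Sum>j. ennreal (1 / T j) * \<Phi> (ennreal (T j)) * ?I j) \<le> ennreal (2 * k) * (\<integral>\<^sup>+x\<in>?B2. \<Phi> (ennreal \<bar>F x\<bar>) \<partial>lebesgue)"
  proof -
    have "(\<Sum>j. ennreal (1 / T j) * \<Phi> (ennreal (T j)) * ?I j) =
      (\<Sum>j. \<integral>\<^sup>+x. ennreal (1 / T j) * \<Phi> (ennreal (T j)) * (ennreal \<bar>F x\<bar> * indicator {x. T j < \<bar>F x\<bar>} x * indicator ?B2 x) \<partial>lebesgue)"
      by (subst nn_integral_cmult) auto
    also have "\<dots> = (\<integral>\<^sup>+x. (\<Sum>j. ennreal (1 / T j) * \<Phi> (ennreal (T j)) * (ennreal \<bar>F x\<bar> * indicator {x. T j < \<bar>F x\<bar>} x * indicator ?B2 x)) \<partial>lebesgue)"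
      by (rule nn_integral_suminf[symmetric]) measurable
    also have "\<dots> \<le> (\<integral>\<^sup>+x. ennreal (2 * k) * (\<Phi> (ennreal \<bar>F x\<bar>) * indicator ?B2 x) \<partial>lebesgue)"
    proof (rule nn_integral_mono)
      fix x
      show "(\<Sum>j. ennreal (1 / T j) * \<Phi> (ennreal (T j)) * (ennreal \<bar>F x\<bar> * indicator {x. T j < \<bar>F x\<bar>} x * indicator ?B2 x)) \<le> ennreal (2 * k) * (\<Phi> (ennreal \<bar>F x\<bar>) * indicator ?B2 x)"
      proof (cases "x \<in> ?B2")
        case True
        then show ?thesis using nabla2_layer_sum[OF nab k s, of "\<bar>F x\<bar>"] by (simp add: T_def indicator_def)
      qed simp
    qed
    also have "\<dots> = ennreal (2 * k) * (\<integral>\<^sup>+x\<in>?B2. \<Phi> (ennreal \<bar>F x\<bar>) \<partial>lebesgue)"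
      by (rule nn_integral_cmult) measurable
    finally show ?thesis .
  qed
  have "(\<integral>\<^sup>+x\<in>?B. \<Phi> (maximal_fun F x / ennreal M0) \<partial>lebesgue) \<le>
    (\<integral>\<^sup>+x. ennreal (1 / 2 * \<phi> r) * indicator ?B x + (\<Sum>j. ennreal (2 * k * K / M0) * (\<Phi> (ennreal (T j)) * indicator (E j) x)) \<partial>lebesgue)"
  proof (rule nn_integral_mono_AE)
    have "AE x in lebesgue. maximal_fun F x < top"
      using K_ge_1 by (intro maximal_fun_finite_AE[OF _ avg]) auto
    then show "AE x in lebesgue. \<Phi> (maximal_fun F x / ennreal M0) * indicator ?B x \<le>
       ennreal (1 / 2 * \<phi> r) * indicator ?B x + (\<Sum>j. ennreal (2 * k * K / M0) * (\<Phi> (ennreal (T j)) * indicator (E j) x))"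
    proof eventually_elim
      case (elim x)
      then show ?case using pt[of x] by (cases "x \<in> ?B") simp_all
    qed
  qed
  also have "\<dots> = (\<integral>\<^sup>+x. ennreal (1 / 2 * \<phi> r) * indicator ?B x \<partial>lebesgue) + (\<integral>\<^sup>+x. (\<Sum>j. ennreal (2 * k * K / M0) * (\<Phi> (ennreal (T j)) * indicator (E j) x)) \<partial>lebesgue)"
    by (rule nn_integral_add) measurable
  also have "(\<integral>\<^sup>+x. ennreal (1 / 2 * \<phi> r) * indicator ?B x \<partial>lebesgue) = ennreal (1 / 2 * \<phi> r) * emeasure lebesgue ?B"
    by (rule nn_integral_cmult_indicator) measurable
  also have "(\<integral>\<^sup>+x. (\<Sum>j. ennreal (2 * k * K / M0) * (\<Phi> (ennreal (T j)) * indicator (E j) x)) \<partial>lebesgue)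
     = (\<Sum>j. \<integral>\<^sup>+x. ennreal (2 * k * K / M0) * (\<Phi> (ennreal (T j)) * indicator (E j) x) \<partial>lebesgue)"
    by (rule nn_integral_suminf) measurable
  also have "\<dots> = (\<Sum>j. ennreal (2 * k * K / M0) * (\<Phi> (ennreal (T j)) * emeasure lebesgue (E j)))"
  proof (rule suminf_cong)
    fix j
    have "(\<integral>\<^sup>+x. ennreal (2 * k * K / M0) * (\<Phi> (ennreal (T j)) * indicator (E j) x) \<partial>lebesgue) =
      ennreal (2 * k * K / M0) * (\<integral>\<^sup>+x. \<Phi> (ennreal (T j)) * indicator (E j) x \<partial>lebesgue)"
      by (rule nn_integral_cmult) measurable
    also have "(\<integral>\<^sup>+x. \<Phi> (ennreal (T j)) * indicator (E j) x \<partial>lebesgue) = \<Phi> (ennreal (T j)) * emeasure lebesgue (E j)"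
      by (rule nn_integral_cmult_indicator) measurable
    finally show "(\<integral>\<^sup>+x. ennreal (2 * k * K / M0) * (\<Phi> (ennreal (T j)) * indicator (E j) x) \<partial>lebesgue) =
      ennreal (2 * k * K / M0) * (\<Phi> (ennreal (T j)) * emeasure lebesgue (E j))" .
  qed
  also have "\<dots> \<le> (\<Sum>j. ennreal (2 * k * K / M0) * (ennreal (5 ^ n) * (ennreal (1 / T j) * \<Phi> (ennreal (T j)) * ?I j)))"
    using EI by (intro suminf_le mult_left_mono summableI) auto
  also have "\<dots> = ennreal (2 * k * K / M0) * (ennreal (5 ^ n) * (\<Sum>j. ennreal (1 / T j) * \<Phi> (ennreal (T j)) * ?I j))"
    by simp
  also have "\<dots> \<le> ennreal (2 * k * K / M0) * (ennreal (5 ^ n) * (ennreal (2 * k) * (ennreal (D * 2 ^ n) * ?V)))"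
  proof -
    have "(\<integral>\<^sup>+x\<in>?B2. \<Phi> (ennreal \<bar>F x\<bar>) \<partial>lebesgue) \<le> ennreal (\<phi> (2 * r)) * emeasure lebesgue ?B2"
      using F r by (auto simp: modular_le_def)
    also have "\<dots> \<le> ennreal (D * 2 ^ n) * ?V"
      using phi_double_ball[OF n r, of a] by (simp add: n)
    finally have "ennreal (2 * k) * (\<integral>\<^sup>+x\<in>?B2. \<Phi> (ennreal \<bar>F x\<bar>) \<partial>lebesgue) \<le> ennreal (2 * k) * (ennreal (D * 2 ^ n) * ?V)"
      by (rule mult_left_mono) simp
    then show ?thesis using sumI by (intro mult_left_mono) (auto intro: order_trans)
  qed
  also have "\<dots> = ennreal (4 * k * k * K * D * 10 ^ n / M0) * ?V"
  proof -
    have "(10::real) ^ n = 5 ^ n * 2 ^ n" by (simp add: power_mult_distrib[symmetric])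
    then show ?thesis using k K_ge_1 D_ge_1 M0pos by (simp add: ennreal_mult_assoc; simp add: mult_ac)
  qed
  \<comment> \<open>The numerator is half of the second summand of M0.\<close>
  also have "\<dots> \<le> ennreal (1 / 2) * ?V"
    using M0'(2) M0pos by (intro mult_right_mono ennreal_leI) (auto simp: field_simps)
  also have "ennreal (1 / 2 * \<phi> r) * emeasure lebesgue ?B = ennreal (1 / 2) * ?V"
    using phi_pos[OF r] by (subst ennreal_mult_assoc) auto
  also have "ennreal (1 / 2) * ?V + ennreal (1 / 2) * ?V = ?V"
  proof -
    have "ennreal (1 / 2) + ennreal (1 / 2) = 1" by (subst ennreal_plus[symmetric]) auto
    then show ?thesis by (simp only: distrib_right[symmetric] mult_1)
  qed
  finally show ?thesis by (simp add: add_left_mono)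
qed

end

section \<open>Kernel estimates\<close>

definition rho_int :: "(real \<Rightarrow> real) \<Rightarrow> real \<Rightarrow> ennreal" where
  "rho_int \<rho> r = (\<integral>\<^sup>+t\<in>{0<..<r}. ennreal (\<rho> t / t) \<partial>lebesgue)"

lemma borel_version:
  fixes f :: "'a::euclidean_space \<Rightarrow> real"
  assumes "f \<in> borel_measurable lebesgue"
  obtains g where "g \<in> borel_measurable borel" "AE y in lborel. f y = g y"
  using completion_ex_borel_measurable_real[OF assms] by auto

locale frac_kernel =
  fixes \<rho> :: "real \<Rightarrow> real" and C K1 K2 :: real
  assumes rho_pos: "0 < t \<Longrightarrow> 0 < \<rho> t"
    and rho_meas: "\<rho> \<in> borel_measurable (lebesgue_on {0<..})"
    and C_pos: "0 < C" and K1_pos: "0 < K1" and K1_less_K2: "K1 < K2"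
    and rho_le: "0 < r \<Longrightarrow> ennreal (\<rho> r) \<le> ennreal C * (\<integral>\<^sup>+t\<in>{K1 * r<..<K2 * r}. ennreal (\<rho> t / t) \<partial>lebesgue)"
begin

lemma K2_pos: "0 < K2" using K1_pos K1_less_K2 by simp

lemma rhob_ex: "\<exists>\<rho>'. \<rho>' \<in> borel_measurable borel \<and> (\<forall>t. 0 \<le> \<rho>' t) \<and> (AE t in lborel. 0 < t \<longrightarrow> \<rho> t = \<rho>' t)"
proof -
  have "(\<lambda>t. if t \<in> {0<..} then \<rho> t else 0) \<in> borel_measurable lebesgue"
    using rho_meas by (subst borel_measurable_if) auto
  then obtain g where g: "g \<in> borel_measurable borel" "AE t in lborel. (if t \<in> {0<..} then \<rho> t else 0) = g t"
    by (rule borel_version)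
  show ?thesis
  proof (intro exI[of _ "\<lambda>t. max 0 (g t)"] conjI)
    show "(\<lambda>t. max 0 (g t)) \<in> borel_measurable borel" using g(1) by simp
    show "AE t in lborel. 0 < t \<longrightarrow> \<rho> t = max 0 (g t)"
      using g(2) 
    proof eventually_elim
      case (elim t)
      then show ?case using rho_pos[of t] by auto
    qed
  qed simp
qed

text \<open>Borel version of \<rho>, fixed once and nonnegative everywhere: Fubini in (y, t) and the
  composition with \<open>norm (x - y)\<close> want a Borel function.\<close>

definition rhob :: "real \<Rightarrow> real" where
  "rhob = (SOME \<rho>'. \<rho>' \<in> borel_measurable borel \<and> (\<forall>t. 0 \<le> \<rho>' t) \<and> (AE t in lborel. 0 < t \<longrightarrow> \<rho> t = \<rho>' t))"

lemma rhob_measurable [measurable]: "rhob \<in> borel_measurable borel"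
  and rhob_nonneg: "0 \<le> rhob t"
  and rhob_AE: "AE t in lborel. 0 < t \<longrightarrow> \<rho> t = rhob t"
  using someI_ex[OF rhob_ex, folded rhob_def] by auto

lemma nn_integral_rho:
  assumes "A \<subseteq> {0<..}"
  shows "(\<integral>\<^sup>+t\<in>A. ennreal (\<rho> t / t) * g t \<partial>lebesgue) = (\<integral>\<^sup>+t\<in>A. ennreal (rhob t / t) * g t \<partial>lborel)"
  unfolding nn_integral_completion
proof (rule nn_integral_cong_AE)
  show "AE t in lborel. ennreal (\<rho> t / t) * g t * indicator A t = ennreal (rhob t / t) * g t * indicator A t"
    using rhob_AE
  proof eventually_elim
    case (elim t)
    then show ?case using assms by (cases "t \<in> A") auto
  qed
qed

lemma nn_integral_rho':
  assumes "A \<subseteq> {0<..}"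
  shows "(\<integral>\<^sup>+t\<in>A. ennreal (\<rho> t / t) \<partial>lebesgue) = (\<integral>\<^sup>+t\<in>A. ennreal (rhob t / t) \<partial>lborel)"
  using nn_integral_rho[OF assms, of "\<lambda>_. 1"] by simp

lemma rhob_le:
  "AE t in lborel. 0 < t \<longrightarrow> \<rho> t = rhob t \<and> ennreal (rhob t) \<le> ennreal C * (\<integral>\<^sup>+s\<in>{K1 * t<..<K2 * t}. ennreal (rhob s / s) \<partial>lborel)"
  using rhob_AE
proof eventually_elim
  case (elim t)
  show ?case
  proof
    assume t: "0 < t"
    then have "{K1 * t<..<K2 * t} \<subseteq> {0<..}" using K1_pos by (auto intro: less_trans[OF mult_pos_pos])
    then show "\<rho> t = rhob t \<and> ennreal (rhob t) \<le> ennreal C * (\<integral>\<^sup>+s\<in>{K1 * t<..<K2 * t}. ennreal (rhob s / s) \<partial>lborel)"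
      using rho_le[OF t] elim t nn_integral_rho' by auto
  qed
qed

lemma frac_integrand_AE:
  fixes x :: "'a::euclidean_space"
  assumes "AE y in lborel. f y = g y"
  shows "AE y in lborel. frac_integrand \<rho> f x y = rhob (norm (x - y)) / norm (x - y) ^ DIM('a) * g y"
proof -
  have "AE y in lborel. y \<noteq> x" by (simp add: AE_lborel_singleton)
  then show ?thesis
    using AE_norm_lborel[OF rhob_AE, of x] assms
    by eventually_elim (simp add: frac_integrand_def)
qed

lemma measurable_frac_integrand:
  fixes f :: "'a::euclidean_space \<Rightarrow> real"
  assumes "f \<in> borel_measurable lebesgue"
  shows "frac_integrand \<rho> f x \<in> borel_measurable lebesgue"
proof -
  obtain g where [measurable]: "g \<in> borel_measurable borel" and g: "AE y in lborel. f y = g y"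
    using borel_version[OF assms] by blast
  have "(\<lambda>y. rhob (norm (x - y)) / norm (x - y) ^ DIM('a) * g y) \<in> borel_measurable lborel" by measurable
  then have "(\<lambda>y. rhob (norm (x - y)) / norm (x - y) ^ DIM('a) * g y) \<in> borel_measurable lebesgue"
    by (rule measurable_completion)
  moreover have "AE y in lebesgue. rhob (norm (x - y)) / norm (x - y) ^ DIM('a) * g y = frac_integrand \<rho> f x y"
    using AE_completion[OF frac_integrand_AE[OF g, of x]] by eventually_elim simp
  ultimately show ?thesis by (rule borel_measurable_AE)
qed

text \<open>For each fixed x the integrands built from \<rho>, f and from their Borel versions agree
  for almost every y. So the two integrals agree at every x, and the second depends measurably on
  x.\<close>

lemma measurable_frac_int:
  fixes f :: "'a::euclidean_space \<Rightarrow> real"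
  assumes "f \<in> borel_measurable lebesgue"
  shows "frac_int \<rho> f \<in> borel_measurable lebesgue"
proof -
  obtain g where [measurable]: "g \<in> borel_measurable borel" and g: "AE y in lborel. f y = g y"
    using borel_version[OF assms] by blast
  have "frac_int \<rho> f x = (\<integral>y. rhob (norm (x - y)) / norm (x - y) ^ DIM('a) * g y \<partial>lborel)" for x
  proof -
    have m: "(\<lambda>y. rhob (norm (x - y)) / norm (x - y) ^ DIM('a) * g y) \<in> borel_measurable lborel" by measurable
    have "frac_int \<rho> f x = (\<integral>y. rhob (norm (x - y)) / norm (x - y) ^ DIM('a) * g y \<partial>lebesgue)"
      unfolding frac_int_def
      using AE_completion[OF frac_integrand_AE[OF g, of x]]
      by (intro integral_cong_AE measurable_frac_integrand assms measurable_completion[OF m])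
    also have "\<dots> = (\<integral>y. rhob (norm (x - y)) / norm (x - y) ^ DIM('a) * g y \<partial>lborel)"
      by (rule integral_completion[OF m])
    finally show ?thesis .
  qed
  then have "frac_int \<rho> f = (\<lambda>x. \<integral>y. rhob (norm (x - y)) / norm (x - y) ^ DIM('a) * g y \<partial>lborel)" by auto
  also have "\<dots> \<in> borel_measurable lborel" by measurable
  finally show ?thesis by (rule measurable_completion)
qed

text \<open>With s = |x - y|, the bound on \<rho>(s) is an integral over K1 s < t < K2 s. There t <
  K2 s bounds \<open>1 / s ^ n\<close> by \<open>K2 ^ n / t ^ n\<close>, n being the dimension, and
  K1 s < t places y in the ball of radius t / K1; exchanging the integrals leaves |f| integrated
  over that ball. S selects the distances s, and T contains the t they reach.\<close>

lemma kernel_bound: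
  fixes f :: "'a::euclidean_space \<Rightarrow> real"
  assumes f: "f \<in> borel_measurable lebesgue"
    and [measurable]: "S \<in> sets borel" "T \<in> sets borel" and T: "T \<subseteq> {0<..}"
    and ST: "\<And>s t. s \<in> S \<Longrightarrow> 0 < s \<Longrightarrow> K1 * s < t \<Longrightarrow> t < K2 * s \<Longrightarrow> t \<in> T"
  shows "(\<integral>\<^sup>+y. ennreal \<bar>frac_integrand \<rho> f x y\<bar> * indicator S (norm (x - y)) \<partial>lebesgue) \<le>
    ennreal (C * K2 ^ DIM('a)) * (\<integral>\<^sup>+t\<in>T. ennreal (\<rho> t / t) *
      (ennreal (1 / t ^ DIM('a)) * abs_int (ball x (t / K1)) f) \<partial>lebesgue)"
proof -
  let ?n = "DIM('a)"
  obtain g where [measurable]: "g \<in> borel_measurable borel" and g: "AE y in lborel. f y = g y"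
    using borel_version[OF f] by blast
  \<comment> \<open>The integrand after both bounds: only |x - y| < t / K1 still couples y with
    t.\<close>
  define H where "H y t = ennreal (rhob t / t) * indicator T t * ennreal (1 / t ^ ?n) * indicator {y. norm (x - y) < t / K1} y * ennreal \<bar>g y\<bar>" for y t
  have [measurable]: "case_prod H \<in> borel_measurable (lborel \<Otimes>\<^sub>M lborel)"
    unfolding H_def by measurable
  have fg: "abs_int B f = (\<integral>\<^sup>+y\<in>B. ennreal \<bar>g y\<bar> \<partial>lborel)" for B
    unfolding nn_integral_completion by (rule nn_integral_cong_AE) (use g in eventually_elim, simp)
  have "(\<integral>\<^sup>+y. ennreal \<bar>frac_integrand \<rho> f x y\<bar> * indicator S (norm (x - y)) \<partial>lebesgue) \<le>
    (\<integral>\<^sup>+y. ennreal (C * K2 ^ ?n) * (\<integral>\<^sup>+t. H y t \<partial>lborel) \<partial>lborel)"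
    unfolding nn_integral_completion
  proof (rule nn_integral_mono_AE)
    have "AE y in lborel. y \<noteq> x" by (simp add: AE_lborel_singleton)
    then show "AE y in lborel. ennreal \<bar>frac_integrand \<rho> f x y\<bar> * indicator S (norm (x - y)) \<le> ennreal (C * K2 ^ ?n) * (\<integral>\<^sup>+t. H y t \<partial>lborel)"
      using AE_norm_lborel[OF rhob_le, of x] g
    proof eventually_elim
      case (elim y)
      define s where "s = norm (x - y)"
      have s: "0 < s" using elim by (simp add: s_def)
      show ?case
      proof (cases "s \<in> S")
        case True
        have rho: "\<rho> s = rhob s" and le: "ennreal (rhob s) \<le> ennreal C * (\<integral>\<^sup>+t\<in>{K1 * s<..<K2 * s}. ennreal (rhob t / t) \<partial>lborel)"
          using elim by (auto simp: s_def)
        have "ennreal \<bar>frac_integrand \<rho> f x y\<bar> = ennreal (rhob s) * ennreal (1 / s ^ ?n * \<bar>g y\<bar>)"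
          using elim(3) s rho rhob_nonneg[of s]
          by (simp add: frac_integrand_def s_def[symmetric] abs_mult ennreal_mult[symmetric])
        also have "\<dots> \<le> (ennreal C * (\<integral>\<^sup>+t\<in>{K1 * s<..<K2 * s}. ennreal (rhob t / t) \<partial>lborel)) * ennreal (1 / s ^ ?n * \<bar>g y\<bar>)"
          by (intro mult_right_mono le) simp
        also have "\<dots> = ennreal C * ((\<integral>\<^sup>+t\<in>{K1 * s<..<K2 * s}. ennreal (rhob t / t) \<partial>lborel) * ennreal (1 / s ^ ?n * \<bar>g y\<bar>))"
          by (simp only: mult_ac)
        also have "(\<integral>\<^sup>+t\<in>{K1 * s<..<K2 * s}. ennreal (rhob t / t) \<partial>lborel) * ennreal (1 / s ^ ?n * \<bar>g y\<bar>) =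
          (\<integral>\<^sup>+t. ennreal (rhob t / t) * indicator {K1 * s<..<K2 * s} t * ennreal (1 / s ^ ?n * \<bar>g y\<bar>) \<partial>lborel)"
          by (rule nn_integral_multc[symmetric]) measurable
        also have "\<dots> \<le> (\<integral>\<^sup>+t. ennreal (K2 ^ ?n) * H y t \<partial>lborel)"
        proof (rule nn_integral_mono)
          fix t
          show "ennreal (rhob t / t) * indicator {K1 * s<..<K2 * s} t * ennreal (1 / s ^ ?n * \<bar>g y\<bar>) \<le> ennreal (K2 ^ ?n) * H y t"
          proof (cases "t \<in> {K1 * s<..<K2 * s}")
            case in_range: True
            then have "t \<in> T" using ST[OF True s] by auto
            then have t: "0 < t" using T by auto
            have "s < t / K1" using in_range K1_pos by (simp add: field_simps)
            have "t ^ ?n \<le> (K2 * s) ^ ?n" using in_range t by (intro power_mono) auto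
            then have "1 / s ^ ?n \<le> K2 ^ ?n * (1 / t ^ ?n)"
              using s t K2_pos by (simp add: field_simps power_mult_distrib)
            then have "1 / s ^ ?n * \<bar>g y\<bar> \<le> K2 ^ ?n * (1 / t ^ ?n) * \<bar>g y\<bar>"
              by (intro mult_right_mono) auto
            then have "ennreal (rhob t / t) * ennreal (1 / s ^ ?n * \<bar>g y\<bar>) \<le> ennreal (rhob t / t) * ennreal (K2 ^ ?n * (1 / t ^ ?n) * \<bar>g y\<bar>)"
              by (intro mult_left_mono ennreal_leI) auto
            also have "\<dots> = ennreal (K2 ^ ?n) * (ennreal (rhob t / t) * ennreal (1 / t ^ ?n) * ennreal \<bar>g y\<bar>)"
            proof -
              have "ennreal (K2 ^ ?n * (1 / t ^ ?n) * \<bar>g y\<bar>) = ennreal (K2 ^ ?n) * ennreal (1 / t ^ ?n) * ennreal \<bar>g y\<bar>"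
                using t K2_pos by (subst ennreal_mult, simp, simp)+ simp
              then show ?thesis by (simp only: mult_ac)
            qed
            finally show ?thesis
              using in_range \<open>t \<in> T\<close> \<open>s < t / K1\<close> by (simp add: H_def s_def)
          qed simp
        qed
        also have "\<dots> = ennreal (K2 ^ ?n) * (\<integral>\<^sup>+t. H y t \<partial>lborel)"
          by (rule nn_integral_cmult) measurable
        also have "ennreal C * (ennreal (K2 ^ ?n) * (\<integral>\<^sup>+t. H y t \<partial>lborel)) = ennreal (C * K2 ^ ?n) * (\<integral>\<^sup>+t. H y t \<partial>lborel)"
          using C_pos K2_pos by (intro ennreal_mult_assoc) auto
        finally show ?thesis using True by (simp add: s_def mult_left_mono)
      qed (simp add: s_def)
    qed
  qed
  also have "\<dots> = ennreal (C * K2 ^ ?n) * (\<integral>\<^sup>+y. (\<integral>\<^sup>+t. H y t \<partial>lborel) \<partial>lborel)"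
    by (rule nn_integral_cmult) measurable
  also have "(\<integral>\<^sup>+y. (\<integral>\<^sup>+t. H y t \<partial>lborel) \<partial>lborel) = (\<integral>\<^sup>+t. (\<integral>\<^sup>+y. H y t \<partial>lborel) \<partial>lborel)"
    by (rule lborel_pair.Fubini'[symmetric]) measurable
  also have "\<dots> = (\<integral>\<^sup>+t\<in>T. ennreal (rhob t / t) * (ennreal (1 / t ^ ?n) * (\<integral>\<^sup>+y\<in>ball x (t / K1). ennreal \<bar>g y\<bar> \<partial>lborel)) \<partial>lborel)"
  proof (rule nn_integral_cong)
    fix t
    have "(\<integral>\<^sup>+y. H y t \<partial>lborel) = (\<integral>\<^sup>+y. (ennreal (rhob t / t) * indicator T t * ennreal (1 / t ^ ?n)) * (ennreal \<bar>g y\<bar> * indicator (ball x (t / K1)) y) \<partial>lborel)"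
      by (rule nn_integral_cong) (auto simp: H_def indicator_def dist_norm)
    also have "\<dots> = (ennreal (rhob t / t) * indicator T t * ennreal (1 / t ^ ?n)) * (\<integral>\<^sup>+y\<in>ball x (t / K1). ennreal \<bar>g y\<bar> \<partial>lborel)"
      by (intro nn_integral_cmult borel_measurable_times_ennreal borel_measurable_indicator) simp_all
    finally show "(\<integral>\<^sup>+y. H y t \<partial>lborel) = ennreal (rhob t / t) * (ennreal (1 / t ^ ?n) * (\<integral>\<^sup>+y\<in>ball x (t / K1). ennreal \<bar>g y\<bar> \<partial>lborel)) * indicator T t"
      by (simp add: mult_ac)
  qed
  also have "\<dots> = (\<integral>\<^sup>+t\<in>T. ennreal (\<rho> t / t) * (ennreal (1 / t ^ ?n) * abs_int (ball x (t / K1)) f) \<partial>lebesgue)"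
    unfolding fg by (rule nn_integral_rho[OF T, symmetric])
  finally show ?thesis by (simp add: mult_left_mono)
qed

lemma ball_volume_scaled:
  "0 < t \<Longrightarrow> ennreal (1 / t ^ DIM('a)) * vol (x :: 'a::euclidean_space) (t / K1) =
    ennreal (unit_ball_vol (real DIM('a)) / K1 ^ DIM('a))"
  using K1_pos by (simp add: emeasure_ball ennreal_mult[symmetric] power_divide)

lemma measurable_rho_restrict:
  assumes "A \<subseteq> {0<..}" "A \<in> sets borel"
  shows "(\<lambda>t. ennreal (\<rho> t / t) * indicator A t) \<in> borel_measurable lebesgue"
proof -
  have "(\<lambda>t. if t \<in> {0<..} then \<rho> t else 0) \<in> borel_measurable lebesgue"
    using rho_meas by (subst borel_measurable_if) auto
  then have [measurable]: "(\<lambda>t. if 0 < t then \<rho> t else 0) \<in> borel_measurable lebesgue" by simp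
  have [measurable]: "A \<in> sets lebesgue" using assms by simp
  have [measurable]: "(\<lambda>t. t) \<in> borel_measurable (lebesgue :: real measure)" by (rule measurable_completion) simp
  have "(\<lambda>t. ennreal (\<rho> t / t) * indicator A t) = (\<lambda>t. ennreal ((if 0 < t then \<rho> t else 0) / t) * indicator A t)"
  proof
    fix t
    show "ennreal (\<rho> t / t) * indicator A t = ennreal ((if 0 < t then \<rho> t else 0) / t) * indicator A t"
      using assms(1) by (cases "t \<in> A") auto
  qed
  also have "\<dots> \<in> borel_measurable lebesgue" by measurable
  finally show ?thesis .
qed

text \<open>Distances below R reach only t below K2 R, and the integral of |f| over a ball of radius
  t / K1 is at most M f(x) times its volume, in which the powers of t cancel.\<close>

lemma near_bound:
  fixes f :: "'a::euclidean_space \<Rightarrow> real"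
  assumes f: "f \<in> borel_measurable lebesgue"
  shows "(\<integral>\<^sup>+y. ennreal \<bar>frac_integrand \<rho> f x y\<bar> * indicator {..<R} (norm (x - y)) \<partial>lebesgue) \<le>
    ennreal (C * K2 ^ DIM('a)) * (ennreal (unit_ball_vol (real DIM('a)) / K1 ^ DIM('a)) * maximal_fun f x * rho_int \<rho> (K2 * R))"
proof -
  let ?n = "DIM('a)" let ?w = "ennreal (unit_ball_vol (real DIM('a)) / K1 ^ DIM('a))"
  have "(\<integral>\<^sup>+y. ennreal \<bar>frac_integrand \<rho> f x y\<bar> * indicator {..<R} (norm (x - y)) \<partial>lebesgue) \<le>
    ennreal (C * K2 ^ ?n) * (\<integral>\<^sup>+t\<in>{0<..<K2 * R}. ennreal (\<rho> t / t) *
      (ennreal (1 / t ^ ?n) * abs_int (ball x (t / K1)) f) \<partial>lebesgue)"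
  proof (rule kernel_bound[OF f])
    fix s t assume "s \<in> {..<R}" "0 < s" "K1 * s < t" "t < K2 * s"
    moreover have "0 < K1 * s" "K2 * s < K2 * R" using K1_pos K2_pos \<open>0 < s\<close> \<open>s \<in> {..<R}\<close> by auto
    ultimately show "t \<in> {0<..<K2 * R}" by auto
  qed auto
  also have "(\<integral>\<^sup>+t\<in>{0<..<K2 * R}. ennreal (\<rho> t / t) *
      (ennreal (1 / t ^ ?n) * abs_int (ball x (t / K1)) f) \<partial>lebesgue)
    \<le> (\<integral>\<^sup>+t. ?w * maximal_fun f x * (ennreal (\<rho> t / t) * indicator {0<..<K2 * R} t) \<partial>lebesgue)"
  proof (rule nn_integral_mono)
    fix t
    show "ennreal (\<rho> t / t) * (ennreal (1 / t ^ ?n) * abs_int (ball x (t / K1)) f) * indicator {0<..<K2 * R} t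
       \<le> ?w * maximal_fun f x * (ennreal (\<rho> t / t) * indicator {0<..<K2 * R} t)"
    proof (cases "t \<in> {0<..<K2 * R}")
      case True
      then have t: "0 < t" by auto
      have "ennreal (1 / t ^ ?n) * abs_int (ball x (t / K1)) f \<le>
        ennreal (1 / t ^ ?n) * (maximal_fun f x * vol x (t / K1))"
        using t K1_pos by (intro mult_left_mono le_maximal_fun) auto
      also have "\<dots> = (ennreal (1 / t ^ ?n) * vol x (t / K1)) * maximal_fun f x"
        by (simp only: mult_ac)
      also have "\<dots> = ?w * maximal_fun f x" using t by (simp only: ball_volume_scaled)
      finally have "ennreal (\<rho> t / t) * (ennreal (1 / t ^ ?n) * abs_int (ball x (t / K1)) f) \<le> ennreal (\<rho> t / t) * (?w * maximal_fun f x)"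
        by (rule mult_left_mono) simp
      then show ?thesis using True by (simp add: mult_ac)
    qed simp
  qed
  also have "\<dots> = ?w * maximal_fun f x * rho_int \<rho> (K2 * R)"
    unfolding rho_int_def by (intro nn_integral_cmult measurable_rho_restrict) auto
  finally show ?thesis by (simp add: mult_left_mono)
qed

end

section \<open>Pointwise estimates and sufficiency\<close>

text \<open>\<phi> may jump over u. R is taken in the set where \<phi> \<le> u and below twice the
  infimum of that set; then R / 2 lies outside it, and \<open>phi_inc\<close> compares R / 2 with R.
  The limits at 0 and \<infinity> make the infimum positive and the set nonempty.\<close>

lemma (in almost_dec) ex_phi_comparable:
  assumes lim0: "filterlim \<phi> at_top (at_right 0)" and limi: "(\<phi> \<longlongrightarrow> 0) at_top" and u: "0 < u"
  shows "\<exists>R>0. \<phi> R \<le> u \<and> u \<le> D * 2 ^ n * \<phi> R"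
proof -
  define S where "S = {r. 0 < r \<and> \<phi> r \<le> u}"
  have "eventually (\<lambda>r. \<phi> r < u) at_top" using limi u by (rule order_tendstoD(2))
  then have "eventually (\<lambda>r. \<phi> r < u \<and> 0 < r) at_top" using eventually_gt_at_top[of 0] by eventually_elim simp
  then obtain r1 where "r1 \<in> S" unfolding S_def using eventually_happens'[OF trivial_limit_at_top_linorder] by (auto intro: less_imp_le)
  have "eventually (\<lambda>r. u < \<phi> r) (at_right 0)" using lim0 by (simp add: filterlim_at_top_dense)
  then obtain d where d: "0 < d" "\<And>r. 0 < r \<Longrightarrow> r < d \<Longrightarrow> u < \<phi> r"
    unfolding eventually_at_right_field by auto
  have lower: "d \<le> r" if "r \<in> S" for r using that d(2)[of r] by (auto simp: S_def not_less[symmetric])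
  have bdd: "bdd_below S" using lower by (auto simp: bdd_below_def)
  have dI: "d \<le> Inf S" using \<open>r1 \<in> S\<close> lower by (intro cInf_greatest) auto
  then have "Inf S < 2 * Inf S" using d by simp
  then obtain R where R: "R \<in> S" "R < 2 * Inf S" using \<open>r1 \<in> S\<close> cInf_lessD[of S "2 * Inf S"] by blast
  have "R / 2 \<notin> S"
  proof
    assume "R / 2 \<in> S"
    then have "Inf S \<le> R / 2" using bdd by (rule cInf_lower)
    then show False using R by simp
  qed
  then have "u < \<phi> (R / 2)" using R by (auto simp: S_def)
  also have "\<phi> (R / 2) \<le> D * 2 ^ n * \<phi> R"
  proof -
    have "\<phi> (R / 2) * (R / 2) ^ n \<le> D * (\<phi> R * R ^ n)" using R by (intro phi_inc) (auto simp: S_def)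
    then show ?thesis using R by (simp add: S_def field_simps power_divide)
  qed
  finally show ?thesis using R by (auto simp: S_def)
qed

locale frac_setting =
  P: orlicz_morrey \<Phi> K \<phi> n D + Q: orlicz_morrey \<Psi> K' \<phi> n D + frac_kernel \<rho> C K1 K2
  for \<Phi> K \<phi> n D \<Psi> K' \<rho> C K1 K2
begin

definition far_int :: "real \<Rightarrow> ennreal" where
  "far_int r = (\<integral>\<^sup>+t\<in>{r<..}. ennreal (\<rho> t / t) * gen_inv \<Phi> (ennreal (\<phi> t)) \<partial>lebesgue)"

text \<open>The averages of |f| are over balls of radius t / K1, while \<open>far_int\<close> has
  the inverse at radius t; \<open>G_comp\<close> bridges the two, with \<open>max 1 K1\<close>
  because it wants a factor at least 1.\<close>

lemma far_bound:
  fixes f :: "'a::euclidean_space \<Rightarrow> real"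
  assumes f: "f \<in> borel_measurable lebesgue" and avg: "P.avg_le c f" and c: "0 \<le> c" and R: "0 < R"
    and meas: "(\<lambda>t. gen_inv \<Phi> (ennreal (\<phi> t))) \<in> borel_measurable (lebesgue_on {0<..})"
  shows "(\<integral>\<^sup>+y. ennreal \<bar>frac_integrand \<rho> f x y\<bar> * indicator {R..} (norm (x - y)) \<partial>lebesgue) \<le>
    ennreal (C * K2 ^ DIM('a)) * (ennreal (unit_ball_vol (real DIM('a)) / K1 ^ DIM('a) * (c * P.Gc (max 1 K1))) * far_int (K1 * R))"
proof -
  let ?n = "DIM('a)" let ?w = "unit_ball_vol (real DIM('a)) / K1 ^ DIM('a)" let ?c = "c * P.Gc (max 1 K1)"
  have KR: "0 < K1 * R" using K1_pos R by simp
  have gc: "1 \<le> P.Gc (max 1 K1)" by (rule P.Gc_ge_1) simp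
  have "(\<integral>\<^sup>+y. ennreal \<bar>frac_integrand \<rho> f x y\<bar> * indicator {R..} (norm (x - y)) \<partial>lebesgue) \<le>
    ennreal (C * K2 ^ ?n) * (\<integral>\<^sup>+t\<in>{K1 * R<..}. ennreal (\<rho> t / t) *
      (ennreal (1 / t ^ ?n) * abs_int (ball x (t / K1)) f) \<partial>lebesgue)"
  proof (rule kernel_bound[OF f])
    fix s t assume "s \<in> {R..}" "0 < s" "K1 * s < t"
    moreover have "K1 * R \<le> K1 * s" using K1_pos \<open>s \<in> {R..}\<close> by auto
    ultimately show "t \<in> {K1 * R<..}" by auto
  qed (use KR in auto)
  also have "(\<integral>\<^sup>+t\<in>{K1 * R<..}. ennreal (\<rho> t / t) *
      (ennreal (1 / t ^ ?n) * abs_int (ball x (t / K1)) f) \<partial>lebesgue)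
    \<le> (\<integral>\<^sup>+t. ennreal (?w * ?c) * (ennreal (\<rho> t / t) * gen_inv \<Phi> (ennreal (\<phi> t)) * indicator {K1 * R<..} t) \<partial>lebesgue)"
  proof (rule nn_integral_mono)
    fix t
    show "ennreal (\<rho> t / t) * (ennreal (1 / t ^ ?n) * abs_int (ball x (t / K1)) f) * indicator {K1 * R<..} t
       \<le> ennreal (?w * ?c) * (ennreal (\<rho> t / t) * gen_inv \<Phi> (ennreal (\<phi> t)) * indicator {K1 * R<..} t)"
    proof (cases "t \<in> {K1 * R<..}")
      case True
      then have t: "0 < t" using KR by auto
      have "P.G (t / K1) \<le> P.Gc (max 1 K1) * P.G t"
      proof (rule P.G_comp)
        have "K1 * (t / K1) \<le> max 1 K1 * (t / K1)" using t K1_pos by (intro mult_right_mono) auto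
        then show "t \<le> max 1 K1 * (t / K1)" using K1_pos by simp
      qed (use t K1_pos in auto)
      then have G: "c * P.G (t / K1) \<le> ?c * P.G t" using c by (simp add: mult_left_mono mult.assoc)
      have "ennreal (1 / t ^ ?n) * abs_int (ball x (t / K1)) f \<le>
        ennreal (1 / t ^ ?n) * (ennreal (c * P.G (t / K1)) * vol x (t / K1))"
        using t K1_pos by (intro mult_left_mono P.avg_leD[OF avg]) auto
      also have "\<dots> = (ennreal (1 / t ^ ?n) * vol x (t / K1)) * ennreal (c * P.G (t / K1))"
        by (simp only: mult_ac)
      also have "\<dots> = ennreal ?w * ennreal (c * P.G (t / K1))" using t by (simp only: ball_volume_scaled)
      also have "\<dots> \<le> ennreal ?w * ennreal (?c * P.G t)" by (intro mult_left_mono ennreal_leI G) simp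
      also have "\<dots> = ennreal (?w * ?c) * gen_inv \<Phi> (ennreal (\<phi> t))"
        using gc c K1_pos P.G_pos[OF t] t by (simp add: ennreal_mult[symmetric] P.G_eq[symmetric] mult_ac)
      finally have "ennreal (\<rho> t / t) * (ennreal (1 / t ^ ?n) * abs_int (ball x (t / K1)) f) \<le> ennreal (\<rho> t / t) * (ennreal (?w * ?c) * gen_inv \<Phi> (ennreal (\<phi> t)))"
        by (rule mult_left_mono) simp
      then show ?thesis using True by (simp add: mult_ac)
    qed simp
  qed
  also have "\<dots> = ennreal (?w * ?c) * far_int (K1 * R)"
  proof -
    have m1: "(\<lambda>t. ennreal (\<rho> t / t) * indicator {K1 * R<..} t) \<in> borel_measurable lebesgue"
      using KR by (intro measurable_rho_restrict) auto
    have m2: "(\<lambda>t. gen_inv \<Phi> (ennreal (\<phi> t)) * indicator {0<..} t) \<in> borel_measurable lebesgue"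
      using meas by (subst (asm) borel_measurable_restrict_space_iff_ennreal) auto
    have "(\<lambda>t. ennreal (\<rho> t / t) * gen_inv \<Phi> (ennreal (\<phi> t)) * indicator {K1 * R<..} t) =
      (\<lambda>t. (ennreal (\<rho> t / t) * indicator {K1 * R<..} t) * (gen_inv \<Phi> (ennreal (\<phi> t)) * indicator {0<..} t))"
      using KR by (auto simp: fun_eq_iff indicator_def)
    also have "\<dots> \<in> borel_measurable lebesgue" using m1 m2 by (rule borel_measurable_times_ennreal)
    finally show ?thesis unfolding far_int_def by (intro nn_integral_cmult)
  qed
  finally show ?thesis by (simp add: mult_left_mono)
qed

definition near_const :: "'a::euclidean_space itself \<Rightarrow> real" where
  "near_const _ = C * K2 ^ DIM('a) * (unit_ball_vol (real DIM('a)) / K1 ^ DIM('a))"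

lemma near_const_nonneg: "0 \<le> near_const TYPE('a::euclidean_space)"
  using C_pos K2_pos K1_pos by (simp add: near_const_def)

text \<open>The near part uses the first summand of \<open>full_cond\<close> at radius K2 R, the far
  part the second at K1 R, and \<open>G_comp\<close> for \<Phi> and \<Psi> brings everything back to
  R. The bound M f(x) \<le> B G(R) is what makes the near part comparable to the first
  summand.\<close>

lemma frac_total_bound:
  fixes f :: "'a::euclidean_space \<Rightarrow> real"
  assumes f: "f \<in> borel_measurable lebesgue" and avg: "P.avg_le c f" and c: "0 \<le> c" and R: "0 < R"
    and meas: "(\<lambda>t. gen_inv \<Phi> (ennreal (\<phi> t))) \<in> borel_measurable (lebesgue_on {0<..})"
    and full: "full_cond \<Phi> \<Psi> \<phi> \<rho> A" and A: "0 < A"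
    and M: "maximal_fun f x \<le> ennreal (B * P.G R)" and B: "0 \<le> B"
  shows "(\<integral>\<^sup>+y. ennreal \<bar>frac_integrand \<rho> f x y\<bar> \<partial>lebesgue) \<le>
    ennreal (near_const TYPE('a) * (B * P.Gc (max 1 K2) * A * Q.Gc (max 1 (1 / K2)) + c * P.Gc (max 1 K1) * A * Q.Gc (max 1 (1 / K1))) * Q.G R)"
proof -
  let ?w = "unit_ball_vol (real DIM('a)) / K1 ^ DIM('a)" let ?CK = "C * K2 ^ DIM('a)"
  have w: "0 \<le> ?w" "0 \<le> ?CK" using K1_pos K2_pos C_pos by auto
  have KR: "0 < K1 * R" "0 < K2 * R" using K1_pos K2_pos R by auto
  have gc: "1 \<le> P.Gc (max 1 L)" "1 \<le> Q.Gc (max 1 L)" for L by (auto intro: P.Gc_ge_1 Q.Gc_ge_1)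
  have QG: "Q.G (L * R) \<le> Q.Gc (max 1 (1 / L)) * Q.G R" if "0 < L" for L
  proof (rule Q.G_comp)
    have "(1 / L) * (L * R) \<le> max 1 (1 / L) * (L * R)" using that R by (intro mult_right_mono) auto
    then show "R \<le> max 1 (1 / L) * (L * R)" using that by simp
  qed (use that R in auto)
  have cond: "rho_int \<rho> r * gen_inv \<Phi> (ennreal (\<phi> r)) + far_int r \<le> ennreal A * ennreal (Q.G r)" if "0 < r" for r
    using full that by (auto simp: full_cond_def rho_int_def far_int_def Q.G_eq)
  have near: "maximal_fun f x * rho_int \<rho> (K2 * R) \<le> ennreal (B * P.Gc (max 1 K2) * A * Q.Gc (max 1 (1 / K2)) * Q.G R)"
  proof -
    have "P.G R \<le> P.Gc (max 1 K2) * P.G (K2 * R)"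
      using R KR by (intro P.G_comp) (auto intro: mult_right_mono)
    then have "B * P.G R \<le> B * (P.Gc (max 1 K2) * P.G (K2 * R))" using B by (rule mult_left_mono)
    then have "maximal_fun f x \<le> ennreal (B * P.Gc (max 1 K2) * P.G (K2 * R))"
      using M by (auto intro: order_trans ennreal_leI simp: mult.assoc)
    then have "maximal_fun f x * rho_int \<rho> (K2 * R) \<le> ennreal (B * P.Gc (max 1 K2) * P.G (K2 * R)) * rho_int \<rho> (K2 * R)"
      by (rule mult_right_mono) simp
    also have "\<dots> = ennreal (B * P.Gc (max 1 K2)) * (rho_int \<rho> (K2 * R) * gen_inv \<Phi> (ennreal (\<phi> (K2 * R))))"
      using B gc(1)[of K2] P.G_pos[OF KR(2)] KR by (simp add: ennreal_mult P.G_eq[symmetric] mult_ac)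
    also have "\<dots> \<le> ennreal (B * P.Gc (max 1 K2)) * (ennreal A * ennreal (Q.G (K2 * R)))"
      using cond[OF KR(2)] by (intro mult_left_mono) (auto intro: order_trans[rotated])
    also have "\<dots> \<le> ennreal (B * P.Gc (max 1 K2)) * (ennreal A * ennreal (Q.Gc (max 1 (1 / K2)) * Q.G R))"
      by (intro mult_left_mono ennreal_leI QG K2_pos) auto
    also have "\<dots> = ennreal (B * P.Gc (max 1 K2) * A * Q.Gc (max 1 (1 / K2)) * Q.G R)"
    proof -
      have "0 \<le> B * P.Gc (max 1 K2)" using B gc(1)[of K2] by simp
      moreover have "0 \<le> Q.Gc (max 1 (1 / K2)) * Q.G R" using gc(2)[of "1 / K2"] Q.G_pos[OF R] by simp
      ultimately show ?thesis using A by (simp add: ennreal_mult_assoc ennreal_mult[symmetric] mult.assoc)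
    qed
    finally show ?thesis .
  qed
  have far: "far_int (K1 * R) \<le> ennreal (A * Q.Gc (max 1 (1 / K1)) * Q.G R)"
  proof -
    have "far_int (K1 * R) \<le> ennreal A * ennreal (Q.G (K1 * R))"
      using cond[OF KR(1)] by (auto intro: order_trans[rotated])
    also have "\<dots> \<le> ennreal A * ennreal (Q.Gc (max 1 (1 / K1)) * Q.G R)"
      by (intro mult_left_mono ennreal_leI QG K1_pos) auto
    also have "\<dots> = ennreal (A * Q.Gc (max 1 (1 / K1)) * Q.G R)"
      using gc(2)[of "1 / K1"] Q.G_pos[OF R] A by (simp add: ennreal_mult[symmetric] mult.assoc)
    finally show ?thesis .
  qed
  let ?g1 = "B * P.Gc (max 1 K2) * A * Q.Gc (max 1 (1 / K2)) * Q.G R"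
  let ?g2 = "A * Q.Gc (max 1 (1 / K1)) * Q.G R"
  have g: "0 \<le> ?g1" "0 \<le> ?g2" "0 \<le> c * P.Gc (max 1 K1)"
    using gc(1)[of K1] gc(1)[of K2] gc(2)[of "1 / K2"] gc(2)[of "1 / K1"] Q.G_pos[OF R] A B c by simp_all
  have [measurable]: "(\<lambda>y. ennreal \<bar>frac_integrand \<rho> f x y\<bar>) \<in> borel_measurable lebesgue"
    using measurable_frac_integrand[OF f, of x] by measurable
  have [measurable]: "(\<lambda>y. indicator {..<R} (norm (x - y)) :: ennreal) \<in> borel_measurable lebesgue"
    "(\<lambda>y. indicator {R..} (norm (x - y)) :: ennreal) \<in> borel_measurable lebesgue"
    by (rule measurable_completion, measurable)+
  have "(\<integral>\<^sup>+y. ennreal \<bar>frac_integrand \<rho> f x y\<bar> \<partial>lebesgue) =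
    (\<integral>\<^sup>+y. ennreal \<bar>frac_integrand \<rho> f x y\<bar> * indicator {..<R} (norm (x - y)) + ennreal \<bar>frac_integrand \<rho> f x y\<bar> * indicator {R..} (norm (x - y)) \<partial>lebesgue)"
    by (intro nn_integral_cong) (auto simp: indicator_def)
  also have "\<dots> = (\<integral>\<^sup>+y. ennreal \<bar>frac_integrand \<rho> f x y\<bar> * indicator {..<R} (norm (x - y)) \<partial>lebesgue) +
    (\<integral>\<^sup>+y. ennreal \<bar>frac_integrand \<rho> f x y\<bar> * indicator {R..} (norm (x - y)) \<partial>lebesgue)"
    by (rule nn_integral_add) measurable
  also have "\<dots> \<le> ennreal ?CK * (ennreal ?w * maximal_fun f x * rho_int \<rho> (K2 * R)) +
     ennreal ?CK * (ennreal (?w * (c * P.Gc (max 1 K1))) * far_int (K1 * R))"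
    by (intro add_mono near_bound far_bound f avg c R meas)
  also have "\<dots> \<le> ennreal ?CK * (ennreal ?w * ennreal ?g1) + ennreal ?CK * (ennreal (?w * (c * P.Gc (max 1 K1))) * ennreal ?g2)"
    using near far by (intro add_mono mult_left_mono) (auto simp: mult.assoc intro!: mult_left_mono)
  also have "\<dots> = ennreal (?CK * (?w * ?g1) + ?CK * ((?w * (c * P.Gc (max 1 K1))) * ?g2))"
  proof -
    have h: "0 \<le> ?w * ?g1" "0 \<le> ?w * (c * P.Gc (max 1 K1))" "0 \<le> (?w * (c * P.Gc (max 1 K1))) * ?g2"
      using w g by (simp_all only: mult_nonneg_nonneg)
    have "ennreal ?CK * (ennreal ?w * ennreal ?g1) = ennreal (?CK * (?w * ?g1))"
      using w g h by (simp only: ennreal_mult)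
    moreover have "ennreal ?CK * (ennreal (?w * (c * P.Gc (max 1 K1))) * ennreal ?g2) = ennreal (?CK * ((?w * (c * P.Gc (max 1 K1))) * ?g2))"
      using w g h by (simp only: ennreal_mult)
    ultimately show ?thesis using w h by (simp only: ennreal_plus[symmetric] mult_nonneg_nonneg)
  qed
  also have "?CK * (?w * ?g1) + ?CK * ((?w * (c * P.Gc (max 1 K1))) * ?g2) =
    near_const TYPE('a) * (B * P.Gc (max 1 K2) * A * Q.Gc (max 1 (1 / K2)) + c * P.Gc (max 1 K1) * A * Q.Gc (max 1 (1 / K1))) * Q.G R"
    by (simp only: near_const_def ring_distribs mult_ac)
  finally show ?thesis .
qed

text \<open>Any radius serves, here R = 1, because for mere convergence B may depend on f and
  x.\<close>

lemma frac_converges_if_maximal_finite: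
  fixes f :: "'a::euclidean_space \<Rightarrow> real"
  assumes f: "f \<in> borel_measurable lebesgue" and avg: "P.avg_le c f" and c: "0 \<le> c"
    and meas: "(\<lambda>t. gen_inv \<Phi> (ennreal (\<phi> t))) \<in> borel_measurable (lebesgue_on {0<..})"
    and full: "full_cond \<Phi> \<Psi> \<phi> \<rho> A" and A: "0 < A"
    and fin: "maximal_fun f x < top"
  shows "frac_converges \<rho> f x"
proof -
  obtain m where m: "maximal_fun f x = ennreal m" "0 \<le> m" using fin by (cases "maximal_fun f x") auto
  have G1: "0 < P.G 1" by (rule P.G_pos) simp
  have "(\<integral>\<^sup>+y. ennreal \<bar>frac_integrand \<rho> f x y\<bar> \<partial>lebesgue) < top"
    using frac_total_bound[OF f avg c zero_less_one meas full A, of x "m / P.G 1"] m G1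
    by (auto intro: le_less_trans)
  then show ?thesis
    unfolding frac_converges_def using measurable_frac_integrand[OF f, of x] by (auto intro: integrableI_bounded)
qed

text \<open>Hedberg's argument. If \<phi>(R) is comparable to u = \<Phi>(M f(x) / C0), then M f(x)
  \<le> B G(R) by \<open>le_G_scale\<close>, so \<open>frac_total_bound\<close> gives
  \<open>\<bar>frac_int \<rho> f x\<bar> \<le> A1 * Q.G R\<close>, and \<Psi> of this, after
  division by C1, is at most \<phi>(R) \<le> u.\<close>

lemma pointwise_normalized:
  assumes n: "n = DIM('a::euclidean_space)"
    and lim0: "filterlim \<phi> at_top (at_right 0)" and limi: "(\<phi> \<longlongrightarrow> 0) at_top"
    and meas: "(\<lambda>t. gen_inv \<Phi> (ennreal (\<phi> t))) \<in> borel_measurable (lebesgue_on {0<..})"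
    and full: "full_cond \<Phi> \<Psi> \<phi> \<rho> A" and A: "0 < A" and c: "0 < c" and C0: "0 < C0"
  obtains C1 where "0 < C1" "\<And>(f :: 'a \<Rightarrow> real) x. f \<in> borel_measurable lebesgue \<Longrightarrow> P.avg_le c f \<Longrightarrow>
    (\<Phi> (maximal_fun f x / ennreal C0) < top \<longrightarrow> frac_converges \<rho> f x) \<and>
    \<Psi> (ennreal (\<bar>frac_int \<rho> f x\<bar> / C1)) \<le> \<Phi> (maximal_fun f x / ennreal C0)"
proof -
  define L where "L = D * 2 ^ n"
  define B where "B = C0 * (K * L)"
  define A1 where "A1 = near_const TYPE('a) * (B * P.Gc (max 1 K2) * A * Q.Gc (max 1 (1 / K2)) + c * P.Gc (max 1 K1) * A * Q.Gc (max 1 (1 / K1)))"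
  have L: "1 \<le> L" unfolding L_def using P.D_ge_1 by (intro mult_ge1_I) auto
  have B: "0 \<le> B" using C0 L P.K_ge_1 by (simp add: B_def)
  have A1: "0 \<le> A1"
    unfolding A1_def using near_const_nonneg[where 'a='a] B A c P.Gc_ge_1[of "max 1 K2"] P.Gc_ge_1[of "max 1 K1"]
      Q.Gc_ge_1[of "max 1 (1 / K2)"] Q.Gc_ge_1[of "max 1 (1 / K1)"] by (auto intro!: mult_nonneg_nonneg add_nonneg_nonneg)
  \<comment> \<open>Strictly larger than A1, because \<open>Phi_le_phi\<close> wants an argument
    strictly below \<open>Q.G R\<close>.\<close>
  define C1 where "C1 = 2 * A1 + 1"
  have C1: "0 < C1" using A1 by (simp add: C1_def)
  show thesis
  proof (rule that[OF C1])
    fix f :: "'a \<Rightarrow> real" and x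
    assume f: "f \<in> borel_measurable lebesgue" and avg: "P.avg_le c f"
    let ?u = "\<Phi> (maximal_fun f x / ennreal C0)"
    show "(?u < top \<longrightarrow> frac_converges \<rho> f x) \<and> \<Psi> (ennreal (\<bar>frac_int \<rho> f x\<bar> / C1)) \<le> ?u"
    proof (cases "?u < top")
      case False
      then show ?thesis by (simp add: less_top[symmetric])
    next
      case True
      then have "maximal_fun f x / ennreal C0 \<noteq> top" by auto
      then have fin: "maximal_fun f x < top"
        using C0 by (auto simp: less_top[symmetric] ennreal_top_divide)
      have conv: "frac_converges \<rho> f x"
        using c by (intro frac_converges_if_maximal_finite[OF f avg _ meas full A fin]) simp
      have key: "\<Psi> (ennreal (\<bar>frac_int \<rho> f x\<bar> / C1)) \<le> ennreal (\<phi> R)" if R: "0 < R" and u: "?u \<le> ennreal (L * \<phi> R)" for R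
      proof -
        have "maximal_fun f x / ennreal C0 \<le> ennreal (K * L * P.G R)" by (rule P.le_G_scale[OF R L u])
        then have "maximal_fun f x \<le> ennreal (K * L * P.G R) * ennreal C0"
          using C0 by (subst (asm) ennreal_divide_le_iff) auto
        also have "\<dots> = ennreal (B * P.G R)"
          using C0 L P.K_ge_1 P.G_pos[OF R] by (simp add: ennreal_mult[symmetric] B_def mult_ac)
        finally have M: "maximal_fun f x \<le> ennreal (B * P.G R)" .
        have "ennreal \<bar>frac_int \<rho> f x\<bar> \<le> (\<integral>\<^sup>+y. ennreal \<bar>frac_integrand \<rho> f x y\<bar> \<partial>lebesgue)"
          using integral_norm_bound_ennreal[OF conv[unfolded frac_converges_def]] by (simp add: frac_int_def)
        also have "\<dots> \<le> ennreal (A1 * Q.G R)"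
          unfolding A1_def using c by (intro frac_total_bound[OF f avg _ R meas full A M B]) simp
        finally have le: "\<bar>frac_int \<rho> f x\<bar> \<le> A1 * Q.G R"
          using A1 Q.G_pos[OF R] by (simp add: ennreal_le_iff)
        have "A1 * Q.G R < C1 * Q.G R" using A1 Q.G_pos[OF R] by (simp add: C1_def)
        then have "\<bar>frac_int \<rho> f x\<bar> / C1 < Q.G R" using le C1 by (simp add: field_simps)
        then show ?thesis using C1 R by (intro Q.Phi_le_phi) auto
      qed
      have "\<Psi> (ennreal (\<bar>frac_int \<rho> f x\<bar> / C1)) \<le> ?u"
      proof (cases "?u = 0")
        case True
        \<comment> \<open>No radius matches the value 0, but \<open>key\<close> applies to every R,
          and \<phi>(R) tends to 0.\<close>
        have "((\<lambda>R. ennreal (\<phi> R)) \<longlongrightarrow> ennreal 0) at_top" by (rule tendsto_ennrealI[OF limi])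
        moreover have "eventually (\<lambda>R. \<Psi> (ennreal (\<bar>frac_int \<rho> f x\<bar> / C1)) \<le> ennreal (\<phi> R)) at_top"
          using eventually_gt_at_top[of 0] by eventually_elim (use True key in simp)
        ultimately have "\<Psi> (ennreal (\<bar>frac_int \<rho> f x\<bar> / C1)) \<le> ennreal 0"
          by (rule tendsto_lowerbound) simp
        then show ?thesis by simp
      next
        case False
        obtain u where u: "?u = ennreal u" "0 < u"
          using False True by (cases ?u) (auto simp: less_le)
        obtain R where R: "0 < R" "\<phi> R \<le> u" "u \<le> L * \<phi> R"
          using P.ex_phi_comparable[OF lim0 limi u(2)] by (auto simp: L_def)
        have "\<Psi> (ennreal (\<bar>frac_int \<rho> f x\<bar> / C1)) \<le> ennreal (\<phi> R)"
          using R u by (intro key) (auto intro: ennreal_leI)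
        also have "\<dots> \<le> ?u" using R u by (auto intro: ennreal_leI)
        finally show ?thesis .
      qed
      with conv show ?thesis by simp
    qed
  qed
qed

end

section \<open>From normalised functions to norms\<close>

lemma frac_integrand_divide: "frac_integrand \<rho> (\<lambda>x. f x / c) x = (\<lambda>y. frac_integrand \<rho> f x y / c)"
  by (simp add: frac_integrand_def fun_eq_iff)

lemma frac_int_divide: "frac_int \<rho> (\<lambda>x. f x / c) x = frac_int \<rho> f x / c"
  by (simp add: frac_int_def frac_integrand_divide)

lemma frac_converges_divide: "c \<noteq> 0 \<Longrightarrow> frac_converges \<rho> (\<lambda>x. f x / c) x \<longleftrightarrow> frac_converges \<rho> f x"
proof -
  assume c: "c \<noteq> 0"
  have "integrable lebesgue (\<lambda>y. frac_integrand \<rho> f x y / c)" if "integrable lebesgue (frac_integrand \<rho> f x)"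
    by (rule integrable_divide_zero) (rule that)
  moreover have "integrable lebesgue (frac_integrand \<rho> f x)" if "integrable lebesgue (\<lambda>y. frac_integrand \<rho> f x y / c)"
    using integrable_mult_right[of c, OF that] c by simp
  ultimately show ?thesis unfolding frac_converges_def frac_integrand_divide by blast
qed

lemma nn_integral_abs_divide:
  fixes f :: "'a::euclidean_space \<Rightarrow> real"
  assumes [measurable]: "f \<in> borel_measurable lebesgue" and "0 < c"
  shows "(\<integral>\<^sup>+y\<in>ball a r. ennreal \<bar>f y / c\<bar> \<partial>lebesgue) = abs_int (ball a r) f / ennreal c"
proof -
  have "(\<integral>\<^sup>+y\<in>ball a r. ennreal \<bar>f y / c\<bar> \<partial>lebesgue) = (\<integral>\<^sup>+y. ennreal \<bar>f y\<bar> * indicator (ball a r) y / ennreal c \<partial>lebesgue)"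
    using assms(2) by (intro nn_integral_cong) (auto simp: indicator_def divide_ennreal)
  also have "\<dots> = abs_int (ball a r) f / ennreal c"
    by (rule nn_integral_divide) measurable
  finally show ?thesis .
qed

lemma maximal_fun_divide:
  fixes f :: "'a::euclidean_space \<Rightarrow> real"
  assumes "f \<in> borel_measurable lebesgue" "0 < c"
  shows "maximal_fun (\<lambda>x. f x / c) x = maximal_fun f x / ennreal c"
  unfolding maximal_fun_def SUP_divide_ennreal
proof (intro SUP_cong refl)
  fix p :: "'a \<times> real"
  show "(case p of (a, r) \<Rightarrow> (\<integral>\<^sup>+y\<in>ball a r. ennreal \<bar>f y / c\<bar> \<partial>lebesgue) / vol a r) =
    (case p of (a, r) \<Rightarrow> abs_int (ball a r) f / vol a r) / ennreal c"
    unfolding nn_integral_abs_divide[OF assms] by (cases p) (simp add: divide_ennreal_def mult_ac)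
qed

lemma frac_integrand_zero_AE:
  assumes "AE x in lebesgue. f x = 0"
  shows "AE y in lebesgue. frac_integrand \<rho> f x y = 0"
  using assms by eventually_elim (simp add: frac_integrand_def)

context orlicz_morrey
begin

text \<open>As m tends to 0, the integral of |f| over each ball is at most m times a finite
  constant. So a function of norm 0 vanishes almost everywhere, and all others may be divided by
  their norm.\<close>

lemma avg_le_all_imp_zero:
  fixes f :: "'a::euclidean_space \<Rightarrow> real"
  assumes [measurable]: "f \<in> borel_measurable lebesgue" and avg: "\<And>m. 0 < m \<Longrightarrow> avg_le c (\<lambda>x. f x / m)"
  shows "AE x in lebesgue. f x = 0"
proof -
  have "AE x in lebesgue. x \<in> ball 0 (real (Suc j)) \<longrightarrow> f x = 0" for j
  proof -
    let ?B = "ball (0::'a) (real (Suc j))" let ?e = "\<integral>\<^sup>+x\<in>?B. ennreal \<bar>f x\<bar> \<partial>lebesgue"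
    have "?e = 0"
    proof (rule ennreal_mult_bounded_imp_zero)
      fix t :: real assume "0 < t"
      have "(\<integral>\<^sup>+x\<in>?B. ennreal \<bar>f x / (1 / t)\<bar> \<partial>lebesgue) \<le> ennreal (c * G (real (Suc j))) * emeasure lebesgue ?B"
        using \<open>0 < t\<close> by (intro avg_leD avg) auto
      moreover have "(\<integral>\<^sup>+x\<in>?B. ennreal \<bar>f x / (1 / t)\<bar> \<partial>lebesgue) = ennreal t * ?e"
        using \<open>0 < t\<close> by (subst nn_integral_abs_divide) (auto simp: divide_ennreal_def mult.commute inverse_ennreal)
      ultimately show "ennreal t * ?e \<le> ennreal (c * G (real (Suc j))) * emeasure lebesgue ?B" by simp
    next
      show "ennreal (c * G (real (Suc j))) * emeasure lebesgue ?B < top"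
        using emeasure_lebesgue_ball_finite[of "0::'a" "real (Suc j)"] by (intro ennreal_mult_less_top[THEN iffD2] disjI2 conjI) auto
    qed
    then have "AE x in lebesgue. ennreal \<bar>f x\<bar> * indicator ?B x = 0"
      by (subst (asm) nn_integral_0_iff_AE) auto
    then show ?thesis by eventually_elim (auto simp: indicator_def)
  qed
  then have "AE x in lebesgue. \<forall>j. x \<in> ball 0 (real (Suc j)) \<longrightarrow> f x = 0" by (subst AE_all_countable) blast
  then show ?thesis
  proof eventually_elim
    case (elim x)
    obtain j :: nat where "norm x < real j" using reals_Archimedean2 by blast
    then show ?case using elim[rule_format, of j] by simp
  qed
qed

end

context frac_setting
begin

text \<open>f is divided by 2 m rather than by its norm m, to meet the strict bounds of
  \<open>L_norm_lessD\<close> and \<open>wL_norm_lessD\<close>. Using C0 / 2 compensates this on the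
  side of M f, and C1 doubles on the other side; any larger constant serves too, so that one can be
  shared by the strong and the weak norm.\<close>

lemma pointwise_ineq_of_normalized:
  fixes f :: "'a::euclidean_space \<Rightarrow> real"
  assumes f: "f \<in> borel_measurable lebesgue" and m: "N f = ennreal m" "0 < m" and C: "0 < C0" "0 < C1"
    and pt: "(\<Phi> (maximal_fun (\<lambda>x. f x / (2 * m)) x / ennreal (C0 / 2)) < top \<longrightarrow> frac_converges \<rho> (\<lambda>x. f x / (2 * m)) x) \<and>
    \<Psi> (ennreal (\<bar>frac_int \<rho> (\<lambda>x. f x / (2 * m)) x\<bar> / C1)) \<le> \<Phi> (maximal_fun (\<lambda>x. f x / (2 * m)) x / ennreal (C0 / 2))"
    and C1': "2 * C1 \<le> C1'"
  shows "pointwise_ineq \<Phi> \<Psi> \<rho> N C0 C1' f x"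
proof -
  have "maximal_fun (\<lambda>x. f x / (2 * m)) x / ennreal (C0 / 2) = maximal_fun f x / (ennreal C0 * N f)"
  proof -
    have "maximal_fun (\<lambda>x. f x / (2 * m)) x / ennreal (C0 / 2) = maximal_fun f x * (inverse (ennreal (2 * m)) * inverse (ennreal (C0 / 2)))"
      using m by (subst maximal_fun_divide[OF f]) (auto simp: divide_ennreal_def mult.assoc)
    also have "inverse (ennreal (2 * m)) * inverse (ennreal (C0 / 2)) = ennreal (inverse (2 * m) * inverse (C0 / 2))"
      using m C by (subst ennreal_mult) (auto simp: inverse_ennreal)
    also have "inverse (2 * m) * inverse (C0 / 2) = inverse (C0 * m)" using m C by (simp add: field_simps)
    also have "ennreal (inverse (C0 * m)) = inverse (ennreal C0 * N f)"
      using m C by (simp add: ennreal_mult[symmetric] inverse_ennreal)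
    finally show ?thesis by (simp add: divide_ennreal_def)
  qed
  moreover have "\<Psi> (ennreal \<bar>frac_int \<rho> f x\<bar> / (ennreal C1' * N f)) \<le> \<Psi> (ennreal (\<bar>frac_int \<rho> (\<lambda>x. f x / (2 * m)) x\<bar> / C1))"
  proof (rule Q.mono')
    have "ennreal \<bar>frac_int \<rho> f x\<bar> / (ennreal C1' * N f) = ennreal (\<bar>frac_int \<rho> f x\<bar> / (C1' * m))"
      using m C C1' by (simp add: ennreal_mult[symmetric] divide_ennreal)
    also have "\<dots> \<le> ennreal (\<bar>frac_int \<rho> f x\<bar> / (2 * C1 * m))"
      using m C C1' by (intro ennreal_leI divide_left_mono mult_right_mono mult_pos_pos) auto
    also have "\<dots> = ennreal (\<bar>frac_int \<rho> (\<lambda>x. f x / (2 * m)) x\<bar> / C1)"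
      using m by (simp add: frac_int_divide mult_ac)
    finally show "ennreal \<bar>frac_int \<rho> f x\<bar> / (ennreal C1' * N f) \<le> ennreal (\<bar>frac_int \<rho> (\<lambda>x. f x / (2 * m)) x\<bar> / C1)" .
  qed
  ultimately show ?thesis
    using pt m by (auto simp: pointwise_ineq_def frac_converges_divide)
qed

lemma norm_positive:
  fixes N :: "('a::euclidean_space \<Rightarrow> real) \<Rightarrow> ennreal"
  assumes f: "f \<in> fun_space N" "\<not> (AE x in lebesgue. f x = 0)"
    and norm: "\<And>m. N f < ennreal m \<Longrightarrow> P.avg_le c (\<lambda>x. f x / m)"
  obtains m where "0 < m" "N f = ennreal m" "P.avg_le c (\<lambda>x. f x / (2 * m))"
proof -
  have fm: "f \<in> borel_measurable lebesgue" and "N f < top" using f by (auto simp: fun_space_def)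
  then obtain m where m: "N f = ennreal m" "0 \<le> m" by (cases "N f") auto
  have "m \<noteq> 0"
  proof
    assume "m = 0"
    then have "P.avg_le c (\<lambda>x. f x / m')" if "0 < m'" for m' using norm[of m'] that m by simp
    then show False using P.avg_le_all_imp_zero[OF fm] f(2) by blast
  qed
  then have "0 < m" using m by simp
  moreover have "P.avg_le c (\<lambda>x. f x / (2 * m))" using norm[of "2 * m"] m \<open>0 < m\<close> by (simp add: ennreal_less_iff)
  ultimately show thesis using m that by blast
qed

text \<open>Scheme for all three boundedness claims: X and Y are the modular conditions that go with
  N and N'. Functions vanishing almost everywhere are treated apart, since their norm may be 0 and
  they cannot be normalised.\<close>

lemma bounded_of_normalized:
  fixes N N' :: "('a::euclidean_space \<Rightarrow> real) \<Rightarrow> ennreal"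
  assumes meas: "(\<lambda>t. gen_inv \<Phi> (ennreal (\<phi> t))) \<in> borel_measurable (lebesgue_on {0<..})"
    and full: "full_cond \<Phi> \<Psi> \<phi> \<rho> A" and A: "0 < A" and c: "0 < c" and C1: "0 < C1"
    and norm: "\<And>f m. f \<in> borel_measurable lebesgue \<Longrightarrow> N f < ennreal m \<Longrightarrow> X (\<lambda>x. f x / m)"
    and avg: "\<And>F. F \<in> borel_measurable lebesgue \<Longrightarrow> X F \<Longrightarrow> P.avg_le c F"
    and norm': "\<And>g m. 0 < m \<Longrightarrow> Y (\<lambda>x. g x / m) \<Longrightarrow> N' g \<le> ennreal m"
    and main: "\<And>F. F \<in> borel_measurable lebesgue \<Longrightarrow> X F \<Longrightarrow> Y (\<lambda>x. frac_int \<rho> F x / C1)"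
    and zero: "Y (\<lambda>_. 0)"
  shows "frac_int_bounded \<rho> N N'"
  unfolding frac_int_bounded_def
proof (intro exI[of _ "2 * C1"] conjI ballI)
  show "0 < 2 * C1" using C1 by simp
  fix f assume fN: "f \<in> fun_space N"
  then have f: "f \<in> borel_measurable lebesgue" by (simp add: fun_space_def)
  have I: "frac_int \<rho> f \<in> borel_measurable lebesgue" by (rule measurable_frac_int[OF f])
  have "(AE x in lebesgue. frac_converges \<rho> f x) \<and> N' (frac_int \<rho> f) \<le> ennreal (2 * C1) * N f"
  proof (cases "AE x in lebesgue. f x = 0")
    case True
    have "frac_converges \<rho> f x" for x
      unfolding frac_converges_def
      using frac_integrand_zero_AE[OF True, of \<rho> x] measurable_frac_integrand[OF f, of x]
      by (subst integrable_cong_AE[where g="\<lambda>_. 0"]) auto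
    moreover have "frac_int \<rho> f = (\<lambda>_. 0)"
    proof
      fix x
      have "frac_int \<rho> f x = (\<integral>y. 0 \<partial>(lebesgue :: 'a measure))"
        unfolding frac_int_def
        using frac_integrand_zero_AE[OF True, of \<rho> x] measurable_frac_integrand[OF f, of x]
        by (intro integral_cong_AE) auto
      then show "frac_int \<rho> f x = 0" by simp
    qed
    moreover have "N' (\<lambda>_. 0) \<le> 0"
    proof (rule ennreal_le_epsilon)
      fix e :: real assume "0 < e"
      then show "N' (\<lambda>_. 0) \<le> 0 + ennreal e" using norm'[of e "\<lambda>_. 0"] zero by simp
    qed
    ultimately show ?thesis by simp
  next
    case False
    have "P.avg_le c (\<lambda>x. f x / m)" if "N f < ennreal m" for m
      using norm[OF f that] f by (intro avg) auto
    then obtain m where m: "0 < m" "N f = ennreal m" "P.avg_le c (\<lambda>x. f x / (2 * m))"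
      using norm_positive[OF fN False] by blast
    have X: "X (\<lambda>x. f x / (2 * m))" using norm[OF f, of "2 * m"] m by (simp add: ennreal_less_iff)
    have F: "(\<lambda>x. f x / (2 * m)) \<in> borel_measurable lebesgue" using f by measurable
    have "Y (\<lambda>x. frac_int \<rho> f x / (2 * C1 * m))"
      using main[OF F X] by (simp add: frac_int_divide mult_ac)
    then have "N' (frac_int \<rho> f) \<le> ennreal (2 * C1 * m)" using m C1 by (intro norm') auto
    also have "\<dots> = ennreal (2 * C1) * N f" using m C1 by (simp add: ennreal_mult)
    finally have "N' (frac_int \<rho> f) \<le> ennreal (2 * C1) * N f" .
    \<comment> \<open>Convergence is derived from finiteness of the maximal function, which also
      covers points where \<Phi> of it is \<infinity>.\<close>
    moreover have "AE x in lebesgue. maximal_fun (\<lambda>x. f x / (2 * m)) x < top"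
      using c by (intro P.maximal_fun_finite_AE[OF F m(3)]) simp
    then have "AE x in lebesgue. frac_converges \<rho> f x"
    proof eventually_elim
      case (elim x)
      then have "frac_converges \<rho> (\<lambda>x. f x / (2 * m)) x"
        using c by (intro frac_converges_if_maximal_finite[OF F m(3) _ meas full A]) simp_all
      then show ?case using m by (simp add: frac_converges_divide)
    qed
    ultimately show ?thesis by simp
  qed
  then show "AE x in lebesgue. frac_converges \<rho> f x" "N' (frac_int \<rho> f) \<le> ennreal (2 * C1) * N f" by auto
  then show "frac_int \<rho> f \<in> fun_space N'"
    using I fN by (auto simp: fun_space_def ennreal_mult_less_top intro: le_less_trans)
qed

lemma weak_of_maximal:
  fixes F :: "'a::euclidean_space \<Rightarrow> real"
  assumes F: "F \<in> borel_measurable lebesgue" and avg: "P.avg_le c F" and c: "0 \<le> c" and M0: "0 < M0" and C1: "0 < C1"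
    and W: "\<And>a r t. 0 < r \<Longrightarrow> 0 < t \<Longrightarrow> \<Phi> (ennreal t) * emeasure lebesgue {x \<in> ball a r. ennreal (M0 * t) < maximal_fun F x}
      \<le> ennreal (\<phi> r) * vol a r"
    and pt: "\<And>x. \<Psi> (ennreal (\<bar>frac_int \<rho> F x\<bar> / C1)) \<le> \<Phi> (maximal_fun F x / ennreal (2 * M0))"
  shows "weak_modular_le \<Psi> \<phi> (\<lambda>x. frac_int \<rho> F x / C1)"
  unfolding weak_modular_le_def distr_fun_def
proof (intro allI impI)
  fix a :: 'a and r t :: real assume r: "0 < r" and t: "0 < t"
  show "\<Psi> (ennreal t) * emeasure lebesgue {x \<in> ball a r. t < \<bar>frac_int \<rho> F x / C1\<bar>} \<le> ennreal (\<phi> r) * vol a r"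
  proof (rule P.weak_transfer[OF W[OF r] P.maximal_fun_finite_AE[OF F avg c] measurable_ball_maximal_fun M0])
    fix x assume x: "x \<in> {x \<in> ball a r. t < \<bar>frac_int \<rho> F x / C1\<bar>}"
    then have "\<Psi> (ennreal t) \<le> \<Psi> (ennreal (\<bar>frac_int \<rho> F x\<bar> / C1))"
      using C1 by (intro Q.mono' ennreal_leI) auto
    then show "x \<in> ball a r \<and> \<Psi> (ennreal t) \<le> \<Phi> (maximal_fun F x / ennreal (2 * M0))"
      using pt[of x] x by auto
  qed
qed

lemma strong_of_maximal:
  fixes F :: "'a::euclidean_space \<Rightarrow> real"
  assumes C1: "0 < C1"
    and S: "\<And>a r. 0 < r \<Longrightarrow> (\<integral>\<^sup>+x\<in>ball a r. \<Phi> (maximal_fun F x / ennreal M0) \<partial>lebesgue) \<le> ennreal (\<phi> r) * vol a r"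
    and pt: "\<And>x. \<Psi> (ennreal (\<bar>frac_int \<rho> F x\<bar> / C1)) \<le> \<Phi> (maximal_fun F x / ennreal M0)"
  shows "modular_le \<Psi> \<phi> (\<lambda>x. frac_int \<rho> F x / C1)"
  unfolding modular_le_def
proof (intro allI impI)
  fix a :: 'a and r :: real assume r: "0 < r"
  have "(\<integral>\<^sup>+x\<in>ball a r. \<Psi> (ennreal \<bar>frac_int \<rho> F x / C1\<bar>) \<partial>lebesgue) \<le> (\<integral>\<^sup>+x\<in>ball a r. \<Phi> (maximal_fun F x / ennreal M0) \<partial>lebesgue)"
    using pt C1 by (intro nn_integral_mono mult_right_mono) auto
  also have "\<dots> \<le> ennreal (\<phi> r) * vol a r" by (rule S[OF r])
  finally show "(\<integral>\<^sup>+x\<in>ball a r. \<Psi> (ennreal \<bar>frac_int \<rho> F x / C1\<bar>) \<partial>lebesgue) \<le> ennreal (\<phi> r) * vol a r" .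
qed

lemma weak_modular_le_zero: "weak_modular_le \<Psi> \<phi> (\<lambda>_. 0)"
  by (simp add: weak_modular_le_def distr_fun_def)

lemma modular_le_zero: "modular_le \<Psi> \<phi> (\<lambda>_. 0)"
  by (simp add: modular_le_def)

text \<open>Boundedness rests on the freedom in C0: it is set to the constant at which the maximal
  function satisfies its modular estimate, M0 for the strong conclusion and 2 M0 for the weak ones,
  where \<open>weak_transfer\<close> costs the factor 2.\<close>

lemma sufficiency:
  assumes n: "n = DIM('a::euclidean_space)"
    and lim0: "filterlim \<phi> at_top (at_right 0)" and limi: "(\<phi> \<longlongrightarrow> 0) at_top"
    and meas: "(\<lambda>t. gen_inv \<Phi> (ennreal (\<phi> t))) \<in> borel_measurable (lebesgue_on {0<..})"
    and full: "full_cond \<Phi> \<Psi> \<phi> \<rho> A" and A: "0 < A"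
  shows "\<forall>C0 > 0. \<exists>C1 > 0.
           (\<forall>f \<in> fun_space (L_norm \<Phi> \<phi>). \<not> (AE x in lebesgue. f x = 0) \<longrightarrow>
              (\<forall>x :: 'a. pointwise_ineq \<Phi> \<Psi> \<rho> (L_norm \<Phi> \<phi>) C0 C1 f x)) \<and>
           (\<Phi> \<in> nabla2_bar \<longrightarrow>
             (\<forall>f \<in> fun_space (wL_norm \<Phi> \<phi>). \<not> (AE x in lebesgue. f x = 0) \<longrightarrow>
                (\<forall>x :: 'a. pointwise_ineq \<Phi> \<Psi> \<rho> (wL_norm \<Phi> \<phi>) C0 C1 f x)))"
    (is "?pointwise")
    and "frac_int_bounded \<rho> (L_norm \<Phi> \<phi> :: ('a \<Rightarrow> real) \<Rightarrow> ennreal) (wL_norm \<Psi> \<phi>)" (is ?L_wL)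
    and "\<Phi> \<in> nabla2_bar \<Longrightarrow> frac_int_bounded \<rho> (L_norm \<Phi> \<phi> :: ('a \<Rightarrow> real) \<Rightarrow> ennreal) (L_norm \<Psi> \<phi>)"
    and "\<Phi> \<in> nabla2_bar \<Longrightarrow> frac_int_bounded \<rho> (wL_norm \<Phi> \<phi> :: ('a \<Rightarrow> real) \<Rightarrow> ennreal) (wL_norm \<Psi> \<phi>)"
proof -
  have nabD: "\<exists>k>1. \<forall>t>0. \<Phi> t \<le> ennreal (1 / (2 * k)) * \<Phi> (ennreal k * t)" if "\<Phi> \<in> nabla2_bar"
    using that by (auto simp: nabla2_bar_def)
  have L_mod: "modular_le \<Phi> \<phi> (\<lambda>x. f x / m)" if "L_norm \<Phi> \<phi> f < ennreal m" for f :: "'a \<Rightarrow> real" and m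
    using that by (intro L_norm_lessD P.phi_pos P.mono)
  have wL_mod: "weak_modular_le \<Phi> \<phi> (\<lambda>x. f x / m)" if "f \<in> borel_measurable lebesgue" "wL_norm \<Phi> \<phi> f < ennreal m" for f :: "'a \<Rightarrow> real" and m
    using that by (intro wL_norm_lessD P.phi_pos)
  have L_avg: "P.avg_le (4 * K) (\<lambda>x. f x / m)" if [measurable]: "f \<in> borel_measurable lebesgue" and "L_norm \<Phi> \<phi> f < ennreal m" for f :: "'a \<Rightarrow> real" and m
    by (intro P.modular_avg_le L_mod that(2)) measurable
  have K4: "0 < 4 * K" using P.K_ge_1 by simp
  note pointwise = pointwise_normalized[OF n lim0 limi meas full A]
  show ?pointwise
  proof (intro allI impI)
    fix C0 :: real assume C0: "0 < C0"
    then have C02: "0 < C0 / 2" by simp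
    obtain C1 where C1: "0 < C1" and pt: "\<And>(f :: 'a \<Rightarrow> real) x. f \<in> borel_measurable lebesgue \<Longrightarrow> P.avg_le (4 * K) f \<Longrightarrow>
      (\<Phi> (maximal_fun f x / ennreal (C0 / 2)) < top \<longrightarrow> frac_converges \<rho> f x) \<and>
      \<Psi> (ennreal (\<bar>frac_int \<rho> f x\<bar> / C1)) \<le> \<Phi> (maximal_fun f x / ennreal (C0 / 2))"
      using pointwise[OF K4 C02] by blast
    have strong: "pointwise_ineq \<Phi> \<Psi> \<rho> (L_norm \<Phi> \<phi>) C0 C1' f x"
      if f: "f \<in> fun_space (L_norm \<Phi> \<phi>)" "\<not> (AE x in lebesgue. f x = 0)" and C1': "2 * C1 \<le> C1'" for f :: "'a \<Rightarrow> real" and x C1'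
    proof -
      have fm: "f \<in> borel_measurable lebesgue" using f by (simp add: fun_space_def)
      then have Fm: "(\<lambda>x. f x / (2 * m)) \<in> borel_measurable lebesgue" for m by measurable
      obtain m where m: "0 < m" "L_norm \<Phi> \<phi> f = ennreal m" "P.avg_le (4 * K) (\<lambda>x. f x / (2 * m))"
        using norm_positive[OF f L_avg[OF fm]] by blast
      show ?thesis by (rule pointwise_ineq_of_normalized[where N="L_norm \<Phi> \<phi>", OF fm m(2,1) C0 C1 pt[OF Fm m(3)] C1'])
    qed
    show "\<exists>C1 > 0.
           (\<forall>f \<in> fun_space (L_norm \<Phi> \<phi>). \<not> (AE x in lebesgue. f x = 0) \<longrightarrow>
              (\<forall>x :: 'a. pointwise_ineq \<Phi> \<Psi> \<rho> (L_norm \<Phi> \<phi>) C0 C1 f x)) \<and>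
           (\<Phi> \<in> nabla2_bar \<longrightarrow>
             (\<forall>f \<in> fun_space (wL_norm \<Phi> \<phi>). \<not> (AE x in lebesgue. f x = 0) \<longrightarrow>
                (\<forall>x :: 'a. pointwise_ineq \<Phi> \<Psi> \<rho> (wL_norm \<Phi> \<phi>) C0 C1 f x)))"
    proof (cases "\<Phi> \<in> nabla2_bar")
      case False
      then show ?thesis using strong C1 by (intro exI[of _ "2 * C1"]) auto
    next
      case True
      then obtain k where k: "1 < k" and nab: "\<And>t. 0 < t \<Longrightarrow> \<Phi> t \<le> ennreal (1 / (2 * k)) * \<Phi> (ennreal k * t)"
        using nabD by blast
      have c: "0 < 2 + 4 * k" using k by simp
      obtain C2 where C2: "0 < C2" and pt2: "\<And>(f :: 'a \<Rightarrow> real) x. f \<in> borel_measurable lebesgue \<Longrightarrow> P.avg_le (2 + 4 * k) f \<Longrightarrow>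
        (\<Phi> (maximal_fun f x / ennreal (C0 / 2)) < top \<longrightarrow> frac_converges \<rho> f x) \<and>
        \<Psi> (ennreal (\<bar>frac_int \<rho> f x\<bar> / C2)) \<le> \<Phi> (maximal_fun f x / ennreal (C0 / 2))"
        using pointwise[OF c C02] by blast
      have weak: "pointwise_ineq \<Phi> \<Psi> \<rho> (wL_norm \<Phi> \<phi>) C0 C1' f x"
        if f: "f \<in> fun_space (wL_norm \<Phi> \<phi>)" "\<not> (AE x in lebesgue. f x = 0)" and C1': "2 * C2 \<le> C1'" for f :: "'a \<Rightarrow> real" and x C1'
      proof -
        have fm[measurable]: "f \<in> borel_measurable lebesgue" using f by (simp add: fun_space_def)
        then have Fm: "(\<lambda>x. f x / (2 * m)) \<in> borel_measurable lebesgue" for m by measurable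
        have "P.avg_le (2 + 4 * k) (\<lambda>x. f x / m)" if "wL_norm \<Phi> \<phi> f < ennreal m" for m
          by (intro P.weak_modular_avg_le[OF nab k] wL_mod that) measurable
        then obtain m where m: "0 < m" "wL_norm \<Phi> \<phi> f = ennreal m" "P.avg_le (2 + 4 * k) (\<lambda>x. f x / (2 * m))"
          using norm_positive[OF f] by blast
        show ?thesis by (rule pointwise_ineq_of_normalized[where N="wL_norm \<Phi> \<phi>", OF fm m(2,1) C0 C2 pt2[OF Fm m(3)] C1'])
      qed
      \<comment> \<open>One constant has to serve both norms, and enlarging it preserves each
        inequality.\<close>
      show ?thesis using strong weak C1 C2 by (intro exI[of _ "max (2 * C1) (2 * C2)"]) auto
    qed
  qed
  have gc: "1 \<le> P.Gc 2" by (rule P.Gc_ge_1) simp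
  show ?L_wL
  proof -
    define M0 where "M0 = 2 * (4 * K * P.Gc 2) + 2 * (K * D * 10 ^ n)"
    have M0: "0 < M0" using P.K_ge_1 P.D_ge_1 gc by (simp add: M0_def add_pos_pos)
    then have "0 < 2 * M0" by simp
    then obtain C1 where C1: "0 < C1" and pt: "\<And>(f :: 'a \<Rightarrow> real) x. f \<in> borel_measurable lebesgue \<Longrightarrow> P.avg_le (4 * K) f \<Longrightarrow>
      (\<Phi> (maximal_fun f x / ennreal (2 * M0)) < top \<longrightarrow> frac_converges \<rho> f x) \<and>
      \<Psi> (ennreal (\<bar>frac_int \<rho> f x\<bar> / C1)) \<le> \<Phi> (maximal_fun f x / ennreal (2 * M0))"
      using pointwise[OF K4] by blast
    show ?thesis
    proof (rule bounded_of_normalized[where X="modular_le \<Phi> \<phi>" and Y="weak_modular_le \<Psi> \<phi>", OF meas full A K4 C1])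
      show "modular_le \<Phi> \<phi> (\<lambda>x. f x / m)" if "f \<in> borel_measurable lebesgue" "L_norm \<Phi> \<phi> f < ennreal m" for f :: "'a \<Rightarrow> real" and m
        by (rule L_mod[OF that(2)])
      show "P.avg_le (4 * K) F" if "F \<in> borel_measurable lebesgue" "modular_le \<Phi> \<phi> F" for F :: "'a \<Rightarrow> real"
        by (rule P.modular_avg_le[OF that])
      show "wL_norm \<Psi> \<phi> g \<le> ennreal m" if "0 < m" "weak_modular_le \<Psi> \<phi> (\<lambda>x. g x / m)" for g :: "'a \<Rightarrow> real" and m
        by (rule wL_norm_leI[OF P.phi_pos that])
      show "weak_modular_le \<Psi> \<phi> (\<lambda>_ :: 'a. 0)" by (rule weak_modular_le_zero)
      show "weak_modular_le \<Psi> \<phi> (\<lambda>x. frac_int \<rho> F x / C1)" if F: "F \<in> borel_measurable lebesgue" "modular_le \<Phi> \<phi> F" for F :: "'a \<Rightarrow> real"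
        using K4 pt[OF F(1) P.modular_avg_le[OF F]] F
        by (intro weak_of_maximal[OF F(1) P.modular_avg_le[OF F] _ M0 C1] P.maximal_weak[OF n]) (auto simp: M0_def)
    qed
  qed
  show "frac_int_bounded \<rho> (L_norm \<Phi> \<phi> :: ('a \<Rightarrow> real) \<Rightarrow> ennreal) (L_norm \<Psi> \<phi>)" if nb: "\<Phi> \<in> nabla2_bar"
  proof -
    obtain k where k: "1 < k" and nab: "\<And>t. 0 < t \<Longrightarrow> \<Phi> t \<le> ennreal (1 / (2 * k)) * \<Phi> (ennreal k * t)"
      using nabD[OF nb] by blast
    define M0 where "M0 = 8 * K * (4 * K * P.Gc 2) + 8 * k * k * K * D * 10 ^ n"
    have M0: "0 < M0" using P.K_ge_1 P.D_ge_1 gc k by (simp add: M0_def add_pos_pos)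
    obtain C1 where C1: "0 < C1" and pt: "\<And>(f :: 'a \<Rightarrow> real) x. f \<in> borel_measurable lebesgue \<Longrightarrow> P.avg_le (4 * K) f \<Longrightarrow>
      (\<Phi> (maximal_fun f x / ennreal M0) < top \<longrightarrow> frac_converges \<rho> f x) \<and>
      \<Psi> (ennreal (\<bar>frac_int \<rho> f x\<bar> / C1)) \<le> \<Phi> (maximal_fun f x / ennreal M0)"
      using pointwise[OF K4 M0] by blast
    show ?thesis
    proof (rule bounded_of_normalized[where X="modular_le \<Phi> \<phi>" and Y="modular_le \<Psi> \<phi>", OF meas full A K4 C1])
      show "modular_le \<Phi> \<phi> (\<lambda>x. f x / m)" if "f \<in> borel_measurable lebesgue" "L_norm \<Phi> \<phi> f < ennreal m" for f :: "'a \<Rightarrow> real" and m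
        by (rule L_mod[OF that(2)])
      show "P.avg_le (4 * K) F" if "F \<in> borel_measurable lebesgue" "modular_le \<Phi> \<phi> F" for F :: "'a \<Rightarrow> real"
        by (rule P.modular_avg_le[OF that])
      show "L_norm \<Psi> \<phi> g \<le> ennreal m" if "0 < m" "modular_le \<Psi> \<phi> (\<lambda>x. g x / m)" for g :: "'a \<Rightarrow> real" and m
        by (rule L_norm_leI[OF P.phi_pos that])
      show "modular_le \<Psi> \<phi> (\<lambda>_ :: 'a. 0)" by (rule modular_le_zero)
      show "modular_le \<Psi> \<phi> (\<lambda>x. frac_int \<rho> F x / C1)" if F: "F \<in> borel_measurable lebesgue" "modular_le \<Phi> \<phi> F" for F :: "'a \<Rightarrow> real"
        using pt[OF F(1) P.modular_avg_le[OF F]] F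
        by (intro strong_of_maximal[OF C1] P.maximal_strong[OF n nab k]) (auto simp: M0_def)
    qed
  qed
  show "frac_int_bounded \<rho> (wL_norm \<Phi> \<phi> :: ('a \<Rightarrow> real) \<Rightarrow> ennreal) (wL_norm \<Psi> \<phi>)" if nb: "\<Phi> \<in> nabla2_bar"
  proof -
    obtain k where k: "1 < k" and nab: "\<And>t. 0 < t \<Longrightarrow> \<Phi> t \<le> ennreal (1 / (2 * k)) * \<Phi> (ennreal k * t)"
      using nabD[OF nb] by blast
    define M0 where "M0 = 2 * ((2 + 4 * k) * P.Gc 2) + 2 * (2 * k * K * D * 10 ^ n)"
    have M0: "0 < M0" using P.K_ge_1 P.D_ge_1 gc k by (simp add: M0_def add_pos_pos)
    then have M02: "0 < 2 * M0" by simp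
    have c: "0 < 2 + 4 * k" using k by simp
    obtain C1 where C1: "0 < C1" and pt: "\<And>(f :: 'a \<Rightarrow> real) x. f \<in> borel_measurable lebesgue \<Longrightarrow> P.avg_le (2 + 4 * k) f \<Longrightarrow>
      (\<Phi> (maximal_fun f x / ennreal (2 * M0)) < top \<longrightarrow> frac_converges \<rho> f x) \<and>
      \<Psi> (ennreal (\<bar>frac_int \<rho> f x\<bar> / C1)) \<le> \<Phi> (maximal_fun f x / ennreal (2 * M0))"
      using pointwise[OF c M02] by blast
    have avg: "P.avg_le (2 + 4 * k) F" if "F \<in> borel_measurable lebesgue" "weak_modular_le \<Phi> \<phi> F" for F :: "'a \<Rightarrow> real"
      by (rule P.weak_modular_avg_le[OF nab k that])
    show ?thesis
    proof (rule bounded_of_normalized[where X="weak_modular_le \<Phi> \<phi>" and Y="weak_modular_le \<Psi> \<phi>", OF meas full A c C1])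
      show "weak_modular_le \<Phi> \<phi> (\<lambda>x. f x / m)" if "f \<in> borel_measurable lebesgue" "wL_norm \<Phi> \<phi> f < ennreal m" for f :: "'a \<Rightarrow> real" and m
        by (rule wL_mod[OF that])
      show "P.avg_le (2 + 4 * k) F" if "F \<in> borel_measurable lebesgue" "weak_modular_le \<Phi> \<phi> F" for F :: "'a \<Rightarrow> real"
        by (rule avg[OF that])
      show "wL_norm \<Psi> \<phi> g \<le> ennreal m" if "0 < m" "weak_modular_le \<Psi> \<phi> (\<lambda>x. g x / m)" for g :: "'a \<Rightarrow> real" and m
        by (rule wL_norm_leI[OF P.phi_pos that])
      show "weak_modular_le \<Psi> \<phi> (\<lambda>_ :: 'a. 0)" by (rule weak_modular_le_zero)
      show "weak_modular_le \<Psi> \<phi> (\<lambda>x. frac_int \<rho> F x / C1)" if F: "F \<in> borel_measurable lebesgue" "weak_modular_le \<Phi> \<phi> F" for F :: "'a \<Rightarrow> real"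
        using c pt[OF F(1) avg[OF F]] F
        by (intro weak_of_maximal[OF F(1) avg[OF F] _ M0 C1] P.maximal_weak_weak[OF n nab k]) (auto simp: M0_def)
    qed
  qed
qed

end

section \<open>Necessity\<close>

lemma nn_integral_lborel_reflect:
  fixes h :: "'a::euclidean_space \<Rightarrow> ennreal"
  assumes [measurable]: "h \<in> borel_measurable borel"
  shows "(\<integral>\<^sup>+y. h (x - y) \<partial>lborel) = (\<integral>\<^sup>+z. h z \<partial>lborel)"
proof -
  have "(lborel :: 'a measure) = distr lborel borel (\<lambda>z. x - z)"
    by (subst lborel_affine[of "-1" x]) (auto simp: density_1)
  then have "(\<integral>\<^sup>+z. h z \<partial>lborel) = (\<integral>\<^sup>+z. h z \<partial>distr lborel borel (\<lambda>z. x - z))" by simp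
  also have "\<dots> = (\<integral>\<^sup>+y. h (x - y) \<partial>lborel)" by (subst nn_integral_distr) auto
  finally show ?thesis ..
qed

section \<open>Test functions and target norms\<close>

context orlicz_morrey
begin

text \<open>G(r) is first halved, to be strictly below it in \<open>Phi_le_phi\<close>;
  \<open>scale_real\<close> converts the remaining 1 / (K L) into the factor 1 / L.\<close>

lemma Phi_G_le:
  assumes "0 < r" "1 \<le> L"
  shows "\<Phi> (ennreal (G r / (2 * K * L))) \<le> ennreal (\<phi> r / L)"
proof -
  have "\<Phi> (ennreal (1 / (2 * K * L)) * ennreal (G r)) \<le> ennreal (K * (1 / (2 * K * L)) / (1 / 2)) * \<Phi> (ennreal (1 / 2) * ennreal (G r))"
    using assms K_ge_1 by (intro scale_real) auto
  also have "K * (1 / (2 * K * L)) / (1 / 2) = 1 / L" using K_ge_1 assms by simp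
  also have "ennreal (1 / 2) * ennreal (G r) = ennreal (1 / 2 * G r)"
    using G_pos[OF assms(1)] by (intro ennreal_mult[symmetric]) auto
  also have "ennreal (1 / L) * \<Phi> (ennreal (1 / 2 * G r)) \<le> ennreal (1 / L) * ennreal (\<phi> r)"
    using G_pos[OF assms(1)] assms by (intro mult_left_mono Phi_le_phi) auto
  also have "\<dots> = ennreal (\<phi> r / L)"
    using assms phi_pos[OF assms(1)] by (simp add: ennreal_mult[symmetric])
  also have "ennreal (1 / (2 * K * L)) * ennreal (G r) = ennreal (G r / (2 * K * L))"
    using assms K_ge_1 G_pos[OF assms(1)] by (simp add: ennreal_mult[symmetric])
  finally show ?thesis .
qed

text \<open>After scaling, \<Phi> of the function is at most \<phi>(r) / D on
  \<open>ball 0 r\<close>. For s \<le> r, \<open>phi_dec\<close> compares \<phi>(r) with \<phi>(s);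
  for s > r the intersection has at most the volume of \<open>ball 0 r\<close>, and
  \<open>phi_inc\<close> compares \<open>\<phi> r * r ^ n\<close> with
  \<open>\<phi> s * s ^ n\<close>. The D in the scaling pays for either.\<close>

lemma modular_le_indicator_ball:
  assumes n: "n = DIM('a::euclidean_space)" and r: "0 < r"
  shows "modular_le \<Phi> \<phi> (\<lambda>x. indicator (ball (0::'a) r) x / (2 * K * D / G r))"
  unfolding modular_le_def
proof (intro allI impI)
  fix a :: 'a and s :: real assume s: "0 < s"
  let ?w = "unit_ball_vol (real DIM('a))"
  have eq: "\<bar>indicator (ball (0::'a) r) x / (2 * K * D / G r)\<bar> = indicator (ball 0 r) x * (G r / (2 * K * D))" for x
    using G_pos[OF r] K_ge_1 D_ge_1 by (auto simp: indicator_def)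
  have "(\<integral>\<^sup>+x\<in>ball a s. \<Phi> (ennreal \<bar>indicator (ball (0::'a) r) x / (2 * K * D / G r)\<bar>) \<partial>lebesgue) \<le>
    (\<integral>\<^sup>+x. ennreal (\<phi> r / D) * indicator (ball a s \<inter> ball 0 r) x \<partial>lebesgue)"
    unfolding eq using Phi_G_le[OF r D_ge_1] by (intro nn_integral_mono) (auto simp: indicator_def)
  also have "\<dots> = ennreal (\<phi> r / D) * emeasure lebesgue (ball a s \<inter> ball 0 r)"
    by (rule nn_integral_cmult_indicator) simp
  also have "\<dots> \<le> ennreal (\<phi> s) * vol a s"
  proof (cases "s \<le> r")
    case True
    then have "\<phi> r \<le> D * \<phi> s" using s by (intro phi_dec) auto
    then have "\<phi> r / D \<le> \<phi> s" using D_ge_1 by (simp add: field_simps)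
    then show ?thesis by (intro mult_mono ennreal_leI emeasure_mono) auto
  next
    case False
    have "\<phi> r * r ^ n \<le> D * (\<phi> s * s ^ n)" using False r by (intro phi_inc) auto
    then have "\<phi> r / D * r ^ n \<le> \<phi> s * s ^ n" using D_ge_1 by (simp add: field_simps)
    then have le: "\<phi> r / D * (?w * r ^ n) \<le> \<phi> s * (?w * s ^ n)"
      using mult_left_mono[of "\<phi> r / D * r ^ n" "\<phi> s * s ^ n" ?w] by (simp add: mult_ac)
    have "ennreal (\<phi> r / D) * emeasure lebesgue (ball a s \<inter> ball 0 r) \<le> ennreal (\<phi> r / D) * vol (0::'a) r"
      by (intro mult_left_mono emeasure_mono) auto
    also have "\<dots> = ennreal (\<phi> r / D * (?w * r ^ n))"
      using r phi_pos[OF r] D_ge_1 by (simp add: emeasure_ball n ennreal_mult[symmetric])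
    also have "\<dots> \<le> ennreal (\<phi> s * (?w * s ^ n))" by (rule ennreal_leI[OF le])
    also have "\<dots> = ennreal (\<phi> s) * vol a s"
      using s phi_pos[OF s] by (simp add: emeasure_ball ennreal_mult n)
    finally show ?thesis .
  qed
  finally show "(\<integral>\<^sup>+x\<in>ball a s. \<Phi> (ennreal \<bar>indicator (ball (0::'a) r) x / (2 * K * D / G r)\<bar>) \<partial>lebesgue) \<le> ennreal (\<phi> s) * vol a s" .
qed

text \<open>The origin is set to 0 because \<phi> carries information on positive radii
  only.\<close>

definition radial_G :: "'a::euclidean_space \<Rightarrow> real" where
  "radial_G y = (if y = 0 then 0 else G (norm y))"

lemma phi_borel_version:
  assumes "\<phi> \<in> borel_measurable (lebesgue_on {0<..})"
  obtains \<phi>' where "\<phi>' \<in> borel_measurable borel" "AE t in lborel. 0 < t \<longrightarrow> \<phi> t = \<phi>' t"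
proof -
  have "(\<lambda>t. if t \<in> {0<..} then \<phi> t else 0) \<in> borel_measurable lebesgue"
    using assms by (subst borel_measurable_if) auto
  then obtain g where g: "g \<in> borel_measurable borel" "AE t in lborel. (if t \<in> {0<..} then \<phi> t else 0) = g t"
    by (rule borel_version)
  show thesis by (rule that[OF g(1)]) (use g(2) in eventually_elim, auto)
qed

lemma measurable_gen_inv: "gen_inv \<Phi> \<in> borel_measurable borel"
  by (rule borel_measurable_mono_ennreal) (auto simp: mono_def gen_inv_mono)

lemma G_borel_version:
  assumes "\<phi> \<in> borel_measurable (lebesgue_on {0<..})"
  obtains g where "g \<in> borel_measurable borel" "AE t in lborel. 0 < t \<longrightarrow> G t = g t"
proof -
  obtain \<phi>' where [measurable]: "\<phi>' \<in> borel_measurable borel" and p: "AE t in lborel. 0 < t \<longrightarrow> \<phi> t = \<phi>' t"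
    using phi_borel_version[OF assms] by blast
  note [measurable] = measurable_gen_inv
  show thesis
  proof (rule that)
    show "(\<lambda>t. enn2real (gen_inv \<Phi> (ennreal (\<phi>' t)))) \<in> borel_measurable borel" by measurable
    show "AE t in lborel. 0 < t \<longrightarrow> G t = enn2real (gen_inv \<Phi> (ennreal (\<phi>' t)))"
      using p by eventually_elim (simp add: inv_comp_def)
  qed
qed

lemma radial_G_AE:
  assumes "AE t in lborel. 0 < t \<longrightarrow> G t = g t"
  shows "AE y in lborel. radial_G (y :: 'a::euclidean_space) = g (norm y)"
proof -
  have "AE y in lborel. y \<noteq> (0::'a)" by (simp add: AE_lborel_singleton)
  then show ?thesis
    using AE_norm_lborel[OF assms, of "0::'a"] by eventually_elim (simp add: radial_G_def)
qed

lemma measurable_radial_G: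
  assumes "\<phi> \<in> borel_measurable (lebesgue_on {0<..})"
  shows "(radial_G :: 'a::euclidean_space \<Rightarrow> real) \<in> borel_measurable lebesgue"
proof -
  obtain g where [measurable]: "g \<in> borel_measurable borel" and g: "AE t in lborel. 0 < t \<longrightarrow> G t = g t"
    using G_borel_version[OF assms] by blast
  have "(\<lambda>y::'a. g (norm y)) \<in> borel_measurable lborel" by measurable
  then have "(\<lambda>y::'a. g (norm y)) \<in> borel_measurable lebesgue" by (rule measurable_completion)
  moreover have "AE y in lebesgue. g (norm y) = radial_G (y :: 'a)"
    using AE_completion[OF radial_G_AE[OF g]] by eventually_elim simp
  ultimately show ?thesis by (rule borel_measurable_AE)
qed

text \<open>If |a| > 2 s, then |y| \<ge> s on the ball, so \<phi>(|y|) \<le> D \<phi>(s). Otherwise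
  the ball lies in \<open>ball 0 (3 * s)\<close>, where polar coordinates lead to the hypothesis at
  radius 3 s, hence the \<open>3 ^ n\<close>. The origin is removed because \<phi> is arbitrary at
  0.\<close>

lemma phi_integral_ball:
  assumes n: "n = DIM('a::euclidean_space)" and meas: "\<phi> \<in> borel_measurable (lebesgue_on {0<..})"
    and B: "0 < B" "\<And>r. 0 < r \<Longrightarrow> (\<integral>\<^sup>+t\<in>{0<..<r}. ennreal (\<phi> t * t ^ (n - 1)) \<partial>lebesgue) \<le> ennreal (B * (\<phi> r * r ^ n))"
    and s: "0 < s"
  shows "(\<integral>\<^sup>+y\<in>ball a s - {0}. ennreal (\<phi> (norm y)) \<partial>lebesgue) \<le>
    ennreal (D + sphere_area TYPE('a) * B * D * 3 ^ n / unit_ball_vol (real n)) * (ennreal (\<phi> s) * vol (a :: 'a) s)"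
    (is "_ \<le> ennreal (D + ?B) * _")
proof -
  let ?V = "ennreal (\<phi> s) * vol a s" let ?w = "unit_ball_vol (real n)"
  have w: "?w \<noteq> 0" by (rule less_imp_neq[symmetric, OF unit_ball_vol_pos]) simp
  have B0: "0 \<le> ?B" using B D_ge_1 less_imp_le[OF sphere_area_pos[where 'a='a]] by simp
  show ?thesis
  proof (cases "norm a \<le> 2 * s")
    case False
    have "(\<integral>\<^sup>+y\<in>ball a s - {0}. ennreal (\<phi> (norm y)) \<partial>lebesgue) \<le> (\<integral>\<^sup>+y. ennreal (D * \<phi> s) * indicator (ball a s) y \<partial>lebesgue)"
    proof (rule nn_integral_mono)
      fix y
      show "ennreal (\<phi> (norm y)) * indicator (ball a s - {0}) y \<le> ennreal (D * \<phi> s) * indicator (ball a s) y"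
      proof (cases "y \<in> ball a s")
        case True
        have "norm a \<le> norm (a - y) + norm y" using norm_triangle_ineq[of "a - y" y] by simp
        then have "s \<le> norm y" using True False by (simp add: dist_norm)
        then have "\<phi> (norm y) \<le> D * \<phi> s" using s by (intro phi_dec) auto
        then show ?thesis using True by (auto simp: indicator_def ennreal_leI)
      qed simp
    qed
    also have "\<dots> = ennreal (D * \<phi> s) * vol a s"
      by (rule nn_integral_cmult_indicator) simp
    also have "\<dots> = ennreal D * ?V" using D_ge_1 phi_pos[OF s] by (simp add: ennreal_mult mult.assoc)
    also have "\<dots> \<le> ennreal (D + ?B) * ?V" using B0 by (intro mult_right_mono ennreal_leI) auto
    finally show ?thesis .
  next
    case True
    obtain \<phi>' where [measurable]: "\<phi>' \<in> borel_measurable borel" and p: "AE t in lborel. 0 < t \<longrightarrow> \<phi> t = \<phi>' t"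
      using phi_borel_version[OF meas] by blast
    have "AE y in lborel. y \<noteq> (0::'a)" by (simp add: AE_lborel_singleton)
    then have p': "AE y in lborel. \<phi> (norm (y::'a)) = \<phi>' (norm y)"
      using AE_norm_lborel[OF p, of "0::'a"] by eventually_elim simp
    have "(\<integral>\<^sup>+y\<in>ball a s - {0}. ennreal (\<phi> (norm y)) \<partial>lebesgue) \<le> (\<integral>\<^sup>+y. ennreal (\<phi>' (norm y)) * indicator {..<3 * s} (norm y) \<partial>(lborel :: 'a measure))"
      unfolding nn_integral_completion
    proof (rule nn_integral_mono_AE)
      show "AE y in lborel. ennreal (\<phi> (norm y)) * indicator (ball a s - {0}) y \<le> ennreal (\<phi>' (norm y)) * indicator {..<3 * s} (norm y)"
        using p'
      proof eventually_elim
        case (elim y)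
        show ?case
        proof (cases "y \<in> ball a s")
          case yin: True
          have "norm y \<le> norm (y - a) + norm a" using norm_triangle_ineq[of "y - a" a] by simp
          then have "norm y < 3 * s" using yin True by (simp add: dist_norm norm_minus_commute)
          then show ?thesis using elim by (auto simp: indicator_def)
        qed simp
      qed
    qed
    also have "\<dots> = (\<integral>\<^sup>+t\<in>{0<..}. ennreal (sphere_area TYPE('a) * t ^ (DIM('a) - 1)) * (ennreal (\<phi>' t) * indicator {..<3 * s} t) \<partial>lborel)"
      by (rule nn_integral_radial) measurable
    also have "\<dots> = (\<integral>\<^sup>+t. ennreal (sphere_area TYPE('a)) * (ennreal (\<phi>' t * t ^ (n - 1)) * indicator {0<..<3 * s} t) \<partial>lborel)"
      using less_imp_le[OF sphere_area_pos[where 'a='a]]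
      by (intro nn_integral_cong) (auto simp: indicator_def n ennreal_mult'' mult_ac)
    also have "\<dots> = ennreal (sphere_area TYPE('a)) * (\<integral>\<^sup>+t\<in>{0<..<3 * s}. ennreal (\<phi>' t * t ^ (n - 1)) \<partial>lborel)"
      by (rule nn_integral_cmult) measurable
    also have "(\<integral>\<^sup>+t\<in>{0<..<3 * s}. ennreal (\<phi>' t * t ^ (n - 1)) \<partial>lborel) = (\<integral>\<^sup>+t\<in>{0<..<3 * s}. ennreal (\<phi> t * t ^ (n - 1)) \<partial>lebesgue)"
      unfolding nn_integral_completion
      by (rule nn_integral_cong_AE) (use p in eventually_elim, auto simp: indicator_def)
    also have "\<dots> \<le> ennreal (B * (\<phi> (3 * s) * (3 * s) ^ n))" using s by (intro B(2)) simp
    also have "\<dots> \<le> ennreal (B * (D * \<phi> s * (3 * s) ^ n))"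
      using s B(1) by (intro ennreal_leI mult_left_mono mult_right_mono phi_dec) auto
    also have "ennreal (sphere_area TYPE('a)) * ennreal (B * (D * \<phi> s * (3 * s) ^ n)) = ennreal ?B * ?V"
    proof -
      have "sphere_area TYPE('a) * (B * (D * \<phi> s * (3 * s) ^ n)) = ?B * (\<phi> s * (?w * s ^ n))"
        using w by (simp add: field_simps power_mult_distrib)
      moreover have "?V = ennreal (\<phi> s * (?w * s ^ n))"
        using s phi_pos[OF s] by (simp add: emeasure_ball ennreal_mult n)
      moreover have "0 \<le> \<phi> s * (?w * s ^ n)" "0 \<le> B * (D * \<phi> s * (3 * s) ^ n)"
        using s phi_pos[OF s] B D_ge_1 by simp_all
      ultimately show ?thesis using B0 less_imp_le[OF sphere_area_pos[where 'a='a]]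
        by (simp only: ennreal_mult[symmetric])
    qed
    also have "ennreal ?B * ?V \<le> ennreal (D + ?B) * ?V" using D_ge_1 by (intro mult_right_mono ennreal_leI) auto
    finally show ?thesis by (simp add: mult_left_mono)
  qed
qed

text \<open>By \<open>Phi_G_le\<close> at radius |y|, \<Phi> of the scaled function is at most
  \<phi>(|y|) / L, and L is the constant of \<open>phi_integral_ball\<close>.\<close>

lemma modular_le_radial_G:
  assumes n: "n = DIM('a::euclidean_space)" and meas: "\<phi> \<in> borel_measurable (lebesgue_on {0<..})"
    and B: "0 < B" "\<And>r. 0 < r \<Longrightarrow> (\<integral>\<^sup>+t\<in>{0<..<r}. ennreal (\<phi> t * t ^ (n - 1)) \<partial>lebesgue) \<le> ennreal (B * (\<phi> r * r ^ n))"
    and L: "L = D + sphere_area TYPE('a) * B * D * 3 ^ n / unit_ball_vol (real n)"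
  shows "modular_le \<Phi> \<phi> (\<lambda>y :: 'a. radial_G y / (2 * K * L))"
  unfolding modular_le_def
proof (intro allI impI)
  fix a :: 'a and s :: real assume s: "0 < s"
  have "0 \<le> sphere_area TYPE('a) * B * D * 3 ^ n / unit_ball_vol (real n)"
    using B D_ge_1 less_imp_le[OF sphere_area_pos[where 'a='a]] by simp
  then have L1: "1 \<le> L" using D_ge_1 by (simp add: L)
  have "(\<integral>\<^sup>+y\<in>ball a s. \<Phi> (ennreal \<bar>radial_G y / (2 * K * L)\<bar>) \<partial>lebesgue) \<le>
    (\<integral>\<^sup>+y. ennreal (\<phi> (norm y)) * indicator (ball a s - {0}) y / ennreal L \<partial>lebesgue)"
  proof (rule nn_integral_mono)
    fix y
    show "\<Phi> (ennreal \<bar>radial_G y / (2 * K * L)\<bar>) * indicator (ball a s) y \<le> ennreal (\<phi> (norm y)) * indicator (ball a s - {0}) y / ennreal L"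
    proof (cases "y = 0 \<or> y \<notin> ball a s")
      case False
      then have y: "0 < norm y" by simp
      have "\<bar>radial_G y / (2 * K * L)\<bar> = G (norm y) / (2 * K * L)"
        using False G_pos[OF y] K_ge_1 L1 by (simp add: radial_G_def)
      then show ?thesis using Phi_G_le[OF y L1] False L1 phi_pos[OF y] by (simp add: divide_ennreal)
    qed (auto simp: radial_G_def)
  qed
  also have "\<dots> = (\<integral>\<^sup>+y\<in>ball a s - {0}. ennreal (\<phi> (norm y)) \<partial>lebesgue) / ennreal L"
  proof (rule nn_integral_divide)
    obtain \<phi>' where [measurable]: "\<phi>' \<in> borel_measurable borel" and p: "AE t in lborel. 0 < t \<longrightarrow> \<phi> t = \<phi>' t"
      using phi_borel_version[OF meas] by blast
    have "(\<lambda>y::'a. if y = 0 then 0 else \<phi> (norm y)) \<in> borel_measurable lebesgue"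
    proof (rule borel_measurable_AE)
      have "(\<lambda>y::'a. if y = 0 then 0 else \<phi>' (norm y)) \<in> borel_measurable lborel" by measurable
      then show "(\<lambda>y::'a. if y = 0 then 0 else \<phi>' (norm y)) \<in> borel_measurable lebesgue" by (rule measurable_completion)
      show "AE y in lebesgue. (if y = 0 then 0 else \<phi>' (norm y)) = (if y = 0 then 0 else \<phi> (norm (y::'a)))"
        using AE_completion[OF AE_norm_lborel[OF p, of "0::'a"]] by eventually_elim auto
    qed
    then have "(\<lambda>y::'a. ennreal (if y = 0 then 0 else \<phi> (norm y)) * indicator (ball a s) y) \<in> borel_measurable lebesgue"
      by measurable
    also have "(\<lambda>y::'a. ennreal (if y = 0 then 0 else \<phi> (norm y)) * indicator (ball a s) y) = (\<lambda>y. ennreal (\<phi> (norm y)) * indicator (ball a s - {0}) y)"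
      by (auto simp: fun_eq_iff indicator_def)
    finally show "(\<lambda>y. ennreal (\<phi> (norm y)) * indicator (ball a s - {0}) y) \<in> borel_measurable lebesgue" .
  qed
  also have "\<dots> \<le> ennreal (\<phi> s) * vol a s"
    using phi_integral_ball[OF n meas B s, of a] L1 unfolding L[symmetric]
    by (subst ennreal_divide_le_iff) (auto simp: mult.commute[of _ "ennreal L"])
  finally show "(\<integral>\<^sup>+y\<in>ball a s. \<Phi> (ennreal \<bar>radial_G y / (2 * K * L)\<bar>) \<partial>lebesgue) \<le> ennreal (\<phi> s) * vol a s" .
qed

text \<open>The only property of the target space that the necessity proofs use.\<close>

definition detects_lower_bounds :: "(('a::euclidean_space \<Rightarrow> real) \<Rightarrow> ennreal) \<Rightarrow> bool" where
  "detects_lower_bounds N \<longleftrightarrow> (\<forall>g c r d. g \<in> borel_measurable lebesgue \<longrightarrow> 0 < c \<longrightarrow> 0 < r \<longrightarrow> N g < ennreal c \<longrightarrow>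
     (AE x in lebesgue. x \<in> ball 0 r \<longrightarrow> d \<le> ennreal \<bar>g x\<bar>) \<longrightarrow> d \<le> ennreal (c * G r))"

text \<open>Each level \<tau> below d / c is exceeded almost everywhere on the ball, so the
  superlevel set has full measure there and the weak condition reads \<Phi>(\<tau>) \<le> \<phi>(r).
  The level d / c itself may not be exceeded, hence \<open>dense_le\<close>.\<close>

lemma wL_norm_detects: "detects_lower_bounds (wL_norm \<Phi> \<phi> :: ('a::euclidean_space \<Rightarrow> real) \<Rightarrow> ennreal)"
  unfolding detects_lower_bounds_def
proof (intro allI impI)
  fix g :: "'a \<Rightarrow> real" and c r :: real and d :: ennreal
  assume g[measurable]: "g \<in> borel_measurable lebesgue" and c: "0 < c" and r: "0 < r" and N: "wL_norm \<Phi> \<phi> g < ennreal c"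
    and d: "AE x in lebesgue. x \<in> ball 0 r \<longrightarrow> d \<le> ennreal \<bar>g x\<bar>"
  have mod: "weak_modular_le \<Phi> \<phi> (\<lambda>x. g x / c)" by (rule wL_norm_lessD[OF phi_pos g N])
  have "d / ennreal c \<le> ennreal (G r)"
  proof (rule dense_le)
    fix t assume t: "t < d / ennreal c"
    then have "t < top" by (metis less_top order_less_le_trans top_greatest)
    then obtain \<tau> where \<tau>: "t = ennreal \<tau>" "0 \<le> \<tau>" by (cases t) auto
    show "t \<le> ennreal (G r)"
    proof (cases "\<tau> = 0")
      case False
      then have tau: "0 < \<tau>" using \<tau> by simp
      let ?E = "{x \<in> ball 0 r. \<tau> < \<bar>g x / c\<bar>}"
      have E: "?E \<in> sets lebesgue" by (rule measurable_abs_greater) measurable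
      have "emeasure lebesgue ?E = vol (0::'a) r"
      proof (rule emeasure_eq_AE)
        show "AE x in lebesgue. (x \<in> ?E) = (x \<in> ball 0 r)"
          using d
        proof eventually_elim
          case (elim x)
          have "\<tau> < \<bar>g x / c\<bar>" if "x \<in> ball 0 r"
          proof -
            have "d / ennreal c \<le> ennreal \<bar>g x\<bar> / ennreal c"
              using elim that by (intro divide_right_mono_ennreal) auto
            also have "\<dots> = ennreal \<bar>g x / c\<bar>" using c by (simp add: divide_ennreal)
            finally have "ennreal \<tau> < ennreal \<bar>g x / c\<bar>" using t \<tau> by order
            then show ?thesis using \<tau> by (simp add: ennreal_less_iff)
          qed
          then show ?case by auto
        qed
      qed (use E in auto)
      then have "\<Phi> (ennreal \<tau>) * vol (0::'a) r \<le> ennreal (\<phi> r) * vol (0::'a) r"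
        using mod[unfolded weak_modular_le_def distr_fun_def, rule_format, OF r tau, of 0] by simp
      then have "\<Phi> (ennreal \<tau>) * vol (0::'a) r / vol (0::'a) r \<le> ennreal (\<phi> r)"
        using emeasure_lebesgue_ball_pos[OF r, of "0::'a"] emeasure_lebesgue_ball_finite[of "0::'a" r]
        by (subst ennreal_divide_le_iff) auto
      then have "\<Phi> (ennreal \<tau>) \<le> ennreal (\<phi> r)"
        using emeasure_lebesgue_ball_pos[OF r, of "0::'a"] emeasure_lebesgue_ball_finite[of "0::'a" r]
        by (subst (asm) ennreal_times_divide[symmetric]) (simp add: ennreal_divide_self)
      then show ?thesis using \<tau> by (simp add: le_G[OF r])
    qed (use \<tau> in simp)
  qed
  then show "d \<le> ennreal (c * G r)"
    using c G_pos[OF r] by (subst (asm) ennreal_divide_le_iff) (auto simp: ennreal_mult mult.commute)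
qed

text \<open>Here \<open>G\<close> is the weight of the target space itself, so it is enough to
  integrate the lower bound over the ball and divide by its volume.\<close>

lemma L1_norm_detects: "detects_lower_bounds (L1_norm G :: ('a::euclidean_space \<Rightarrow> real) \<Rightarrow> ennreal)"
  unfolding detects_lower_bounds_def
proof (intro allI impI)
  fix g :: "'a \<Rightarrow> real" and c r :: real and d :: ennreal
  assume g: "g \<in> borel_measurable lebesgue" and c: "0 < c" and r: "0 < r" and N: "L1_norm G g < ennreal c"
    and d: "AE x in lebesgue. x \<in> ball 0 r \<longrightarrow> d \<le> ennreal \<bar>g x\<bar>"
  let ?m = "vol (0::'a) r"
  have m: "0 < ?m" "?m < top" using emeasure_lebesgue_ball_pos[OF r] emeasure_lebesgue_ball_finite by auto
  have "modular_le (\<lambda>t. t) G (\<lambda>x. g x / c)"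
    using N unfolding L1_norm_def by (intro L_norm_lessD G_pos) (auto simp: mono_def)
  then have "(\<integral>\<^sup>+x\<in>ball 0 r. ennreal \<bar>g x / c\<bar> \<partial>lebesgue) \<le> ennreal (G r) * ?m"
    using r by (auto simp: modular_le_def)
  then have "abs_int (ball 0 r) g \<le> ennreal (G r) * ?m * ennreal c"
    using c unfolding nn_integral_abs_divide[OF g c] by (subst (asm) ennreal_divide_le_iff) auto
  moreover have "d * ?m \<le> abs_int (ball 0 r) g"
  proof -
    have "d * ?m = (\<integral>\<^sup>+x. d * indicator (ball (0::'a) r) x \<partial>lebesgue)"
      by (rule nn_integral_cmult_indicator[symmetric]) simp
    also have "\<dots> \<le> abs_int (ball 0 r) g"
      by (rule nn_integral_mono_AE) (use d in eventually_elim, auto simp: indicator_def)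
    finally show ?thesis .
  qed
  ultimately have "d * ?m \<le> (ennreal c * ennreal (G r)) * ?m" by (simp add: mult_ac)
  then have "d * ?m / ?m \<le> ennreal c * ennreal (G r)" using m by (subst ennreal_divide_le_iff) auto
  then show "d \<le> ennreal (c * G r)"
    using m c G_pos[OF r] by (subst (asm) ennreal_times_divide[symmetric]) (simp add: ennreal_divide_self ennreal_mult)
qed

end

section \<open>Lower bounds obtained from the test functions\<close>

context frac_setting
begin

text \<open>For F \<ge> 0 the convergence clause of boundedness makes the Bochner integral equal to
  the nonnegative integral almost everywhere, so a lower bound for the latter passes to
  \<open>frac_int\<close>. The factor 2 yields the strict norm bound in
  \<open>detects_lower_bounds\<close>.\<close>

lemma test_function_bound:
  fixes F :: "'a::euclidean_space \<Rightarrow> real" and N' :: "('a \<Rightarrow> real) \<Rightarrow> ennreal"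
  assumes det: "Q.detects_lower_bounds N'" and Cb: "0 < Cb"
    and bdd: "\<And>f. f \<in> fun_space (L_norm \<Phi> \<phi>) \<Longrightarrow>
        (AE x in lebesgue. frac_converges \<rho> f x) \<and> frac_int \<rho> f \<in> fun_space N' \<and> N' (frac_int \<rho> f) \<le> ennreal Cb * L_norm \<Phi> \<phi> f"
    and F: "F \<in> borel_measurable lebesgue" "\<And>y. 0 \<le> F y" and c0: "0 < c0" and mod: "modular_le \<Phi> \<phi> (\<lambda>x. F x / c0)"
    and r: "0 < r" and d: "\<And>x. x \<in> ball 0 r \<Longrightarrow> d \<le> (\<integral>\<^sup>+y. ennreal (frac_integrand \<rho> F x y) \<partial>lebesgue)"
  shows "d \<le> ennreal (2 * Cb * c0 * Q.G r)"
proof -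
  have norm: "L_norm \<Phi> \<phi> F \<le> ennreal c0" by (rule L_norm_leI[OF P.phi_pos c0 mod])
  then have "F \<in> fun_space (L_norm \<Phi> \<phi>)" using F by (auto simp: fun_space_def intro: le_less_trans)
  note b = bdd[OF this]
  have "N' (frac_int \<rho> F) \<le> ennreal Cb * ennreal c0"
    using b mult_left_mono[OF norm, of "ennreal Cb"] by (auto intro: order_trans)
  also have "\<dots> < ennreal (2 * Cb * c0)" using Cb c0 by (simp add: ennreal_mult[symmetric] ennreal_less_iff)
  finally have N: "N' (frac_int \<rho> F) < ennreal (2 * Cb * c0)" .
  have nonneg: "0 \<le> frac_integrand \<rho> F x y" if "y \<noteq> x" for x y
    using that F(2)[of y] rho_pos[of "norm (x - y)"] by (simp add: frac_integrand_def)
  have "AE x in lebesgue. x \<in> ball 0 r \<longrightarrow> d \<le> ennreal \<bar>frac_int \<rho> F x\<bar>"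
    using b[THEN conjunct1]
  proof eventually_elim
    case (elim x)
    have nn: "AE y in lebesgue. 0 \<le> frac_integrand \<rho> F x y"
    proof (rule AE_completion)
      have "AE y in lborel. y \<noteq> x" by (simp add: AE_lborel_singleton)
      then show "AE y in lborel. 0 \<le> frac_integrand \<rho> F x y" by eventually_elim (rule nonneg)
    qed
    have "(\<integral>\<^sup>+y. ennreal (frac_integrand \<rho> F x y) \<partial>lebesgue) = ennreal (frac_int \<rho> F x)"
      unfolding frac_int_def by (rule nn_integral_eq_integral[OF elim[unfolded frac_converges_def] nn])
    also have "\<dots> \<le> ennreal \<bar>frac_int \<rho> F x\<bar>" by (intro ennreal_leI) simp
    finally show ?case using d[of x] by (auto intro: order_trans)
  qed
  then show ?thesis
    using det[unfolded Q.detects_lower_bounds_def, rule_format, OF measurable_frac_int[OF F(1)] _ r N] Cb c0 by simp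
qed

text \<open>In polar coordinates around x, a minorant h of F that is radial about x reduces the
  operator to a one-dimensional integral, the form in which the conditions are stated.\<close>

lemma radial_lower_bound:
  fixes F :: "'a::euclidean_space \<Rightarrow> real" and h :: "real \<Rightarrow> ennreal"
  assumes [measurable]: "h \<in> borel_measurable borel"
    and le: "AE y in lborel. y \<noteq> x \<longrightarrow> h (norm (x - y)) \<le> ennreal (F y)"
  shows "ennreal (sphere_area TYPE('a)) * (\<integral>\<^sup>+t\<in>{0<..}. ennreal (rhob t / t) * h t \<partial>lborel) \<le>
    (\<integral>\<^sup>+y. ennreal (frac_integrand \<rho> F x y) \<partial>lebesgue)"
proof -
  have "ennreal (sphere_area TYPE('a)) * (\<integral>\<^sup>+t\<in>{0<..}. ennreal (rhob t / t) * h t \<partial>lborel) =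
    (\<integral>\<^sup>+z. ennreal (rhob (norm z) / norm z ^ DIM('a)) * h (norm (z :: 'a)) \<partial>lborel)"
    by (rule nn_integral_radial_kernel[symmetric]) (auto intro: rhob_nonneg)
  also have "\<dots> = (\<integral>\<^sup>+y. ennreal (rhob (norm (x - y)) / norm (x - y) ^ DIM('a)) * h (norm (x - y)) \<partial>lborel)"
    by (rule nn_integral_lborel_reflect[symmetric]) measurable
  also have "\<dots> \<le> (\<integral>\<^sup>+y. ennreal (frac_integrand \<rho> F x y) \<partial>lebesgue)"
    unfolding nn_integral_completion
  proof (rule nn_integral_mono_AE)
    have "AE y in lborel. y \<noteq> x" by (simp add: AE_lborel_singleton)
    then show "AE y in lborel. ennreal (rhob (norm (x - y)) / norm (x - y) ^ DIM('a)) * h (norm (x - y)) \<le> ennreal (frac_integrand \<rho> F x y)"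
      using AE_norm_lborel[OF rhob_AE, of x] le
    proof eventually_elim
      case (elim y)
      have "ennreal (rhob (norm (x - y)) / norm (x - y) ^ DIM('a)) * h (norm (x - y)) \<le>
        ennreal (rhob (norm (x - y)) / norm (x - y) ^ DIM('a)) * ennreal (F y)"
        using elim by (intro mult_left_mono) auto
      also have "\<dots> = ennreal (frac_integrand \<rho> F x y)"
        using elim rhob_nonneg[of "norm (x - y)"] by (simp add: frac_integrand_def ennreal_mult'[symmetric])
      finally show ?case .
    qed
  qed
  finally show ?thesis .
qed

text \<open>For |x| < r the ball of radius r around x lies in \<open>ball 0 (2 * r)\<close>, so the
  operator applied to the indicator is at least a constant times \<open>rho_int \<rho> r\<close> at
  x. The norm of the indicator is at most of order 1 / G(2 r), and \<open>G_comp\<close> returns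
  from 2 r to r.\<close>

lemma near_necessary:
  fixes N' :: "('a::euclidean_space \<Rightarrow> real) \<Rightarrow> ennreal"
  assumes n: "n = DIM('a)" and det: "Q.detects_lower_bounds N'" and bdd: "frac_int_bounded \<rho> (L_norm \<Phi> \<phi>) N'"
  shows "\<exists>A>0. near_cond \<Phi> \<Psi> \<phi> \<rho> A"
proof -
  obtain Cb where Cb: "0 < Cb" and b: "\<And>f. f \<in> fun_space (L_norm \<Phi> \<phi>) \<Longrightarrow>
        (AE x in lebesgue. frac_converges \<rho> f x) \<and> frac_int \<rho> f \<in> fun_space N' \<and> N' (frac_int \<rho> f) \<le> ennreal Cb * L_norm \<Phi> \<phi> f"
    using bdd by (auto simp: frac_int_bounded_def)
  let ?\<sigma> = "sphere_area TYPE('a)"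
  have gc: "1 \<le> P.Gc 2" by (rule P.Gc_ge_1) simp
  define A where "A = 4 * Cb * K * D * P.Gc 2 / ?\<sigma>"
  have A: "0 < A" using Cb P.K_ge_1 P.D_ge_1 gc sphere_area_pos[where 'a='a] by (simp add: A_def)
  have "rho_int \<rho> r * gen_inv \<Phi> (ennreal (\<phi> r)) \<le> ennreal A * gen_inv \<Psi> (ennreal (\<phi> r))" if r: "0 < r" for r
  proof -
    have r2: "0 < 2 * r" using r by simp
    define c0 where "c0 = 2 * K * D / P.G (2 * r)"
    have c0: "0 < c0" using P.K_ge_1 P.D_ge_1 P.G_pos[OF r2] by (simp add: c0_def)
    let ?F = "indicator (ball (0::'a) (2 * r)) :: 'a \<Rightarrow> real"
    have J: "rho_int \<rho> r = (\<integral>\<^sup>+t\<in>{0<..}. ennreal (rhob t / t) * indicator {..<r} t \<partial>lborel)"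
    proof -
      have "rho_int \<rho> r = (\<integral>\<^sup>+t\<in>{0<..<r}. ennreal (rhob t / t) \<partial>lborel)"
        unfolding rho_int_def by (rule nn_integral_rho') auto
      also have "\<dots> = (\<integral>\<^sup>+t\<in>{0<..}. ennreal (rhob t / t) * indicator {..<r} t \<partial>lborel)"
        by (rule nn_integral_cong) (auto simp: indicator_def)
      finally show ?thesis .
    qed
    have "ennreal ?\<sigma> * rho_int \<rho> r \<le> ennreal (2 * Cb * c0 * Q.G r)"
    proof (rule test_function_bound[OF det Cb b _ _ c0 _ r])
      show "?F \<in> borel_measurable lebesgue" by (intro borel_measurable_indicator) simp
      show "modular_le \<Phi> \<phi> (\<lambda>x. ?F x / c0)"
        unfolding c0_def by (rule P.modular_le_indicator_ball[OF n r2])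
      fix x :: 'a assume x: "x \<in> ball 0 r"
      have "AE y in lborel. y \<noteq> x \<longrightarrow> indicator {..<r} (norm (x - y)) \<le> ennreal (?F y)"
      proof (rule AE_I2, rule impI)
        fix y
        have "norm y \<le> norm (y - x) + norm x" using norm_triangle_ineq[of "y - x" x] by simp
        then show "indicator {..<r} (norm (x - y)) \<le> ennreal (?F y)"
          using x by (auto simp: indicator_def norm_minus_commute)
      qed
      then show "ennreal ?\<sigma> * rho_int \<rho> r \<le> (\<integral>\<^sup>+y. ennreal (frac_integrand \<rho> ?F x y) \<partial>lebesgue)"
        unfolding J by (intro radial_lower_bound) measurable
    qed simp_all
    then have "ennreal (P.Gc 2 * P.G (2 * r) / ?\<sigma>) * (ennreal ?\<sigma> * rho_int \<rho> r) \<le> ennreal (P.Gc 2 * P.G (2 * r) / ?\<sigma>) * ennreal (2 * Cb * c0 * Q.G r)"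
      by (rule mult_left_mono) simp
    also have "ennreal (P.Gc 2 * P.G (2 * r) / ?\<sigma>) * (ennreal ?\<sigma> * rho_int \<rho> r) = ennreal (P.Gc 2 * P.G (2 * r)) * rho_int \<rho> r"
      using sphere_area_pos[where 'a='a] gc P.G_pos[OF r2] by (subst ennreal_mult_assoc) auto
    also have "ennreal (P.Gc 2 * P.G (2 * r) / ?\<sigma>) * ennreal (2 * Cb * c0 * Q.G r) = ennreal (A * Q.G r)"
    proof -
      have "P.Gc 2 * P.G (2 * r) / ?\<sigma> * (2 * Cb * c0 * Q.G r) = A * Q.G r"
        using P.G_pos[OF r2] by (simp add: A_def c0_def field_simps)
      moreover have "0 \<le> P.Gc 2 * P.G (2 * r) / ?\<sigma>" "0 \<le> 2 * Cb * c0 * Q.G r"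
        using sphere_area_pos[where 'a='a] gc P.G_pos[OF r2] Q.G_pos[OF r] Cb c0 by simp_all
      ultimately show ?thesis by (simp only: ennreal_mult[symmetric])
    qed
    finally have 1: "ennreal (P.Gc 2 * P.G (2 * r)) * rho_int \<rho> r \<le> ennreal (A * Q.G r)" .
    have "P.G r \<le> P.Gc 2 * P.G (2 * r)" using r by (intro P.G_comp) auto
    then have "rho_int \<rho> r * ennreal (P.G r) \<le> ennreal (P.Gc 2 * P.G (2 * r)) * rho_int \<rho> r"
      by (subst mult.commute) (intro mult_right_mono ennreal_leI, auto)
    also note 1
    also have "ennreal (A * Q.G r) = ennreal A * ennreal (Q.G r)" using A Q.G_pos[OF r] by (simp add: ennreal_mult)
    finally show ?thesis using r by (simp add: P.G_eq Q.G_eq)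
  qed
  then show ?thesis using A by (auto simp: near_cond_def rho_int_def)
qed

text \<open>\<open>phi_int_cond\<close> gives \<open>radial_G\<close> a finite norm, so one function
  tests all r. If |x| < r < |x - y|, then |y| \<le> 2 |x - y|, hence \<open>radial_G\<close> at y is
  at least G(|x - y|) / Gc 2, and the part |x - y| > r of the operator dominates
  \<open>far_int r\<close>.\<close>

lemma full_necessary:
  fixes N' :: "('a::euclidean_space \<Rightarrow> real) \<Rightarrow> ennreal"
  assumes n: "n = DIM('a)" and det: "Q.detects_lower_bounds N'" and bdd: "frac_int_bounded \<rho> (L_norm \<Phi> \<phi>) N'"
    and meas: "\<phi> \<in> borel_measurable (lebesgue_on {0<..})" and phi_int: "phi_int_cond n \<phi>"
  shows "\<exists>A>0. full_cond \<Phi> \<Psi> \<phi> \<rho> A"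
proof -
  obtain Cb where Cb: "0 < Cb" and b: "\<And>f. f \<in> fun_space (L_norm \<Phi> \<phi>) \<Longrightarrow>
        (AE x in lebesgue. frac_converges \<rho> f x) \<and> frac_int \<rho> f \<in> fun_space N' \<and> N' (frac_int \<rho> f) \<le> ennreal Cb * L_norm \<Phi> \<phi> f"
    using bdd by (auto simp: frac_int_bounded_def)
  obtain B where B: "0 < B" "\<And>r. 0 < r \<Longrightarrow> (\<integral>\<^sup>+t\<in>{0<..<r}. ennreal (\<phi> t * t ^ (n - 1)) \<partial>lebesgue) \<le> ennreal (B * (\<phi> r * r ^ n))"
    using phi_int by (auto simp: phi_int_cond_def)
  obtain g where [measurable]: "g \<in> borel_measurable borel" and g: "AE t in lborel. 0 < t \<longrightarrow> P.G t = g t"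
    using P.G_borel_version[OF meas] by blast
  let ?\<sigma> = "sphere_area TYPE('a)"
  define L where "L = D + ?\<sigma> * B * D * 3 ^ n / unit_ball_vol (real n)"
  define c0 where "c0 = 2 * K * L"
  have gc: "1 \<le> P.Gc 2" by (rule P.Gc_ge_1) simp
  have "0 \<le> ?\<sigma> * B * D * 3 ^ n / unit_ball_vol (real n)"
    using B P.D_ge_1 less_imp_le[OF sphere_area_pos[where 'a='a]] by simp
  then have L: "1 \<le> L" using P.D_ge_1 by (simp add: L_def)
  have c0: "0 < c0" using P.K_ge_1 L by (simp add: c0_def)
  define A2 where "A2 = P.Gc 2 / ?\<sigma> * (2 * Cb * c0)"
  have A2: "0 < A2" using gc sphere_area_pos[where 'a='a] Cb c0 by (simp add: A2_def)
  obtain A1 where A1: "0 < A1" and near: "near_cond \<Phi> \<Psi> \<phi> \<rho> A1"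
    using near_necessary[OF n det bdd] by blast
  have far: "far_int r \<le> ennreal A2 * gen_inv \<Psi> (ennreal (\<phi> r))" if r: "0 < r" for r
  proof -
    \<comment> \<open>The same minorant works for every x in \<open>ball 0 r\<close>; g, the Borel
      version of G, makes it measurable.\<close>
    define h where "h t = indicator {r<..} t * ennreal (g t / P.Gc 2)" for t
    have [measurable]: "h \<in> borel_measurable borel" unfolding h_def by measurable
    have "far_int r = (\<integral>\<^sup>+t\<in>{r<..}. ennreal (rhob t / t) * gen_inv \<Phi> (ennreal (\<phi> t)) \<partial>lborel)"
      unfolding far_int_def using r by (intro nn_integral_rho) auto
    also have "\<dots> = (\<integral>\<^sup>+t. ennreal (P.Gc 2) * (ennreal (rhob t / t) * h t * indicator {0<..} t) \<partial>lborel)"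
    proof (rule nn_integral_cong_AE)
      show "AE t in lborel. ennreal (rhob t / t) * gen_inv \<Phi> (ennreal (\<phi> t)) * indicator {r<..} t =
        ennreal (P.Gc 2) * (ennreal (rhob t / t) * h t * indicator {0<..} t)"
        using g
      proof eventually_elim
        case (elim t)
        show ?case
        proof (cases "r < t")
          case True
          then have t: "0 < t" using r by simp
          have "ennreal (P.Gc 2) * ennreal (g t / P.Gc 2) = ennreal (P.G t)"
            using elim t gc P.G_pos[OF t] by (simp add: ennreal_mult[symmetric])
          then have "ennreal (P.Gc 2) * (ennreal (rhob t / t) * ennreal (g t / P.Gc 2)) = ennreal (rhob t / t) * ennreal (P.G t)"
            by (metis mult.left_commute)
          then show ?thesis using True t by (simp add: h_def P.G_eq)
        qed (simp add: h_def)
      qed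
    qed
    also have "\<dots> = ennreal (P.Gc 2) * (\<integral>\<^sup>+t\<in>{0<..}. ennreal (rhob t / t) * h t \<partial>lborel)"
      by (rule nn_integral_cmult) measurable
    finally have far_eq: "far_int r = ennreal (P.Gc 2) * (\<integral>\<^sup>+t\<in>{0<..}. ennreal (rhob t / t) * h t \<partial>lborel)" .
    have "ennreal ?\<sigma> * (\<integral>\<^sup>+t\<in>{0<..}. ennreal (rhob t / t) * h t \<partial>lborel) \<le> ennreal (2 * Cb * c0 * Q.G r)"
    proof (rule test_function_bound[OF det Cb b _ _ c0 _ r])
      show "P.radial_G \<in> borel_measurable (lebesgue :: 'a measure)" by (rule P.measurable_radial_G[OF meas])
      show "0 \<le> P.radial_G y" for y :: 'a using P.G_pos[of "norm y"] by (auto simp: P.radial_G_def)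
      show "modular_le \<Phi> \<phi> (\<lambda>x :: 'a. P.radial_G x / c0)"
        unfolding c0_def by (rule P.modular_le_radial_G[OF n meas B L_def])
      fix x :: 'a assume x: "x \<in> ball 0 r"
      have "AE y in lborel. y \<noteq> x \<longrightarrow> h (norm (x - y)) \<le> ennreal (P.radial_G y)"
        using AE_norm_lborel[OF g, of x]
      proof eventually_elim
        case (elim y)
        show ?case
        proof (cases "r < norm (x - y)")
          case True
          \<comment> \<open>Since y = 0 would give r < |x|.\<close>
          then have "y \<noteq> 0" using x by auto
          then have y: "0 < norm y" by simp
          have "norm y \<le> norm (x - y) + norm x" using norm_triangle_ineq[of "y - x" x] by (simp add: norm_minus_commute)
          then have "norm y \<le> 2 * norm (x - y)" using True x by simp
          then have "P.G (norm (x - y)) \<le> P.Gc 2 * P.G (norm y)" using y True r by (intro P.G_comp) auto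
          then have "P.G (norm (x - y)) / P.Gc 2 \<le> P.radial_G y"
            using gc \<open>y \<noteq> 0\<close> by (simp add: P.radial_G_def field_simps)
          moreover have "y \<noteq> x" using True r by auto
          ultimately show ?thesis using elim by (simp add: h_def indicator_def ennreal_leI)
        qed (simp add: h_def)
      qed
      then show "ennreal ?\<sigma> * (\<integral>\<^sup>+t\<in>{0<..}. ennreal (rhob t / t) * h t \<partial>lborel) \<le> (\<integral>\<^sup>+y. ennreal (frac_integrand \<rho> P.radial_G x y) \<partial>lebesgue)"
        by (intro radial_lower_bound) measurable
    qed
    then have "ennreal (P.Gc 2 / ?\<sigma>) * (ennreal ?\<sigma> * (\<integral>\<^sup>+t\<in>{0<..}. ennreal (rhob t / t) * h t \<partial>lborel)) \<le> ennreal (P.Gc 2 / ?\<sigma>) * ennreal (2 * Cb * c0 * Q.G r)"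
      by (rule mult_left_mono) simp
    also have "ennreal (P.Gc 2 / ?\<sigma>) * (ennreal ?\<sigma> * (\<integral>\<^sup>+t\<in>{0<..}. ennreal (rhob t / t) * h t \<partial>lborel)) = far_int r"
      unfolding far_eq using sphere_area_pos[where 'a='a] gc by (subst ennreal_mult_assoc) auto
    also have "ennreal (P.Gc 2 / ?\<sigma>) * ennreal (2 * Cb * c0 * Q.G r) = ennreal A2 * ennreal (Q.G r)"
      using sphere_area_pos[where 'a='a] gc Cb c0 Q.G_pos[OF r] by (simp add: ennreal_mult[symmetric] A2_def mult_ac)
    finally show ?thesis using r by (simp add: Q.G_eq)
  qed
  have "full_cond \<Phi> \<Psi> \<phi> \<rho> (A1 + A2)"
    unfolding full_cond_def
  proof (intro allI impI)
    fix r :: real assume r: "0 < r"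
    have "(\<integral>\<^sup>+t\<in>{0<..<r}. ennreal (\<rho> t / t) \<partial>lebesgue) * gen_inv \<Phi> (ennreal (\<phi> r)) \<le> ennreal A1 * gen_inv \<Psi> (ennreal (\<phi> r))"
      using near r by (simp add: near_cond_def)
    from add_mono[OF this far[OF r]]
    show "(\<integral>\<^sup>+t\<in>{0<..<r}. ennreal (\<rho> t / t) \<partial>lebesgue) * gen_inv \<Phi> (ennreal (\<phi> r))
       + (\<integral>\<^sup>+t\<in>{r<..}. ennreal (\<rho> t / t) * gen_inv \<Phi> (ennreal (\<phi> t)) \<partial>lebesgue)
       \<le> ennreal (A1 + A2) * gen_inv \<Psi> (ennreal (\<phi> r))"
      using A1 A2 by (simp add: far_int_def distrib_right)
  qed
  then show ?thesis using A1 A2 by (intro exI[of _ "A1 + A2"]) auto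
qed

end

theorem theorem3p4:
  fixes \<Phi> \<Psi> :: "ennreal \<Rightarrow> ennreal" and \<phi> \<rho> :: "real \<Rightarrow> real"
  assumes "\<Phi> \<in> Phi_Y_bar" and "\<Psi> \<in> Phi_Y_bar"
    and "\<phi> \<in> G_dec CARD('n::finite)"
    and "\<forall>t > 0. \<rho> t > 0"
    and "\<rho> \<in> borel_measurable (lebesgue_on {0<..})"
    and "(\<integral>\<^sup>+t\<in>{0<..<1}. ennreal (\<rho> t / t) \<partial>lebesgue) < top"
    and "\<exists>C K1 K2. 0 < C \<and> 0 < K1 \<and> K1 < K2 \<and>
           (\<forall>r > 0. (SUP t \<in> {r..2 * r}. ennreal (\<rho> t))
              \<le> ennreal C * (\<integral>\<^sup>+t\<in>{K1 * r<..<K2 * r}. ennreal (\<rho> t / t) \<partial>lebesgue))"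
  shows
    \<comment> \<open>(i)\<close>
    "((filterlim \<phi> at_top (at_right 0) \<and> (\<phi> \<longlongrightarrow> 0) at_top \<and>
       (\<lambda>t. gen_inv \<Phi> (ennreal (\<phi> t))) \<in> borel_measurable (lebesgue_on {0<..}) \<and>
       (\<exists>A > 0. full_cond \<Phi> \<Psi> \<phi> \<rho> A)) \<longrightarrow>
        (\<forall>C0 > 0. \<exists>C1 > 0.
           (\<forall>f \<in> fun_space (L_norm \<Phi> \<phi>). \<not> (AE x in lebesgue. f x = 0) \<longrightarrow>
              (\<forall>x :: real ^ 'n. pointwise_ineq \<Phi> \<Psi> \<rho> (L_norm \<Phi> \<phi>) C0 C1 f x)) \<and>
           (\<Phi> \<in> nabla2_bar \<longrightarrow>
             (\<forall>f \<in> fun_space (wL_norm \<Phi> \<phi>). \<not> (AE x in lebesgue. f x = 0) \<longrightarrow>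
                (\<forall>x :: real ^ 'n. pointwise_ineq \<Phi> \<Psi> \<rho> (wL_norm \<Phi> \<phi>) C0 C1 f x)))) \<and>
        frac_int_bounded \<rho> (L_norm \<Phi> \<phi> :: (real ^ 'n \<Rightarrow> real) \<Rightarrow> ennreal) (wL_norm \<Psi> \<phi>) \<and>
        (\<Phi> \<in> nabla2_bar \<longrightarrow>
           frac_int_bounded \<rho> (L_norm \<Phi> \<phi> :: (real ^ 'n \<Rightarrow> real) \<Rightarrow> ennreal) (L_norm \<Psi> \<phi>) \<and>
           frac_int_bounded \<rho> (wL_norm \<Phi> \<phi> :: (real ^ 'n \<Rightarrow> real) \<Rightarrow> ennreal) (wL_norm \<Psi> \<phi>)))
     \<and>
     \<comment> \<open>(ii)\<close>
     (frac_int_bounded \<rho> (L_norm \<Phi> \<phi> :: (real ^ 'n \<Rightarrow> real) \<Rightarrow> ennreal) (wL_norm \<Psi> \<phi>) \<longrightarrow>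
        (\<exists>A' > 0. near_cond \<Phi> \<Psi> \<phi> \<rho> A') \<and>
        (\<phi> \<in> borel_measurable (lebesgue_on {0<..}) \<and> phi_int_cond CARD('n) \<phi> \<longrightarrow>
           (\<exists>A > 0. full_cond \<Phi> \<Psi> \<phi> \<rho> A)))
     \<and>
     \<comment> \<open>(iii)\<close>
     (frac_int_bounded \<rho> (L_norm \<Phi> \<phi> :: (real ^ 'n \<Rightarrow> real) \<Rightarrow> ennreal) (L1_norm (inv_comp \<Psi> \<phi>)) \<longrightarrow>
        (\<exists>A' > 0. near_cond \<Phi> \<Psi> \<phi> \<rho> A') \<and>
        (\<phi> \<in> borel_measurable (lebesgue_on {0<..}) \<and> phi_int_cond CARD('n) \<phi> \<longrightarrow>
           (\<exists>A > 0. full_cond \<Phi> \<Psi> \<phi> \<rho> A)))"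
proof -
  have n: "CARD('n) = DIM(real ^ 'n)" by simp
  obtain K where P: "quasi_young \<Phi> K" using Phi_Y_bar_quasi_young[OF assms(1)] .
  obtain K' where Q: "quasi_young \<Psi> K'" using Phi_Y_bar_quasi_young[OF assms(2)] .
  obtain D where D: "almost_dec \<phi> CARD('n) D" using G_dec_almost_dec[OF assms(3)] .
  obtain C K1 K2 where C: "0 < C" "0 < K1" "K1 < K2"
    and sup: "\<And>r. 0 < r \<Longrightarrow> (SUP t \<in> {r..2 * r}. ennreal (\<rho> t)) \<le> ennreal C * (\<integral>\<^sup>+t\<in>{K1 * r<..<K2 * r}. ennreal (\<rho> t / t) \<partial>lebesgue)"
    using assms(7) by blast
  have kernel: "frac_kernel \<rho> C K1 K2"
  proof
    fix r :: real assume r: "0 < r"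
    then have "ennreal (\<rho> r) \<le> (SUP t \<in> {r..2 * r}. ennreal (\<rho> t))" by (intro SUP_upper) auto
    also note sup[OF r]
    finally show "ennreal (\<rho> r) \<le> ennreal C * (\<integral>\<^sup>+t\<in>{K1 * r<..<K2 * r}. ennreal (\<rho> t / t) \<partial>lebesgue)" .
  qed (use assms C in auto)
  interpret frac_setting \<Phi> K \<phi> "CARD('n)" D \<Psi> K' \<rho> C K1 K2
    by (intro frac_setting.intro orlicz_morrey.intro P Q D kernel)
  note wL = Q.wL_norm_detects[where 'a = "real ^ 'n"] and L1 = Q.L1_norm_detects[where 'a = "real ^ 'n"]
  show ?thesis
    \<comment> \<open>The last two parts differ only in the target norm, and both target norms
      detect lower bounds, so the same two lemmas serve each.\<close>
    using sufficiency[OF n] near_necessary[OF n wL] full_necessary[OF n wL] near_necessary[OF n L1] full_necessary[OF n L1]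
    by (intro conjI impI) blast+
qed

end
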